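(* Let $(X_n)_{n\in\mathbb{N}}$ be a stochastic growth model with drift function $g$ and conditional variance function $\sigma^2$ (see context). Assume: (A1) $g$ is positive, differentiable, and $g(x)=o(x)$ as $x\to\infty$. (A2) There exist $M>0$, $c_1>0$ and $\varepsilon>0$ such that for all $x>M$ and all $y>(1-\varepsilon)x$, $xg(x)\le c_1\,y g(y)$. (A3) There exist $\delta>0$ and a constant $C>0$ such that for all $n\in\mathbb{N}$, $\mathbb{E}(|\xi_n|^{4+\delta}\mid\mathcal{F}_n)\le C\sigma^{4+\delta}(X_n)$ almost surely. Assume moreover that there exist $\lambda>0$ and $\theta\in(0,1)$ such that $$\lim_{x\to\infty}\frac{g'(x)x}{g(x)}=1-\lambda\qquad\text{and}\qquad \lim_{x\to\infty}\frac{2xg(x)}{\sigma^2(x)}=\theta .$$ Then there exists $A>0$ such that for all $x_0\in\mathcal{X}\cap(A,\infty)$ and all $\alpha,\beta$ with $0<\alpha<1-\theta<\beta$, there exist two positive constants $C_\alpha$ and $C_\beta$ such that for all $n\in\mathbb{N}$, $$\frac{C_\beta}{\ell_\beta(n)}\le \mathbb{P}_{x_0}(\tau_A>n)\le\frac{C_\alpha}{\ell_\alpha(n)},$$ where $\tau_A=\inf\{n\in\mathbb{N}: X_n\le A\}$.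
   Context: Setting: $\mathcal{X}$ is an unbounded subset of $\mathbb{R}_+=[0,\infty)$, and $(X_n)_{n\in\mathbb{N}}$ is a stochastic process with values in $\mathcal{X}$, adapted to a filtration $(\mathcal{F}_n)_{n\in\mathbb{N}}$, satisfying $$X_{n+1}=X_n+g(X_n)+\xi_n,$$ where $g$ is a given function on $\mathbb{R}_+$ (if $g$ is originally defined only on a discrete subset of $\mathbb{R}_+$, a differentiable continuation to $\mathbb{R}_+$ is used) and $(\xi_n)$ are random variables with, almost surely, $\mathbb{E}(\xi_n\mid\mathcal{F}_n)=0$ and $\mathbb{E}(\xi_n^2\mid\mathcal{F}_n)=\sigma^2(X_n)<\infty$ for a positive function $\sigma^2$; $\sigma^{p}$ denotes $(\sigma^2)^{p/2}$. $\mathbb{P}_{x_0}$ denotes probability when the process is started from $X_0=x_0$ (with the same $g$, $\sigma^2$, $\delta$, $C$ for every starting point). Notation: $G(x)=\int_1^x \frac{dy}{g(y)}$, and for $\alpha>0$, $\ell_\alpha(x)=\left(G^{-1}(x)\right)^\alpha$. *)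

theory Defs
  imports "HOL-Probability.Probability"
begin

text \<open>
  One process started from \<open>x0\<close>, i.e. the objects living under \<open>\<P>\<^sub>x\<^sub>0\<close>.
  The functions \<open>g\<close> and \<open>sigma2\<close> (the conditional variance \<open>\<sigma>\<^sup>2\<close>) are functions on \<open>[0,\<infinity>)\<close>;
  their values at negative arguments never matter.

  Conditional expectations are taken in the extended sense: neither \<open>\<xi> n\<close> nor \<open>(\<xi> n)\<^sup>2\<close> is
  required to be integrable. \<open>nn_cond_exp\<close> makes sense for every nonnegative measurable function,
  and finiteness of the conditional second moment makes the conditional expectations of the
  positive and negative parts of \<open>\<xi> n\<close> almost surely finite, so that \<open>real_cond_exp\<close>, which is
  their difference, has its intended meaning.
\<close>

locale stochastic_growth_process =
  prob_space M + filtration "space M" F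
  for M :: "'a measure" and F :: "nat \<Rightarrow> 'a measure" +
  fixes S :: "real set" and g sigma2 :: "real \<Rightarrow> real" and x0 :: real
    and X \<xi> :: "nat \<Rightarrow> 'a \<Rightarrow> real"
  assumes subalgebra_F: "\<And>n. subalgebra M (F n)"
    and adapted: "\<And>n. X n \<in> borel_measurable (F n)"
    and in_state_space: "\<And>n \<omega>. \<omega> \<in> space M \<Longrightarrow> X n \<omega> \<in> S"
    and start: "AE \<omega> in M. X 0 \<omega> = x0"
    and noise_measurable: "\<And>n. \<xi> n \<in> borel_measurable M"
    and step: "\<And>n \<omega>. \<omega> \<in> space M \<Longrightarrow> X (Suc n) \<omega> = X n \<omega> + g (X n \<omega>) + \<xi> n \<omega>"
    and noise_mean: "\<And>n. AE \<omega> in M. real_cond_exp M (F n) (\<xi> n) \<omega> = 0"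
    and noise_variance:
      "\<And>n. AE \<omega> in M. nn_cond_exp M (F n) (\<lambda>\<omega>. ennreal ((\<xi> n \<omega>)\<^sup>2)) \<omega> = ennreal (sigma2 (X n \<omega>))"

definition growth_G :: "(real \<Rightarrow> real) \<Rightarrow> real \<Rightarrow> real" where
  "growth_G g x = (LBINT y=ereal 1..ereal x. 1 / g y)"

text \<open>For positive continuous \<open>g\<close>, \<open>G\<close> is strictly increasing on \<open>[0,\<infinity>)\<close>, the domain of \<open>g\<close>; \<open>G\<^sup>-\<^sup>1\<close> is the inverse there.\<close>

definition growth_ell :: "(real \<Rightarrow> real) \<Rightarrow> real \<Rightarrow> real \<Rightarrow> real" where
  "growth_ell g \<alpha> x = (inv_into {0..} (growth_G g) x) powr \<alpha>"

text \<open>The value is \<open>\<infinity>\<close> if the process never enters \<open>(-\<infinity>, A]\<close>.\<close>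

definition growth_tau :: "(nat \<Rightarrow> 'a \<Rightarrow> real) \<Rightarrow> real \<Rightarrow> 'a \<Rightarrow> enat" where
  "growth_tau X A \<omega> = Inf {enat n | n. X n \<omega> \<le> A}"

end

theory Submission
  imports Defs
begin

text \<open>
Write \<open>rate x = g x / x\<close>. Far out the conditional variance is close to \<open>2 x g(x) / \<theta>\<close>, so one step changes
\<open>f X\<close> in expectation by about \<open>g(x) (f' x + x f'' x / \<theta>)\<close>. For \<open>f x = x powr p\<close> this is a multiple of
\<open>p (p - (1 - \<theta>)) rate x f x\<close>: powers below \<open>1 - \<theta>\<close> decrease in mean and powers above it increase. Noise
enters only through mean 0, second moment 1 and a bounded moment of order \<open>4 + \<delta>\<close> of \<open>\<xi> / \<sigma>\<close>, because all third
order terms are \<open>o(rate x)\<close>. Time is measured by \<open>clock = G\<^sup>-\<^sup>1\<close>, which solves \<open>x' = g x\<close>; the limit of \<open>x g' x / g x\<close>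
makes \<open>rate\<close> decrease like \<open>x powr - lam\<close> up to small powers, so that \<open>n rate (clock n)\<close> stays bounded.

Upper bound. With \<open>n\<close> steps to go, \<open>min 1 (K f(x) / clock n powr p)\<close> dominates the survival probability, for
\<open>f\<close> close to \<open>x powr p\<close>, \<open>p = \<alpha>\<close>. Where the fraction exceeds 1 there is nothing to prove. Where it is below
1, \<open>x\<close> is a small multiple of \<open>clock n\<close>, hence \<open>rate x\<close> is a large multiple of \<open>rate (clock n)\<close>, and the
decrease of \<open>f X\<close> in mean beats the decrease of \<open>clock n powr p\<close> in \<open>n\<close> (\<open>clock_decay\<close>). Minima of
supermartingales are supermartingales, so comparing times 0 and \<open>n\<close> gives \<open>survival_upper\<close>.

Lower bound. Fix \<open>R = clock n\<close> and use the bounded function \<open>u x = x powr p / (R powr p + x powr p)\<close>, \<open>p = \<beta>\<close>.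
Where \<open>u\<close> is small it behaves like a power above \<open>1 - \<theta>\<close> and grows in mean; elsewhere \<open>x\<close> is of order at
least \<open>R\<close> and one step loses at most a factor \<open>1 - c / n\<close>. Over \<open>n\<close> steps this costs a constant factor.
Since \<open>u \<le> 1\<close>, the survival probability is therefore at least a constant times the value of \<open>u\<close> at a fixed
point, which is of order \<open>1 / clock n powr p\<close> (\<open>survival_lower\<close>). As \<open>clock n \<ge> 1\<close>, the bound weakens when \<open>\<beta>\<close>
grows, and it suffices to treat \<open>\<beta> < 1\<close>.

The level \<open>A\<close> must not depend on \<open>\<alpha>\<close> and \<open>\<beta>\<close>, but the signs above are right only beyond a level \<open>B\<close> that does.
Between \<open>A\<close> and \<open>B\<close> only this is used: the moment bounds give, uniformly, a positive probability to move up, or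
down, by a fixed amount (\<open>jump_chance\<close>). For the lower bound the process first climbs above \<open>2 B\<close> in a fixed
number of steps. For the upper bound a multiple of \<open>1 - exp (- \<kappa> x)\<close> is added to the power; for large \<open>\<kappa>\<close>
the chance of a downward jump makes it a supermartingale that decreases strictly on \<open>(A, B]\<close>.

The process is adapted but need not be Markov, so restarting arguments are replaced by test functions, whose
conditional expectations are tested against bounded weights that are measurable at the present time.
\<close>

section \<open>Expansion of a power\<close>

lemma abs_powr_1_minus_1_le:
  fixes t p :: real
  assumes "-1 \<le> t" "0 < p" "p < 1"
  shows "\<bar>(1 + t) powr p - 1\<bar> \<le> \<bar>t\<bar>"
proof (cases "0 \<le> t")
  case True
  have "(1+t) powr p \<le> (1+t) powr 1" using True assms by (intro powr_mono) auto
  moreover have "1 \<le> (1+t) powr p" using True assms by (simp add: ge_one_powr_ge_zero)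
  ultimately show ?thesis using True by simp
next
  case False
  show ?thesis
  proof (cases "t = -1")
    case True then show ?thesis using assms by simp
  next
    case t: False
    have "(1+t) powr 1 \<le> (1+t) powr p" using False t assms by (intro powr_mono') auto
    moreover have "(1+t) powr p \<le> 1" using False t assms by (intro powr_le1) auto
    ultimately show ?thesis using False t assms by simp
  qed
qed

text \<open>
The error is cubic on the whole half line \<open>t \<ge> -1\<close>: near 0 by Taylor's formula, elsewhere because every term
is at most linear or quadratic. So no truncation of the increments is needed later.
\<close>

lemma powr_taylor2:
  fixes t p :: real
  assumes t: "-1 \<le> t" and p: "0 < p" "p < 1"
  shows "\<bar>(1 + t) powr p - (1 + p * t - p * (1 - p) / 2 * t\<^sup>2)\<bar> \<le> 16 * \<bar>t\<bar> ^ 3"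
proof (cases "\<bar>t\<bar> \<le> 1/2")
  case small: True
  show ?thesis
  proof (cases "t = 0")
    case True then show ?thesis by simp
  next
    case False
    define d :: "nat \<Rightarrow> real \<Rightarrow> real" where
      "d m x = (if m = 0 then (1+x) powr p else if m = 1 then p * (1+x) powr (p-1)
        else if m = 2 then p * (p-1) * (1+x) powr (p-2) else p * (p-1) * (p-2) * (1+x) powr (p-3))" for m x
    have d_fun: "d 0 = (\<lambda>x. (1+x) powr p)" "d (Suc 0) = (\<lambda>x. p * (1+x) powr (p-1))"
      "d 2 = (\<lambda>x. p * (p-1) * (1+x) powr (p-2))" "d (Suc (Suc 0)) = (\<lambda>x. p * (p-1) * (1+x) powr (p-2))"
      "d 3 = (\<lambda>x. p * (p-1) * (p-2) * (1+x) powr (p-3))"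
      "d (Suc 2) = (\<lambda>x. p * (p-1) * (p-2) * (1+x) powr (p-3))"
      by (auto simp: d_def fun_eq_iff)
    have der: "\<forall>m u. m < 3 \<and> -1/2 \<le> u \<and> u \<le> 1/2 \<longrightarrow> (d m has_real_derivative d (Suc m) u) (at u)"
    proof (intro allI impI)
      fix m :: nat and u :: real assume a: "m < 3 \<and> -1/2 \<le> u \<and> u \<le> 1/2"
      have dd: "((\<lambda>x. (1+x) powr e) has_real_derivative e * (1+u) powr (e-1)) (at u)" for e
        using a by (auto intro!: derivative_eq_intros)
      have "m = 0 \<or> m = 1 \<or> m = 2" using a by auto
      then show "(d m has_real_derivative d (Suc m) u) (at u)"
        using DERIV_cmult[OF dd, of p "p-1"] DERIV_cmult[OF dd, of "p*(p-1)" "p-2"] dd[of p]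
        by (auto simp: d_fun mult.assoc)
    qed
    obtain s where s: "if t < 0 then t < s \<and> s < 0 else 0 < s \<and> s < t"
      "(1+t) powr p = (\<Sum>m<3. d m 0 / fact m * (t - 0) ^ m) + d 3 s / fact 3 * (t - 0) ^ 3"
    proof -
      have "\<exists>s. (if t < 0 then t < s \<and> s < 0 else 0 < s \<and> s < t) \<and>
          (1+t) powr p = (\<Sum>m<3. d m 0 / fact m * (t - 0) ^ m) + d 3 s / fact 3 * (t - 0) ^ 3"
        by (rule Taylor[of 3 d _ "-1/2" "1/2" 0 t, OF _ d_fun(1) der]) (use small False in auto)
      then show ?thesis using that by blast
    qed
    have e: "(1 + t) powr p - (1 + p * t - p * (1 - p) / 2 * t\<^sup>2) = p * (p-1) * (p-2) / 6 * (1+s) powr (p-3) * t^3"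
      unfolding s(2) by (simp add: numeral_3_eq_3 d_def fact_numeral field_simps power2_eq_square)
    have s2: "1/2 \<le> 1 + s" using s(1) small by (auto split: if_splits)
    have "(1+s) powr (p-3) \<le> (1/2) powr (p-3)"
      using s2 p by (intro powr_mono2') auto
    also have "\<dots> \<le> (1/2) powr (-3)" using p by (intro powr_mono') auto
    also have "\<dots> = 8" by (simp add: powr_minus_divide power3_eq_cube)
    finally have b1: "(1+s) powr (p-3) \<le> 8" .
    have b2: "\<bar>p * (p-1) * (p-2) / 6\<bar> \<le> 2"
    proof -
      have "\<bar>p\<bar> * \<bar>p-1\<bar> * \<bar>p-2\<bar> \<le> 1 * 1 * 2" using p by (intro mult_mono) auto
      then show ?thesis by (simp add: abs_mult)
    qed
    have "\<bar>p * (p-1) * (p-2) / 6 * (1+s) powr (p-3) * t^3\<bar> = \<bar>p * (p-1) * (p-2) / 6\<bar> * (1+s) powr (p-3) * \<bar>t\<bar>^3"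
      by (simp add: abs_mult power_abs)
    also have "\<dots> \<le> 2 * 8 * \<bar>t\<bar>^3" using b1 b2 by (intro mult_mono) auto
    finally show ?thesis unfolding e by simp
  qed
next
  case False
  have a: "\<bar>(1 + t) powr p - 1\<bar> \<le> \<bar>t\<bar>" by (rule abs_powr_1_minus_1_le) (use t p in auto)
  have b: "\<bar>p * t\<bar> \<le> \<bar>t\<bar>" using p by (simp add: abs_mult mult_left_le_one_le)
  have c: "\<bar>p * (1 - p) / 2 * t\<^sup>2\<bar> \<le> t\<^sup>2"
  proof -
    have "p * (1-p) \<le> 1 * 1" using p by (intro mult_mono) auto
    then have "p * (1-p) / 2 * t\<^sup>2 \<le> 1 * t\<^sup>2" by (intro mult_right_mono) auto
    then show ?thesis using p by (simp add: abs_mult)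
  qed
  have d: "t\<^sup>2 \<le> 2 * \<bar>t\<bar>^3"
  proof -
    have "\<bar>t\<bar>^2 * 1 \<le> \<bar>t\<bar>^2 * (2 * \<bar>t\<bar>)" using False by (intro mult_left_mono) auto
    then show ?thesis by (simp add: power3_eq_cube power2_eq_square algebra_simps)
  qed
  have e: "\<bar>t\<bar> \<le> 4 * \<bar>t\<bar>^3"
  proof -
    have "\<bar>t\<bar> * 1 \<le> \<bar>t\<bar> * (2 * \<bar>t\<bar>)" using False by (intro mult_left_mono) auto
    then show ?thesis using d by (simp add: power2_eq_square)
  qed
  have "\<bar>(1 + t) powr p - (1 + p * t - p * (1 - p) / 2 * t\<^sup>2)\<bar> \<le> \<bar>t\<bar> + \<bar>t\<bar> + t\<^sup>2"
    using a b c by linarith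
  also have "\<dots> \<le> 16 * \<bar>t\<bar>^3" using d e by linarith
  finally show ?thesis .
qed

text \<open>
This bounds third moments of the increment by its moment of order \<open>q\<close> without an appeal to Jensen's inequality.
\<close>

lemma abs_add_cubed_le:
  fixes r s y q :: real
  assumes "0 \<le> r" "0 \<le> s" "3 \<le> q"
  shows "\<bar>r + s * y\<bar> ^ 3 \<le> 4 * (r ^ 3 + s ^ 3 * (1 + \<bar>y\<bar> powr q))"
proof -
  have conv: "(u + v) ^ 3 \<le> 4 * (u ^ 3 + v ^ 3)" if "0 \<le> u" "0 \<le> v" for u v :: real
  proof -
    have "4 * (u^3+v^3) - (u+v)^3 = 3 * (u+v) * (u-v)^2"
      by (simp add: power3_eq_cube power2_eq_square algebra_simps)
    also have "\<dots> \<ge> 0" using that by simp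
    finally show ?thesis by simp
  qed
  have y3: "\<bar>y\<bar> ^ 3 \<le> 1 + \<bar>y\<bar> powr q"
  proof (cases "\<bar>y\<bar> \<le> 1")
    case True
    then have "\<bar>y\<bar>^3 \<le> 1" by (intro power_le_one) auto
    then show ?thesis by (simp add: add_increasing2)
  next
    case False
    then have "\<bar>y\<bar> powr 3 \<le> \<bar>y\<bar> powr q" using assms by (intro powr_mono) auto
    then show ?thesis using False by (simp add: powr_numeral)
  qed
  have "\<bar>r + s * y\<bar> ^ 3 \<le> (r + s * \<bar>y\<bar>) ^ 3"
    using assms by (intro power_mono order.trans[OF abs_triangle_ineq]) (auto simp: abs_mult)
  also have "\<dots> \<le> 4 * (r^3 + (s * \<bar>y\<bar>)^3)" using assms by (intro conv) auto
  also have "\<dots> \<le> 4 * (r ^ 3 + s ^ 3 * (1 + \<bar>y\<bar> powr q))"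
    using assms y3 by (simp add: power_mult_distrib mult_left_mono)
  finally show ?thesis .
qed

section \<open>Test functions for the two bounds\<close>

text \<open>
The bounded second term repairs the sign of the drift on a bounded interval.
\<close>

definition lyapunov :: "real \<Rightarrow> real \<Rightarrow> real \<Rightarrow> real \<Rightarrow> real" where
  "lyapunov p D \<kappa> x = x powr p + D * (1 - exp (- \<kappa> * x))"

lemma lyapunov_meas [measurable]: "lyapunov p D \<kappa> \<in> borel_measurable borel"
  unfolding lyapunov_def[abs_def] by measurable

lemma lyapunov_ge: "0 \<le> D \<Longrightarrow> 0 \<le> \<kappa> \<Longrightarrow> 0 \<le> x \<Longrightarrow> x powr p \<le> lyapunov p D \<kappa> x"
  by (simp add: lyapunov_def)

text \<open>
This is \<open>x powr p / R powr p\<close> up to a constant factor for \<open>x \<le> R\<close>, but it never exceeds 1,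
so that it can be compared with a survival probability.
\<close>

definition saturated :: "real \<Rightarrow> real \<Rightarrow> real \<Rightarrow> real" where
  "saturated p R x = x powr p / (R powr p + x powr p)"

lemma saturated_bounds: "0 < R \<Longrightarrow> 0 \<le> saturated p R x \<and> saturated p R x < 1"
  by (simp add: saturated_def add_pos_nonneg)

lemma saturated_mono: "0 < p \<Longrightarrow> 0 < R \<Longrightarrow> 0 \<le> x \<Longrightarrow> x \<le> y \<Longrightarrow> saturated p R x \<le> saturated p R y"
proof -
  assume a: "0 < p" "0 < R" "0 \<le> x" "x \<le> y"
  have "x powr p \<le> y powr p" using a by (intro powr_mono2) auto
  then have "R powr p * x powr p \<le> R powr p * y powr p" by (intro mult_left_mono) auto
  moreover have "0 < R powr p + x powr p" "0 < R powr p + y powr p" using a by (auto intro: add_pos_nonneg)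
  ultimately show ?thesis unfolding saturated_def
    by (simp add: pos_divide_le_eq pos_le_divide_eq) (simp add: algebra_simps)
qed

lemma saturated_small: "0 < p \<Longrightarrow> 0 < u \<Longrightarrow> 0 < B \<Longrightarrow> B / u powr (1/p) \<le> R \<Longrightarrow> saturated p R B \<le> u"
proof -
  assume a: "0 < p" "0 < u" "0 < B" "B / u powr (1/p) \<le> R"
  have "(B / u powr (1/p)) powr p \<le> R powr p" using a by (intro powr_mono2) auto
  then have "B powr p / u \<le> R powr p" using a by (simp add: powr_divide powr_powr)
  then have "B powr p \<le> u * R powr p" using a by (simp add: field_simps)
  also have "\<dots> \<le> u * (R powr p + B powr p)" using a by simp
  finally show ?thesis using a by (simp add: saturated_def pos_divide_le_eq add_nonneg_pos)
qed

lemma saturated_large: "0 < p \<Longrightarrow> 0 < u \<Longrightarrow> 0 < R \<Longrightarrow> 0 \<le> x \<Longrightarrow> u < saturated p R x \<Longrightarrow> u powr (1/p) * R \<le> x"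
proof (rule ccontr)
  assume a: "0 < p" "0 < u" "0 < R" "0 \<le> x" "u < saturated p R x" and n: "\<not> u powr (1/p) * R \<le> x"
  have "x powr p \<le> (u powr (1/p) * R) powr p" using a n by (intro powr_mono2) auto
  also have "\<dots> = u * R powr p" using a by (simp add: powr_mult powr_powr)
  finally have "x powr p \<le> u * (R powr p + x powr p)" using a by (simp add: distrib_left add_increasing2)
  then have "saturated p R x \<le> u" using a by (simp add: saturated_def pos_divide_le_eq add_pos_nonneg)
  then show False using a by simp
qed

text \<open>
If \<open>q = z / (k + z)\<close> and \<open>z\<close> is replaced by \<open>z (1 + d)\<close>, the new ratio is \<open>q (1 + d) / (1 + q d)\<close>. The lower
bound is its expansion to second order in \<open>d\<close>; the factor \<open>1 - q\<close> cancels the possible smallness of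
\<open>1 + q d\<close> for \<open>d\<close> close to \<open>-1\<close>, so the cubic error is uniform in \<open>q\<close>.
\<close>

lemma saturated_ge:
  fixes q d :: real
  assumes q: "0 \<le> q" "q < 1" and d: "-1 \<le> d"
  shows "q + q * (1 - q) * (d - q * d\<^sup>2) - q * \<bar>d\<bar> ^ 3 \<le> q * (1 + d) / (1 + q * d)"
proof -
  have pos: "1 + q * d > 0"
  proof -
    have "q * d \<ge> q * (-1)" using q d by (intro mult_left_mono) auto
    then show ?thesis using q by simp
  qed
  have qd: "1 - q \<le> 1 + q * d" using mult_left_mono[OF d q(1)] by simp
  have "q * (1 + d) / (1 + q * d) - q - q * (1 - q) * (d - q * d\<^sup>2) = q * ((1-q) * q\<^sup>2 * d^3 / (1 + q*d))"
    using pos by (simp add: field_simps power2_eq_square power3_eq_cube)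
  also have "\<dots> \<ge> q * (- (\<bar>d\<bar>^3))"
  proof (intro mult_left_mono q)
    have "\<bar>(1-q) * q\<^sup>2 * d^3 / (1 + q*d)\<bar> = ((1-q) / (1+q*d)) * q\<^sup>2 * \<bar>d\<bar>^3"
      using q pos by (simp add: abs_mult power_abs)
    also have "\<dots> \<le> 1 * 1 * \<bar>d\<bar>^3"
      using q qd pos by (intro mult_mono) (auto simp: power_le_one)
    finally have "\<bar>(1-q) * q\<^sup>2 * d^3 / (1 + q*d)\<bar> \<le> \<bar>d\<bar>^3" by simp
    from abs_le_D2[OF this] show "- (\<bar>d\<bar>^3) \<le> (1-q) * q\<^sup>2 * d^3 / (1 + q*d)" by linarith
  qed
  finally show ?thesis by simp
qed

text \<open>
The previous expansion is composed with the one of \<open>(1 + t) powr p\<close>. In the quadratic term the crude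
bound \<open>d\<^sup>2 \<le> t\<^sup>2\<close> is enough, since it carries a factor \<open>u\<close> and the sign of the drift matters only for small \<open>u\<close>.
\<close>

lemma saturated_pointwise:
  assumes p: "0 < p" "p < 1" and R: "0 < R" and x: "0 < x" and x': "x' / x = 1 + t" and t: "-1 \<le> t"
  defines "u \<equiv> saturated p R x"
  shows "u * (1 + (1 - u) * (p * t - (p * (1 - p) / 2 + u) * t\<^sup>2) - 17 * \<bar>t\<bar> ^ 3) \<le> saturated p R x'"
proof -
  define d where "d = (1 + t) powr p - 1"
  have u: "0 \<le> u" "u < 1" using saturated_bounds[OF R] by (auto simp: u_def)
  have d1: "-1 \<le> d" by (simp add: d_def)
  have dt: "\<bar>d\<bar> \<le> \<bar>t\<bar>" unfolding d_def by (rule abs_powr_1_minus_1_le[OF t p])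
  have d2: "d\<^sup>2 \<le> t\<^sup>2" using dt by (simp add: abs_le_square_iff)
  have d3: "\<bar>d\<bar>^3 \<le> \<bar>t\<bar>^3" using dt by (intro power_mono) auto
  have tay: "p * t - p * (1 - p) / 2 * t\<^sup>2 - 16 * \<bar>t\<bar>^3 \<le> d"
    using powr_taylor2[OF t p] unfolding d_def by linarith
  have xx: "x' = x * (1 + t)" using x x' by (simp add: field_simps)
  have "saturated p R x' = x powr p * (1 + d) / (R powr p + x powr p * (1 + d))"
    unfolding saturated_def xx d_def using x t by (simp add: powr_mult)
  also have "\<dots> = u * (1 + d) / (1 + u * d)"
  proof -
    have pos: "0 < R powr p + x powr p" using R by (simp add: add_pos_nonneg)
    have "u * (1 + d) / (1 + u * d) = (R powr p + x powr p) * (u * (1 + d)) / ((R powr p + x powr p) * (1 + u * d))"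
      using pos by simp
    also have "\<dots> = (u * (R powr p + x powr p)) * (1 + d) / ((R powr p + x powr p) + (u * (R powr p + x powr p)) * d)"
      by (simp add: algebra_simps)
    also have "u * (R powr p + x powr p) = x powr p" using pos by (simp add: u_def saturated_def)
    finally show ?thesis by (simp add: algebra_simps)
  qed
  finally have eq: "saturated p R x' = u * (1 + d) / (1 + u * d)" .
  have "(1 - u) * (p * t - (p * (1 - p) / 2 + u) * t\<^sup>2) - 17 * \<bar>t\<bar> ^ 3
      \<le> (1 - u) * (d - u * d\<^sup>2) - \<bar>d\<bar> ^ 3"
  proof -
    have "(1 - u) * (p * t - p * (1 - p) / 2 * t\<^sup>2 - 16 * \<bar>t\<bar>^3 - u * t\<^sup>2) \<le> (1 - u) * (d - u * d\<^sup>2)"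
      using u tay d2 by (intro mult_left_mono diff_mono) auto
    moreover have "(1 - u) * (16 * \<bar>t\<bar>^3) \<le> 1 * (16 * \<bar>t\<bar>^3)" using u by (intro mult_right_mono) auto
    moreover have e: "(1 - u) * (p * t - (p * (1 - p) / 2 + u) * t\<^sup>2)
        = (1 - u) * (p * t - p * (1 - p) / 2 * t\<^sup>2 - 16 * \<bar>t\<bar>^3 - u * t\<^sup>2) + (1 - u) * (16 * \<bar>t\<bar>^3)"
      by (simp add: field_simps)
    ultimately show ?thesis using d3 unfolding e by linarith
  qed
  then have "u * ((1 - u) * (p * t - (p * (1 - p) / 2 + u) * t\<^sup>2) - 17 * \<bar>t\<bar> ^ 3)
      \<le> u * ((1 - u) * (d - u * d\<^sup>2) - \<bar>d\<bar> ^ 3)" using u by (intro mult_left_mono)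
  then show ?thesis using saturated_ge[OF u d1] unfolding eq by (simp add: algebra_simps)
qed

lemma one_minus_power_ge:
  fixes c :: real
  assumes "0 \<le> c" "2 * c \<le> real n" "0 < n"
  shows "exp (- 2 * c) \<le> (1 - c / real n) ^ n"
proof -
  define x where "x = c / real n"
  have x: "0 \<le> x" "x \<le> 1/2" using assms by (auto simp: x_def field_simps)
  have "- 2 * x \<le> - x - 2 * x\<^sup>2" using x mult_left_mono[of x "1/2" x] by (simp add: power2_eq_square)
  also have "\<dots> \<le> ln (1 - x)" by (rule ln_one_minus_pos_lower_bound[OF x])
  finally have "exp (- 2 * x) \<le> 1 - x" using x by (subst (asm) ln_ge_iff) auto
  then have "exp (- 2 * x) ^ n \<le> (1 - x) ^ n" by (intro power_mono) auto
  moreover have "exp (- 2 * x) ^ n = exp (- 2 * c)" using assms by (simp add: x_def flip: exp_of_nat_mult)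
  ultimately show ?thesis by (simp add: x_def)
qed

section \<open>Jumps of the order of the standard deviation\<close>

text \<open>
A test function for a one-sided jump: its expectation under a law with mean 0, variance 1 and moment of order
\<open>q\<close> at most \<open>C\<close> is at least \<open>3/4 - 2 C a powr (2 - q)\<close>, which is positive once \<open>a\<close> is large. The linear term has mean 0;
it is there to make the left side nonpositive for \<open>0 \<le> y \<le> a\<close>, and the last term does this for \<open>\<bar>y\<bar> \<ge> a\<close>.
\<close>

lemma below_indicator_ge:
  fixes a y q :: real
  assumes a: "1 \<le> a" and q: "2 < q"
  shows "- 1/4 - a * y + y\<^sup>2 - 2 * a powr (2 - q) * \<bar>y\<bar> powr q
    \<le> 2 * a\<^sup>2 * (if y \<le> - (1 / (8 * a)) then 1 else 0)"
proof (cases "a \<le> \<bar>y\<bar>")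
  case True
  have "y\<^sup>2 * a powr (q-2) \<le> y\<^sup>2 * \<bar>y\<bar> powr (q-2)"
    using True a q by (intro mult_left_mono powr_mono2) auto
  also have "\<dots> = \<bar>y\<bar> powr 2 * \<bar>y\<bar> powr (q-2)" using True a by simp
  also have "\<dots> = \<bar>y\<bar> powr q" by (simp only: powr_add[symmetric]) simp
  finally have "y\<^sup>2 * a powr (q-2) * a powr (2-q) \<le> \<bar>y\<bar> powr q * a powr (2-q)"
    by (intro mult_right_mono) auto
  moreover have "y\<^sup>2 * a powr (q-2) * a powr (2-q) = y\<^sup>2"
    using a by (simp add: mult.assoc flip: powr_add)
  ultimately have 1: "y\<^sup>2 \<le> a powr (2-q) * \<bar>y\<bar> powr q" by (metis mult.commute)
  have "- (a * y) \<le> a * \<bar>y\<bar>" using a by (metis abs_ge_minus_self abs_mult abs_of_nonneg order.trans zero_le_one)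
  also have "\<dots> \<le> \<bar>y\<bar> * \<bar>y\<bar>" using True by (intro mult_right_mono) auto
  finally have "- (a*y) \<le> y\<^sup>2" by (simp add: power2_eq_square)
  with 1 have "- 1/4 - a * y + y\<^sup>2 - 2 * a powr (2 - q) * \<bar>y\<bar> powr q \<le> 0" by linarith
  also have "\<dots> \<le> 2 * a\<^sup>2 * (if y \<le> - (1 / (8 * a)) then 1 else 0)" by simp
  finally show ?thesis .
next
  case False
  have nn: "0 \<le> 2 * a powr (2 - q) * \<bar>y\<bar> powr q" by simp
  show ?thesis
  proof (cases "y \<le> - (1 / (8 * a))")
    case True
    have "-(a * y) \<le> a * a" using False a by (metis abs_ge_minus_self linorder_not_le minus_mult_right mult_left_mono order.strict_trans2 less_imp_le order.trans zero_le_one)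
    moreover have "y\<^sup>2 \<le> a\<^sup>2" using False a by (simp add: abs_le_square_iff[symmetric])
    ultimately have "- 1/4 - a * y + y\<^sup>2 - 2 * a powr (2 - q) * \<bar>y\<bar> powr q \<le> 2 * a\<^sup>2"
      using nn unfolding power2_eq_square by linarith
    then show ?thesis using True by simp
  next
    case y: False
    have "- (a * y) + y\<^sup>2 \<le> 1/4"
    proof (cases "0 \<le> y")
      case True
      have "y * y \<le> a * y" using True False by (intro mult_right_mono) auto
      then show ?thesis by (simp add: power2_eq_square)
    next
      case neg: False
      have "a * (-y) \<le> a * (1/(8*a))" using y a by (intro mult_left_mono) auto
      then have 1: "- (a*y) \<le> 1/8" using a by simp
      have "1 / (8*a) \<le> 1/8" using a by (simp add: field_simps)
      then have "\<bar>y\<bar> \<le> 1/8" using y neg by linarith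
      then have "\<bar>y\<bar>^2 \<le> (1/8)^2" by (intro power_mono) auto
      then show ?thesis using 1 by (simp add: power2_eq_square)
    qed
    then have "- 1/4 - a * y + y\<^sup>2 - 2 * a powr (2 - q) * \<bar>y\<bar> powr q \<le> 0"
      using nn by linarith
    then show ?thesis using y by simp
  qed
qed

text \<open>
The smallest \<open>a \<ge> 1\<close> for which the last term of the preceding test function costs at most \<open>1/4\<close>.
\<close>

definition spread :: "real \<Rightarrow> real \<Rightarrow> real" where
  "spread q C = max 1 ((8 * C) powr (1 / (q - 2)))"

definition jump :: "real \<Rightarrow> real \<Rightarrow> real" where "jump q C = 1 / (8 * spread q C)"

definition jump_prob :: "real \<Rightarrow> real \<Rightarrow> real" where "jump_prob q C = 1 / (4 * (spread q C)\<^sup>2)"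

lemma spread:
  assumes q: "2 < q"
  shows "1 \<le> spread q C" "0 < C \<Longrightarrow> 2 * spread q C powr (2 - q) * C \<le> 1/4"
proof -
  show s1: "1 \<le> spread q C" by (simp add: spread_def)
  assume C: "0 < C"
  have "(8 * C) powr (1 / (q - 2)) \<le> spread q C" by (simp add: spread_def)
  then have "((8 * C) powr (1 / (q - 2))) powr (q - 2) \<le> spread q C powr (q - 2)" using q by (intro powr_mono2) auto
  then have "8 * C \<le> spread q C powr (q - 2)" using q C by (simp add: powr_powr)
  then have "8 * C * spread q C powr (2 - q) \<le> spread q C powr (q - 2) * spread q C powr (2 - q)" by (intro mult_right_mono) auto
  also have "\<dots> = 1" using s1 by (simp flip: powr_add)
  finally show "2 * spread q C powr (2 - q) * C \<le> 1/4" by (simp add: mult_ac)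
qed

lemma jump_pos: "0 < jump q C" "0 < jump_prob q C"
  by (auto simp: jump_def jump_prob_def spread_def)

section \<open>The drift and its clock\<close>

text \<open>
Here \<open>lam\<close> is minus the index of regular variation of \<open>g x / x\<close>.
\<close>

locale growth_drift =
  fixes g :: "real \<Rightarrow> real" and lam :: real
  assumes g_pos: "\<And>x. 0 \<le> x \<Longrightarrow> 0 < g x"
    and g_diff: "g differentiable_on {0..}"
    and g_small: "g \<in> o[at_top](\<lambda>x. x)"
    and lam_pos: "0 < lam"
    and g_lim: "((\<lambda>x. deriv g x * x / g x) \<longlongrightarrow> 1 - lam) at_top"

begin

abbreviation "rate x \<equiv> g x / x"

abbreviation "G \<equiv> growth_G g"

definition clock :: "real \<Rightarrow> real" where
  "clock s = inv_into {0..} G s"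

lemma g_cont: "continuous_on {0..} g"
  using g_diff by (rule differentiable_imp_continuous_on)

lemma g_deriv: "0 < x \<Longrightarrow> (g has_real_derivative deriv g x) (at x)"
proof -
  assume x: "0 < x"
  have "g differentiable (at x within {0..})" using g_diff x by (auto simp: differentiable_on_def)
  moreover have "at x within {0..} = at x" using x by (intro at_within_interior) (simp add: interior_real_atLeast)
  ultimately have "g differentiable (at x)" by simp
  then show ?thesis by (simp add: DERIV_deriv_iff_real_differentiable)
qed

lemma rate_tendsto: "((\<lambda>x. rate x) \<longlongrightarrow> 0) at_top"
  using smalloD_tendsto[OF g_small] .

lemma rate_pos: "0 < x \<Longrightarrow> 0 < rate x"
  using g_pos[of x] by simp

lemma rate_bounded: "\<exists>m>0. \<forall>x\<ge>1. rate x \<le> m"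
proof -
  have "eventually (\<lambda>x. rate x < 1) at_top"
    using order_tendstoD(2)[OF rate_tendsto, of 1] by simp
  then obtain N where N: "\<And>x. x \<ge> N \<Longrightarrow> rate x < 1" by (auto simp: eventually_at_top_linorder)
  have "continuous_on {1..max 1 N} (\<lambda>x. rate x)"
    by (intro continuous_intros continuous_on_subset[OF g_cont]) auto
  then have "\<exists>x\<in>{1..max 1 N}. \<forall>y\<in>{1..max 1 N}. rate y \<le> rate x"
    by (intro continuous_attains_sup) auto
  then obtain b where b: "\<forall>y\<in>{1..max 1 N}. rate y \<le> rate b" by blast
  have "rate x \<le> max 1 (rate b)" if "1 \<le> x" for x
  proof (cases "N \<le> x")
    case True then show ?thesis using N[of x] by simp
  next
    case False then show ?thesis using b that by (simp add: le_max_iff_disj)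
  qed
  then show ?thesis by (intro exI[of _ "max 1 (rate b)"]) auto
qed

lemma G_deriv_within: "0 \<le> a \<Longrightarrow> a \<le> 1 \<Longrightarrow> 1 \<le> b \<Longrightarrow> a \<le> x \<Longrightarrow> x \<le> b \<Longrightarrow>
    (G has_real_derivative 1 / g x) (at x within {a..b})"
proof -
  assume a: "0 \<le> a" "a \<le> 1" "1 \<le> b" "a \<le> x" "x \<le> b"
  have "continuous_on {a..b} (\<lambda>x. 1 / g x)"
    using a g_pos by (intro continuous_intros continuous_on_subset[OF g_cont]) (auto simp: less_imp_neq[symmetric])
  from interval_integral_FTC2[OF a(2,3) this a(4,5)]
  show ?thesis by (simp add: growth_G_def[abs_def] has_real_derivative_iff_has_vector_derivative)
qed

lemma G_deriv: "0 < x \<Longrightarrow> (G has_real_derivative 1 / g x) (at x)"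
proof -
  assume x: "0 < x"
  have "(G has_real_derivative 1 / g x) (at x within {0..max 1 x + 1})"
    by (intro G_deriv_within) (use x in auto)
  moreover have "at x within {0..max 1 x + 1} = at x" using x by (intro at_within_interior) auto
  ultimately show ?thesis by simp
qed

lemma G_cont: "continuous_on {0..} G"
proof (rule continuous_on_vector_derivative)
  fix x :: real assume x: "x \<in> {0..}"
  have "(G has_real_derivative 1 / g x) (at x within {0..max 1 x + 1})"
    by (intro G_deriv_within) (use x in auto)
  moreover have "at x within {0..max 1 x + 1} = at x within {0..}"
    using x by (intro at_within_nhd[of _ "{..<max 1 x + 1}"]) auto
  ultimately show "(G has_vector_derivative 1 / g x) (at x within {0..})"
    by (simp add: has_real_derivative_iff_has_vector_derivative)
qed

lemma G_strict_mono: "0 \<le> x \<Longrightarrow> x < y \<Longrightarrow> G x < G y"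
proof -
  assume xy: "0 \<le> x" "x < y"
  show "G x < G y"
  proof (rule DERIV_pos_imp_increasing_open[OF xy(2)])
    fix z assume z: "x < z" "z < y"
    then show "\<exists>d. (G has_real_derivative d) (at z) \<and> 0 < d"
      using G_deriv[of z] g_pos[of z] xy by (intro exI[of _ "1 / g z"]) auto
  next
    show "continuous_on {x..y} G" by (rule continuous_on_subset[OF G_cont]) (use xy in auto)
  qed
qed

lemma G_one: "G 1 = 0"
  unfolding growth_G_def using interval_integral_endpoints_same[of "ereal 1" "\<lambda>y. 1 / g y"] by simp

lemma G_inj: "inj_on G {0..}"
  by (rule linorder_inj_onI) (use G_strict_mono in \<open>auto simp: less_imp_neq\<close>)

text \<open>
Since \<open>g\<close> grows at most linearly, \<open>G\<close> tends to infinity, and its inverse is defined on \<open>[0, \<infinity>)\<close>.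
\<close>

lemma G_ge_ln: "\<exists>m>0. \<forall>x\<ge>1. ln x \<le> m * G x"
proof -
  obtain m where m: "m > 0" "\<And>x. x \<ge> 1 \<Longrightarrow> rate x \<le> m" using rate_bounded by blast
  have "ln x - m * G x \<le> ln 1 - m * G 1" if "1 \<le> x" for x
  proof (rule DERIV_nonpos_imp_nonincreasing[OF that])
    fix z :: real assume z: "1 \<le> z" "z \<le> x"
    have "((\<lambda>x. ln x - m * G x) has_real_derivative 1 / z - m * (1 / g z)) (at z)"
      using z by (auto intro!: derivative_eq_intros G_deriv)
    moreover have "1 / z - m * (1 / g z) \<le> 0"
      using m(2)[OF z(1)] z g_pos[of z] by (simp add: field_simps)
    ultimately show "\<exists>d. ((\<lambda>x. ln x - m * G x) has_real_derivative d) (at z) \<and> d \<le> 0" by blast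
  qed
  then show ?thesis using m(1) by (auto simp: G_one)
qed

lemma clock_ex:
  assumes "0 \<le> s"
  shows "\<exists>x\<ge>1. G x = s"
proof -
  obtain m where m: "m > 0" "\<And>x. x \<ge> 1 \<Longrightarrow> ln x \<le> m * G x" using G_ge_ln by blast
  have b: "1 \<le> exp (m * s)" using m assms by simp
  from m(2)[OF this] have "s \<le> G (exp (m * s))" using m(1) by simp
  moreover have "continuous_on {1..exp (m * s)} G" by (rule continuous_on_subset[OF G_cont]) auto
  ultimately show ?thesis
    using IVT'[of G 1 s "exp (m * s)"] assms b by (auto simp: G_one)
qed

lemma
  assumes "0 \<le> s"
  shows G_clock: "G (clock s) = s" and clock_ge_1: "1 \<le> clock s"
proof -
  obtain x where x: "1 \<le> x" "G x = s" using clock_ex[OF assms] by blast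
  then have "clock s = x" unfolding clock_def using G_inj by (auto intro!: inv_into_f_eq)
  then show "G (clock s) = s" "1 \<le> clock s" using x by auto
qed

lemma clock_0: "clock 0 = 1"
  unfolding clock_def using G_inj by (auto intro!: inv_into_f_eq simp: G_one)

lemma clock_mono: "0 \<le> s \<Longrightarrow> s \<le> t \<Longrightarrow> clock s \<le> clock t"
  using G_strict_mono[of "clock t" "clock s"] G_clock[of s] G_clock[of t] clock_ge_1[of t]
  by (cases "clock s \<le> clock t") auto

lemma clock_ge: "1 \<le> y \<Longrightarrow> G y \<le> s \<Longrightarrow> y \<le> clock s"
proof -
  assume y: "1 \<le> y" "G y \<le> s"
  have "0 \<le> G y" using G_strict_mono[of 1 y] y by (cases "y = 1") (auto simp: G_one)
  then have s: "0 \<le> s" using y by simp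
  show "y \<le> clock s"
  proof (rule ccontr)
    assume "\<not> y \<le> clock s"
    then have "G (clock s) < G y" using clock_ge_1[OF s] by (intro G_strict_mono) auto
    then show False using G_clock[OF s] y by simp
  qed
qed

lemma clock_eventually_ge: "eventually (\<lambda>n. y \<le> clock (real n)) sequentially"
proof -
  obtain N where N: "G (max 1 y) \<le> real N" using real_arch_simple by blast
  have "y \<le> clock (real n)" if "N \<le> n" for n
    using clock_ge[of "max 1 y" "real n"] N that by simp
  then show ?thesis by (auto simp: eventually_sequentially)
qed

text \<open>
The logarithm of the clock grows at speed \<open>rate\<close>.
\<close>

lemma ln_clock_diff_le:
  assumes "0 \<le> s" "s \<le> t" "\<And>y. clock s \<le> y \<Longrightarrow> y \<le> clock t \<Longrightarrow> rate y \<le> c"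
  shows "ln (clock t) - ln (clock s) \<le> c * (t - s)"
proof -
  note ge = clock_ge_1[OF assms(1)]
  have "ln (clock t) - c * G (clock t) \<le> ln (clock s) - c * G (clock s)"
  proof (rule DERIV_nonpos_imp_nonincreasing[OF clock_mono[OF assms(1,2)]])
    fix z :: real assume z: "clock s \<le> z" "z \<le> clock t"
    have "((\<lambda>x. ln x - c * G x) has_real_derivative 1 / z - c * (1 / g z)) (at z)"
      using z ge by (auto intro!: derivative_eq_intros G_deriv)
    moreover have "1 / z - c * (1 / g z) \<le> 0"
      using assms(3)[OF z] z ge g_pos[of z] by (simp add: field_simps)
    ultimately show "\<exists>d. ((\<lambda>x. ln x - c * G x) has_real_derivative d) (at z) \<and> d \<le> 0" by blast
  qed
  then show ?thesis using assms by (simp add: G_clock algebra_simps)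
qed

text \<open>
The logarithmic derivative of \<open>rate\<close> is close to \<open>- lam / x\<close>, hence lies between \<open>- 2 lam / x\<close> and
\<open>- lam / (2 x)\<close> far out; this gives the first two monotonicity statements. The third compares the derivative
\<open>(1 - x g' x / g x) / g x\<close> of \<open>x / g x\<close> with that of \<open>lam / 2\<close> times \<open>G\<close>.
\<close>

lemma rate_regular:
  "\<exists>a\<ge>1. (\<forall>x y. a \<le> x \<longrightarrow> x \<le> y \<longrightarrow> rate y * y powr (lam/2) \<le> rate x * x powr (lam/2))
     \<and> (\<forall>x y. a \<le> x \<longrightarrow> x \<le> y \<longrightarrow> rate x * x powr (2*lam) \<le> rate y * y powr (2*lam))
     \<and> (\<forall>x y. a \<le> x \<longrightarrow> x \<le> y \<longrightarrow> x / g x - lam/2 * G x \<le> y / g y - lam/2 * G y)"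
proof -
  have "eventually (\<lambda>x. deriv g x * x / g x < 1 - lam/2) at_top"
    using lam_pos by (intro order_tendstoD(2)[OF g_lim]) auto
  moreover have "eventually (\<lambda>x. 1 - 2 * lam < deriv g x * x / g x) at_top"
    using lam_pos by (intro order_tendstoD(1)[OF g_lim]) auto
  ultimately have "eventually (\<lambda>x. deriv g x * x / g x < 1 - lam/2 \<and> 1 - 2 * lam < deriv g x * x / g x) at_top"
    by (rule eventually_conj)
  then obtain N where N: "\<And>x. N \<le> x \<Longrightarrow> deriv g x * x / g x < 1 - lam/2"
    "\<And>x. N \<le> x \<Longrightarrow> 1 - 2 * lam < deriv g x * x / g x"
    by (auto simp: eventually_at_top_linorder)
  define a where "a = max 1 N"
  have ln_rate: "((\<lambda>x. ln (g x) + (c - 1) * ln x) has_real_derivative (deriv g z * z / g z + (c - 1)) / z) (at z)"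
    if "a \<le> z" for c z
    using that g_pos[of z] by (auto intro!: derivative_eq_intros g_deriv simp: a_def field_simps)
  have eq: "rate x * x powr c = exp (ln (g x) + (c - 1) * ln x)" if "a \<le> x" for x c
    using that g_pos[of x] by (simp add: powr_def exp_add exp_diff algebra_simps a_def)
  have "rate y * y powr (lam/2) \<le> rate x * x powr (lam/2)" if xy: "a \<le> x" "x \<le> y" for x y
  proof -
    have "ln (g y) + (lam/2 - 1) * ln y \<le> ln (g x) + (lam/2 - 1) * ln x"
    proof (rule DERIV_nonpos_imp_nonincreasing[OF xy(2)])
      fix z assume z: "x \<le> z" "z \<le> y"
      have "(deriv g z * z / g z + (lam/2 - 1)) / z \<le> 0"
        using N(1)[of z] z xy by (intro divide_nonpos_pos) (auto simp: a_def)
      then show "\<exists>d. ((\<lambda>x. ln (g x) + (lam/2 - 1) * ln x) has_real_derivative d) (at z) \<and> d \<le> 0"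
        using ln_rate[of z "lam/2"] z xy by auto
    qed
    then show ?thesis unfolding eq[OF xy(1)] eq[OF order.trans[OF xy]] by simp
  qed
  moreover have "rate x * x powr (2*lam) \<le> rate y * y powr (2*lam)" if xy: "a \<le> x" "x \<le> y" for x y
  proof -
    have "ln (g x) + (2*lam - 1) * ln x \<le> ln (g y) + (2*lam - 1) * ln y"
    proof (rule DERIV_nonneg_imp_nondecreasing[OF xy(2)])
      fix z assume z: "x \<le> z" "z \<le> y"
      have "0 \<le> (deriv g z * z / g z + (2*lam - 1)) / z"
        using N(2)[of z] z xy by (intro divide_nonneg_pos) (auto simp: a_def)
      then show "\<exists>d. ((\<lambda>x. ln (g x) + (2*lam - 1) * ln x) has_real_derivative d) (at z) \<and> 0 \<le> d"
        using ln_rate[of z "2*lam"] z xy by auto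
    qed
    then show ?thesis unfolding eq[OF xy(1)] eq[OF order.trans[OF xy]] by simp
  qed
  moreover have "x / g x - lam/2 * G x \<le> y / g y - lam/2 * G y" if xy: "a \<le> x" "x \<le> y" for x y
  proof (rule DERIV_nonneg_imp_nondecreasing[OF xy(2)])
    fix z assume z: "x \<le> z" "z \<le> y"
    then have z0: "0 < z" "0 < g z" "N \<le> z" using xy g_pos[of z] by (auto simp: a_def)
    have "((\<lambda>x. x / g x - lam/2 * G x) has_real_derivative (1 * g z - z * deriv g z) / (g z * g z) - lam/2 * (1 / g z)) (at z)"
      using z0 by (auto intro!: derivative_eq_intros g_deriv G_deriv)
    moreover have "(1 * g z - z * deriv g z) / (g z * g z) - lam/2 * (1 / g z) = (1 - lam/2 - deriv g z * z / g z) / g z"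
      using z0 by (simp add: field_simps)
    moreover have "0 \<le> (1 - lam/2 - deriv g z * z / g z) / g z"
      using N(1)[OF z0(3)] z0 by (intro divide_nonneg_pos) auto
    ultimately show "\<exists>d. ((\<lambda>x. x / g x - lam/2 * G x) has_real_derivative d) (at z) \<and> 0 \<le> d" by auto
  qed
  ultimately show ?thesis by (intro exI[of _ a]) (auto simp: a_def)
qed

end

section \<open>The normalised noise\<close>

locale noisy_growth =
  stochastic_growth_process M F S g sigma2 x0 X \<xi>
  for M :: "'a measure" and F S g sigma2 x0 X \<xi> +
  fixes q C :: real
  assumes S_nonneg: "S \<subseteq> {0..}"
    and sigma2_pos: "\<And>x. 0 \<le> x \<Longrightarrow> 0 < sigma2 x"
    and g_pos: "\<And>x. 0 \<le> x \<Longrightarrow> 0 < g x"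
    and g_cont: "continuous_on {0..} g"
    and q: "4 < q" and C: "0 < C"
    and noise_moment: "\<And>n. AE \<omega> in M. nn_cond_exp M (F n) (\<lambda>\<omega>. ennreal (\<bar>\<xi> n \<omega>\<bar> powr q)) \<omega>
        \<le> ennreal (C * sigma2 (X n \<omega>) powr (q / 2))"

begin

text \<open>
The conditional standard deviation, as a measurable version: \<open>sigma2\<close> need not be measurable, so
\<open>sigma2 (X n)\<close> cannot be used directly.
\<close>

definition sd :: "nat \<Rightarrow> 'a \<Rightarrow> real" where
  "sd n \<omega> = sqrt (enn2real (nn_cond_exp M (F n) (\<lambda>\<omega>. ennreal ((\<xi> n \<omega>)\<^sup>2)) \<omega>))"

definition Y :: "nat \<Rightarrow> 'a \<Rightarrow> real" where
  "Y n \<omega> = \<xi> n \<omega> / sd n \<omega>"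

text \<open>
Conditional expectations given \<open>F n\<close> are tested against these functions.
\<close>

definition weight :: "nat \<Rightarrow> ('a \<Rightarrow> real) \<Rightarrow> bool" where
  "weight n W \<longleftrightarrow> W \<in> borel_measurable (F n) \<and> (\<exists>K. \<forall>\<omega>\<in>space M. \<bar>W \<omega>\<bar> \<le> K)"

lemma X_nonneg: "\<omega> \<in> space M \<Longrightarrow> 0 \<le> X n \<omega>"
  using in_state_space S_nonneg by force

lemma sigma_finite_subalgebra_F: "sigma_finite_subalgebra M (F n)"
proof -
  interpret finite_measure_subalgebra M "F n" by unfold_locales (rule subalgebra_F)
  show ?thesis by unfold_locales
qed

lemma measurable_F_M: "f \<in> borel_measurable (F n) \<Longrightarrow> f \<in> borel_measurable M"
  using subalgebra_F by (rule measurable_from_subalg)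

lemma space_Fn: "space (F n) = space M" by (rule space_F)

lemma sets_F_M: "A \<in> sets (F n) \<Longrightarrow> A \<in> sets M"
  using subalgebra_F[of n] by (auto simp: subalgebra_def)

lemma X_meas [measurable]: "X n \<in> borel_measurable M"
  by (rule measurable_F_M[OF adapted])

lemma sd_F: "sd n \<in> borel_measurable (F n)"
  unfolding sd_def[abs_def] by measurable

lemma sd_meas [measurable]: "sd n \<in> borel_measurable M" by (rule measurable_F_M[OF sd_F])

lemma Y_meas [measurable]: "Y n \<in> borel_measurable M"
  unfolding Y_def[abs_def] using noise_measurable by measurable

lemma sd_eq: "AE \<omega> in M. sd n \<omega> = sqrt (sigma2 (X n \<omega>)) \<and> 0 < sd n \<omega>"
proof -
  have "AE \<omega> in M. sd n \<omega> = sqrt (sigma2 (X n \<omega>)) \<and> 0 < sqrt (sigma2 (X n \<omega>))"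
    using noise_variance[of n] AE_space
  proof eventually_elim
    case (elim \<omega>)
    then show ?case using sigma2_pos[OF X_nonneg[OF elim(2), of n]] by (simp add: sd_def)
  qed
  then show ?thesis by eventually_elim auto
qed

lemma gX_F: "(\<lambda>\<omega>. g (X n \<omega>)) \<in> borel_measurable (F n)"
proof -
  have "continuous_on UNIV (\<lambda>x. g (max 0 x))"
    by (intro continuous_on_compose2[OF g_cont] continuous_intros) auto
  then have "(\<lambda>x. g (max 0 x)) \<in> borel_measurable borel" by (rule borel_measurable_continuous_onI)
  then have "(\<lambda>\<omega>. g (max 0 (X n \<omega>))) \<in> borel_measurable (F n)"
    using adapted by (rule measurable_compose_rev)
  moreover have "g (max 0 (X n \<omega>)) = g (X n \<omega>)" if "\<omega> \<in> space (F n)" for \<omega>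
    using X_nonneg[of \<omega> n] that by (simp add: space_Fn max_def)
  ultimately show ?thesis by (simp cong: measurable_cong)
qed

lemma gX_meas [measurable]: "(\<lambda>\<omega>. g (X n \<omega>)) \<in> borel_measurable M"
  by (rule measurable_F_M[OF gX_F])

lemma step_normalised: "AE \<omega> in M. X (Suc n) \<omega> = X n \<omega> + g (X n \<omega>) + sd n \<omega> * Y n \<omega>"
  using sd_eq[of n] AE_space
proof eventually_elim
  case (elim \<omega>)
  then have "sd n \<omega> \<noteq> 0" by auto
  then show ?case using step[OF elim(2), of n] by (simp add: Y_def)
qed

lemma weight_meas: "weight n W \<Longrightarrow> W \<in> borel_measurable (F n)" "weight n W \<Longrightarrow> W \<in> borel_measurable M"
  by (auto simp: weight_def intro: measurable_F_M)

lemma weight_const: "weight n (\<lambda>_. c)" by (auto simp: weight_def)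

lemma weight_add: "weight n a \<Longrightarrow> weight n b \<Longrightarrow> weight n (\<lambda>\<omega>. a \<omega> + b \<omega>)"
proof -
  assume a: "weight n a" and b: "weight n b"
  obtain K L where K: "\<forall>\<omega>\<in>space M. \<bar>a \<omega>\<bar> \<le> K" and L: "\<forall>\<omega>\<in>space M. \<bar>b \<omega>\<bar> \<le> L" using a b by (auto simp: weight_def)
  have "\<forall>\<omega>\<in>space M. \<bar>a \<omega> + b \<omega>\<bar> \<le> K + L" using K L by (smt (verit))
  then show ?thesis using a b by (auto simp: weight_def)
qed

lemma weight_mult: "weight n a \<Longrightarrow> weight n b \<Longrightarrow> weight n (\<lambda>\<omega>. a \<omega> * b \<omega>)"
proof -
  assume a: "weight n a" and b: "weight n b"
  obtain K L where K: "\<forall>\<omega>\<in>space M. \<bar>a \<omega>\<bar> \<le> K" and L: "\<forall>\<omega>\<in>space M. \<bar>b \<omega>\<bar> \<le> L" using a b by (auto simp: weight_def)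
  have "\<bar>a \<omega> * b \<omega>\<bar> \<le> K * L" if "\<omega> \<in> space M" for \<omega>
    unfolding abs_mult using that K[rule_format, OF that] L[rule_format, OF that]
    by (intro mult_mono) auto
  then show ?thesis using a b by (auto simp: weight_def)
qed

lemma weight_diff: "weight n a \<Longrightarrow> weight n b \<Longrightarrow> weight n (\<lambda>\<omega>. a \<omega> - b \<omega>)"
  using weight_add[OF _ weight_mult[OF weight_const[of n "-1"]], of a b] by simp

lemma weight_power: "weight n a \<Longrightarrow> weight n (\<lambda>\<omega>. a \<omega> ^ k)"
  by (induction k) (auto intro: weight_const weight_mult)

lemma weight_indicator: "A \<in> sets (F n) \<Longrightarrow> weight n (indicator A)"
  unfolding weight_def by (auto intro!: exI[of _ 1] simp: indicator_def)

lemmas weight_intros = weight_const weight_add weight_mult weight_diff weight_power weight_indicator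

lemma weight_integrable: "weight n W \<Longrightarrow> integrable M W"
proof -
  assume W: "weight n W"
  obtain K where K: "\<forall>\<omega>\<in>space M. \<bar>W \<omega>\<bar> \<le> K" using W by (auto simp: weight_def)
  show ?thesis
    by (rule integrable_const_bound[of _ K]) (use K weight_meas(2)[OF W] in \<open>auto intro!: AE_I2\<close>)
qed

text \<open>
Dividing the noise by its conditional standard deviation makes its second moment 1 and its moment of
order \<open>q\<close> bounded. The normalised noise is therefore integrable, while \<open>\<xi> n\<close> itself may fail to be.
\<close>

lemma moments_nn:
  assumes W: "weight n W" "\<And>\<omega>. \<omega> \<in> space M \<Longrightarrow> 0 \<le> W \<omega>"
  shows "(\<integral>\<^sup>+\<omega>. ennreal (W \<omega> * (Y n \<omega>)\<^sup>2) \<partial>M) = (\<integral>\<^sup>+\<omega>. ennreal (W \<omega>) \<partial>M)"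
    and "(\<integral>\<^sup>+\<omega>. ennreal (W \<omega> * \<bar>Y n \<omega>\<bar> powr q) \<partial>M) \<le> (\<integral>\<^sup>+\<omega>. ennreal (C * W \<omega>) \<partial>M)"
proof -
  interpret sigma_finite_subalgebra M "F n" by (rule sigma_finite_subalgebra_F)
  note [measurable] = weight_meas(1)[OF W(1)] sd_F noise_measurable
  have "(\<integral>\<^sup>+\<omega>. ennreal (W \<omega> * (Y n \<omega>)\<^sup>2) \<partial>M) = (\<integral>\<^sup>+\<omega>. ennreal (W \<omega> / (sd n \<omega>)\<^sup>2) * ennreal ((\<xi> n \<omega>)\<^sup>2) \<partial>M)"
    by (intro nn_integral_cong) (simp add: Y_def power_divide W flip: ennreal_mult)
  also have "\<dots> = (\<integral>\<^sup>+\<omega>. ennreal (W \<omega> / (sd n \<omega>)\<^sup>2) * nn_cond_exp M (F n) (\<lambda>\<omega>. ennreal ((\<xi> n \<omega>)\<^sup>2)) \<omega> \<partial>M)"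
    by (rule nn_cond_exp_intg[symmetric]) auto
  also have "\<dots> = (\<integral>\<^sup>+\<omega>. ennreal (W \<omega>) \<partial>M)"
  proof (rule nn_integral_cong_AE)
    show "AE \<omega> in M. ennreal (W \<omega> / (sd n \<omega>)\<^sup>2) * nn_cond_exp M (F n) (\<lambda>\<omega>. ennreal ((\<xi> n \<omega>)\<^sup>2)) \<omega> = ennreal (W \<omega>)"
      using noise_variance[of n] sd_eq[of n] AE_space
    proof eventually_elim
      case (elim \<omega>)
      have s: "0 < sigma2 (X n \<omega>)" using X_nonneg sigma2_pos elim by blast
      show ?case unfolding elim(1) using elim s W(2)[of \<omega>] by (simp flip: ennreal_mult)
    qed
  qed
  finally show "(\<integral>\<^sup>+\<omega>. ennreal (W \<omega> * (Y n \<omega>)\<^sup>2) \<partial>M) = (\<integral>\<^sup>+\<omega>. ennreal (W \<omega>) \<partial>M)" .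
  have "(\<integral>\<^sup>+\<omega>. ennreal (W \<omega> * \<bar>Y n \<omega>\<bar> powr q) \<partial>M) = (\<integral>\<^sup>+\<omega>. ennreal (W \<omega> / sd n \<omega> powr q) * ennreal (\<bar>\<xi> n \<omega>\<bar> powr q) \<partial>M)"
  proof (rule nn_integral_cong_AE)
    show "AE \<omega> in M. ennreal (W \<omega> * \<bar>Y n \<omega>\<bar> powr q) = ennreal (W \<omega> / sd n \<omega> powr q) * ennreal (\<bar>\<xi> n \<omega>\<bar> powr q)"
      using sd_eq[of n] AE_space
    proof eventually_elim
      case (elim \<omega>)
      then have "0 < sd n \<omega>" by blast
      then show ?case using W(2)[OF elim(2)] by (simp add: Y_def powr_divide flip: ennreal_mult)
    qed
  qed
  also have "\<dots> = (\<integral>\<^sup>+\<omega>. ennreal (W \<omega> / sd n \<omega> powr q) * nn_cond_exp M (F n) (\<lambda>\<omega>. ennreal (\<bar>\<xi> n \<omega>\<bar> powr q)) \<omega> \<partial>M)"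
    by (rule nn_cond_exp_intg[symmetric]) auto
  also have "\<dots> \<le> (\<integral>\<^sup>+\<omega>. ennreal (C * W \<omega>) \<partial>M)"
  proof (rule nn_integral_mono_AE)
    show "AE \<omega> in M. ennreal (W \<omega> / sd n \<omega> powr q) * nn_cond_exp M (F n) (\<lambda>\<omega>. ennreal (\<bar>\<xi> n \<omega>\<bar> powr q)) \<omega> \<le> ennreal (C * W \<omega>)"
      using noise_moment[of n] sd_eq[of n] AE_space
    proof eventually_elim
      case (elim \<omega>)
      have s: "0 < sigma2 (X n \<omega>)" using X_nonneg sigma2_pos elim by blast
      have e: "sd n \<omega> powr q = sigma2 (X n \<omega>) powr (q/2)"
        using elim s by (simp add: powr_half_sqrt[symmetric] powr_powr)
      have "ennreal (W \<omega> / sd n \<omega> powr q) * nn_cond_exp M (F n) (\<lambda>\<omega>. ennreal (\<bar>\<xi> n \<omega>\<bar> powr q)) \<omega>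
         \<le> ennreal (W \<omega> / sd n \<omega> powr q) * ennreal (C * sigma2 (X n \<omega>) powr (q / 2))"
        using elim by (intro mult_left_mono) auto
      also have "\<dots> = ennreal (C * W \<omega>)"
        using s W(2)[OF elim(3)] C unfolding e by (simp flip: ennreal_mult)
      finally show ?case .
    qed
  qed
  finally show "(\<integral>\<^sup>+\<omega>. ennreal (W \<omega> * \<bar>Y n \<omega>\<bar> powr q) \<partial>M) \<le> (\<integral>\<^sup>+\<omega>. ennreal (C * W \<omega>) \<partial>M)" .
qed

lemma Y_integrable: "integrable M (\<lambda>\<omega>. (Y n \<omega>)\<^sup>2)" "integrable M (\<lambda>\<omega>. \<bar>Y n \<omega>\<bar> powr q)" "integrable M (Y n)"
proof -
  show a: "integrable M (\<lambda>\<omega>. (Y n \<omega>)\<^sup>2)"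
    using moments_nn(1)[OF weight_const[of n 1]] emeasure_space_1
    by (intro integrableI_nonneg) auto
  show "integrable M (\<lambda>\<omega>. \<bar>Y n \<omega>\<bar> powr q)"
  proof (intro integrableI_nonneg)
    show "(\<integral>\<^sup>+\<omega>. ennreal (\<bar>Y n \<omega>\<bar> powr q) \<partial>M) < \<infinity>"
      using moments_nn(2)[OF weight_const[of n 1]] emeasure_space_1
      by (simp add: order.strict_trans1)
  qed auto
  have y: "\<bar>y\<bar> \<le> 1 + y\<^sup>2" for y :: real
    using zero_le_power2[of "\<bar>y\<bar> - 1"] by (simp add: power2_diff)
  show "integrable M (Y n)"
    by (rule Bochner_Integration.integrable_bound[OF Bochner_Integration.integrable_add[OF integrable_const[of 1] a]])
      (auto intro!: AE_I2 simp: y) 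
qed

lemma weight_times_integrable: "weight n W \<Longrightarrow> integrable M f \<Longrightarrow> integrable M (\<lambda>\<omega>. W \<omega> * f \<omega>)"
proof -
  assume W: "weight n W" and f: "integrable M f"
  obtain K where K: "\<forall>\<omega>\<in>space M. \<bar>W \<omega>\<bar> \<le> K" using W by (auto simp: weight_def)
  show ?thesis
  proof (rule Bochner_Integration.integrable_bound[OF integrable_mult_right[of K, OF f]])
    show "AE \<omega> in M. norm (W \<omega> * f \<omega>) \<le> norm (K * f \<omega>)"
      using K by (intro AE_I2) (force simp: abs_mult intro!: mult_right_mono)
  qed (use weight_meas(2)[OF W] f in measurable)
qed

lemma Y_mean: "weight n W \<Longrightarrow> (\<integral>\<omega>. W \<omega> * Y n \<omega> \<partial>M) = 0"
proof -
  assume W: "weight n W"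
  interpret sigma_finite_subalgebra M "F n" by (rule sigma_finite_subalgebra_F)
  note [measurable] = weight_meas(1)[OF W(1)] sd_F noise_measurable
  have i: "integrable M (\<lambda>\<omega>. (W \<omega> / sd n \<omega>) * \<xi> n \<omega>)"
    using weight_times_integrable[OF W Y_integrable(3)[of n]] by (simp add: Y_def)
  have "(\<integral>\<omega>. W \<omega> * Y n \<omega> \<partial>M) = (\<integral>\<omega>. (W \<omega> / sd n \<omega>) * \<xi> n \<omega> \<partial>M)" by (simp add: Y_def)
  also have "\<dots> = (\<integral>\<omega>. (W \<omega> / sd n \<omega>) * real_cond_exp M (F n) (\<xi> n) \<omega> \<partial>M)"
    by (rule real_cond_exp_intg(2)[symmetric, OF i]) auto
  also have "\<dots> = (\<integral>\<omega>. 0 \<partial>M)"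
    using weight_meas(2)[OF W] measurable_F_M[OF borel_measurable_cond_exp[of M "F n" "\<xi> n"]] noise_mean[of n] by (intro integral_cong_AE) auto
  finally show ?thesis by simp
qed

text \<open>
The nonnegative case is \<open>moments_nn\<close>; adding a constant reduces the general case to it.
\<close>

lemma Y_var: "weight n W \<Longrightarrow> (\<integral>\<omega>. W \<omega> * (Y n \<omega>)\<^sup>2 \<partial>M) = (\<integral>\<omega>. W \<omega> \<partial>M)"
proof -
  have nn: "(\<integral>\<omega>. W \<omega> * (Y n \<omega>)\<^sup>2 \<partial>M) = (\<integral>\<omega>. W \<omega> \<partial>M)" if W: "weight n W" "\<And>\<omega>. \<omega> \<in> space M \<Longrightarrow> 0 \<le> W \<omega>" for W
  proof -
    have m: "(\<integral>\<^sup>+\<omega>. ennreal (W \<omega> * (Y n \<omega>)\<^sup>2) \<partial>M) = (\<integral>\<^sup>+\<omega>. ennreal (W \<omega>) \<partial>M)"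
      by (rule moments_nn(1)) (use W in auto)
    have "ennreal (\<integral>\<omega>. W \<omega> * (Y n \<omega>)\<^sup>2 \<partial>M) = ennreal (\<integral>\<omega>. W \<omega> \<partial>M)"
      using m weight_times_integrable[OF W(1) Y_integrable(1)[of n]] weight_integrable[OF W(1)] W(2)
      by (subst (asm) (1 2) nn_integral_eq_integral) auto
    then show ?thesis using W by (subst (asm) ennreal_inj) (auto intro!: integral_nonneg_AE AE_I2)
  qed
  assume W: "weight n W"
  obtain K where K: "\<forall>\<omega>\<in>space M. \<bar>W \<omega>\<bar> \<le> K" using W by (auto simp: weight_def)
  have "K \<ge> 0" using K not_empty by fastforce
  have "(\<integral>\<omega>. (W \<omega> + K) * (Y n \<omega>)\<^sup>2 \<partial>M) = (\<integral>\<omega>. W \<omega> + K \<partial>M)"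
    using K by (intro nn weight_intros W) force
  moreover have "(\<integral>\<omega>. K * (Y n \<omega>)\<^sup>2 \<partial>M) = (\<integral>\<omega>. K \<partial>M)"
    using \<open>K \<ge> 0\<close> by (intro nn weight_intros)
  ultimately show ?thesis
    using weight_times_integrable[OF W Y_integrable(1)[of n]] Y_integrable(1)[of n] weight_integrable[OF W]
    by (auto simp: distrib_right)
qed

lemma Y_moment: "weight n W \<Longrightarrow> (\<And>\<omega>. \<omega> \<in> space M \<Longrightarrow> 0 \<le> W \<omega>) \<Longrightarrow>
    (\<integral>\<omega>. W \<omega> * \<bar>Y n \<omega>\<bar> powr q \<partial>M) \<le> (\<integral>\<omega>. C * W \<omega> \<partial>M)"
proof -
  assume W: "weight n W" "\<And>\<omega>. \<omega> \<in> space M \<Longrightarrow> 0 \<le> W \<omega>"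
  have m: "(\<integral>\<^sup>+\<omega>. ennreal (W \<omega> * \<bar>Y n \<omega>\<bar> powr q) \<partial>M) \<le> (\<integral>\<^sup>+\<omega>. ennreal (C * W \<omega>) \<partial>M)"
    by (rule moments_nn(2)) (use W in auto)
  have "ennreal (\<integral>\<omega>. W \<omega> * \<bar>Y n \<omega>\<bar> powr q \<partial>M) \<le> ennreal (\<integral>\<omega>. C * W \<omega> \<partial>M)"
    using m weight_times_integrable[OF W(1) Y_integrable(2)[of n]] weight_integrable[OF W(1)] W(2) C
    by (subst (asm) (1 2) nn_integral_eq_integral) auto
  then show ?thesis using W C by (subst (asm) ennreal_le_iff) (auto intro!: integral_nonneg_AE AE_I2)
qed

lemma moment_expansion:
  assumes w: "weight n a" "weight n b" "weight n c" "weight n d"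
  shows "integrable M (\<lambda>\<omega>. a \<omega> + b \<omega> * Y n \<omega> + c \<omega> * (Y n \<omega>)\<^sup>2 + d \<omega> * \<bar>Y n \<omega>\<bar> powr q)"
    and "(\<integral>\<omega>. a \<omega> + b \<omega> * Y n \<omega> + c \<omega> * (Y n \<omega>)\<^sup>2 + d \<omega> * \<bar>Y n \<omega>\<bar> powr q \<partial>M)
      = (\<integral>\<omega>. a \<omega> \<partial>M) + (\<integral>\<omega>. c \<omega> \<partial>M) + (\<integral>\<omega>. d \<omega> * \<bar>Y n \<omega>\<bar> powr q \<partial>M)"
proof -
  note i = weight_integrable[OF w(1)] weight_times_integrable[OF w(2) Y_integrable(3)]
    weight_times_integrable[OF w(3) Y_integrable(1)] weight_times_integrable[OF w(4) Y_integrable(2)]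
  show "integrable M (\<lambda>\<omega>. a \<omega> + b \<omega> * Y n \<omega> + c \<omega> * (Y n \<omega>)\<^sup>2 + d \<omega> * \<bar>Y n \<omega>\<bar> powr q)"
    by (intro Bochner_Integration.integrable_add i)
  show "(\<integral>\<omega>. a \<omega> + b \<omega> * Y n \<omega> + c \<omega> * (Y n \<omega>)\<^sup>2 + d \<omega> * \<bar>Y n \<omega>\<bar> powr q \<partial>M)
      = (\<integral>\<omega>. a \<omega> \<partial>M) + (\<integral>\<omega>. c \<omega> \<partial>M) + (\<integral>\<omega>. d \<omega> * \<bar>Y n \<omega>\<bar> powr q \<partial>M)"
    by (simp add: i Y_mean[OF w(2)] Y_var[OF w(3)])
qed

text \<open>
Together with its counterpart \<open>moment_ge\<close>, this is the only way in which the noise enters below: the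
expected change of a test function is read off from a polynomial bound in \<open>Y n\<close> and \<open>\<bar>Y n\<bar> powr q\<close>.
\<close>

lemma moment_le:
  assumes w: "weight n a" "weight n b" "weight n c" "weight n d"
    and d: "\<And>\<omega>. \<omega> \<in> space M \<Longrightarrow> 0 \<le> d \<omega>"
    and Z: "Z \<in> borel_measurable M" "AE \<omega> in M. 0 \<le> Z \<omega>"
    and le: "AE \<omega> in M. Z \<omega> \<le> a \<omega> + b \<omega> * Y n \<omega> + c \<omega> * (Y n \<omega>)\<^sup>2 + d \<omega> * \<bar>Y n \<omega>\<bar> powr q"
  shows "integrable M Z" "(\<integral>\<omega>. Z \<omega> \<partial>M) \<le> (\<integral>\<omega>. a \<omega> + c \<omega> + C * d \<omega> \<partial>M)"
proof -
  note e = moment_expansion[OF w]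
  show i: "integrable M Z"
    by (rule Bochner_Integration.integrable_bound[OF e(1) Z(1)]) (use Z(2) le in eventually_elim, auto)
  have "(\<integral>\<omega>. Z \<omega> \<partial>M) \<le> (\<integral>\<omega>. a \<omega> \<partial>M) + (\<integral>\<omega>. c \<omega> \<partial>M) + (\<integral>\<omega>. d \<omega> * \<bar>Y n \<omega>\<bar> powr q \<partial>M)"
    unfolding e(2)[symmetric] by (intro integral_mono_AE i e(1) le)
  also have "\<dots> \<le> (\<integral>\<omega>. a \<omega> + c \<omega> + C * d \<omega> \<partial>M)"
    using Y_moment[OF w(4) d] weight_integrable[OF w(1)] weight_integrable[OF w(3)] weight_integrable[OF w(4)]
    by simp
  finally show "(\<integral>\<omega>. Z \<omega> \<partial>M) \<le> (\<integral>\<omega>. a \<omega> + c \<omega> + C * d \<omega> \<partial>M)" .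
qed

lemma moment_ge:
  assumes w: "weight n a" "weight n b" "weight n c" "weight n d"
    and d: "\<And>\<omega>. \<omega> \<in> space M \<Longrightarrow> 0 \<le> d \<omega>"
    and Z: "integrable M Z"
    and le: "AE \<omega> in M. a \<omega> + b \<omega> * Y n \<omega> + c \<omega> * (Y n \<omega>)\<^sup>2 - d \<omega> * \<bar>Y n \<omega>\<bar> powr q \<le> Z \<omega>"
  shows "(\<integral>\<omega>. a \<omega> + c \<omega> - C * d \<omega> \<partial>M) \<le> (\<integral>\<omega>. Z \<omega> \<partial>M)"
proof -
  note e = moment_expansion[OF w(1-3), of "\<lambda>\<omega>. - 1 * d \<omega>", OF weight_mult[OF weight_const w(4)]]
  have "(\<integral>\<omega>. a \<omega> + c \<omega> - C * d \<omega> \<partial>M) \<le> (\<integral>\<omega>. a \<omega> \<partial>M) + (\<integral>\<omega>. c \<omega> \<partial>M) + (\<integral>\<omega>. - 1 * d \<omega> * \<bar>Y n \<omega>\<bar> powr q \<partial>M)"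
    using Y_moment[OF w(4) d] weight_integrable[OF w(1)] weight_integrable[OF w(3)] weight_integrable[OF w(4)]
    by simp
  also have "\<dots> \<le> (\<integral>\<omega>. Z \<omega> \<partial>M)"
    unfolding e(2)[symmetric] by (intro integral_mono_AE Z e(1)) (use le in simp)
  finally show ?thesis .
qed

section \<open>Expected one-step change of the test functions\<close>

lemma clip_weight: "f \<in> borel_measurable (F n) \<Longrightarrow> weight n (\<lambda>\<omega>. min b (max 0 (f \<omega>)))"
  unfolding weight_def by (auto intro!: exI[of _ "\<bar>b\<bar>"])

text \<open>
The relative drift, and below it the relative standard deviation, cut off so that they are weights. For
\<open>b\<close> as in \<open>near_critical\<close> the cut-off has no effect while the process is above the level \<open>A\<close>.
\<close>

definition clipped_rate :: "real \<Rightarrow> nat \<Rightarrow> 'a \<Rightarrow> real" where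
  "clipped_rate b n \<omega> = min b (max 0 (g (X n \<omega>) / X n \<omega>))"

definition clipped_vol :: "real \<Rightarrow> nat \<Rightarrow> 'a \<Rightarrow> real" where
  "clipped_vol b n \<omega> = min b (max 0 (sd n \<omega> / X n \<omega>))"

lemma clipped_rate_weight: "weight n (clipped_rate b n)" and clipped_vol_weight: "weight n (clipped_vol b n)"
  using gX_F[of n] adapted[of n] sd_F[of n]
  by (auto simp: clipped_rate_def[abs_def] clipped_vol_def[abs_def] intro!: clip_weight borel_measurable_divide)

lemma increment:
  assumes "\<forall>x. P x \<longrightarrow> 0 < x \<and> g x / x \<le> b \<and> sqrt (sigma2 x) / x \<le> b" "0 \<le> b"
  shows "AE \<omega> in M. P (X n \<omega>) \<longrightarrow> clipped_rate b n \<omega> = g (X n \<omega>) / X n \<omega> \<and> clipped_vol b n \<omega> = sqrt (sigma2 (X n \<omega>)) / X n \<omega>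
    \<and> X (Suc n) \<omega> / X n \<omega> = 1 + (clipped_rate b n \<omega> + clipped_vol b n \<omega> * Y n \<omega>) \<and> -1 \<le> clipped_rate b n \<omega> + clipped_vol b n \<omega> * Y n \<omega>"
  using sd_eq[of n] step_normalised[of n] AE_space
proof eventually_elim
  case (elim \<omega>)
  show ?case
  proof (intro impI)
    assume p: "P (X n \<omega>)"
    have x: "0 < X n \<omega>" "g (X n \<omega>) / X n \<omega> \<le> b" "sqrt (sigma2 (X n \<omega>)) / X n \<omega> \<le> b" using assms(1)[rule_format, OF p] by auto
    have r: "clipped_rate b n \<omega> = g (X n \<omega>) / X n \<omega>" using x g_pos[of "X n \<omega>"] by (simp add: clipped_rate_def)
    have rho: "clipped_vol b n \<omega> = sqrt (sigma2 (X n \<omega>)) / X n \<omega>" using x sigma2_pos[of "X n \<omega>"] elim(1) by (simp add: clipped_vol_def)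
    have s: "sd n \<omega> = clipped_vol b n \<omega> * X n \<omega>" using rho elim(1) x by simp
    have X: "X (Suc n) \<omega> / X n \<omega> = 1 + (clipped_rate b n \<omega> + clipped_vol b n \<omega> * Y n \<omega>)"
      unfolding elim(2) s r using x by (simp add: field_simps)
    moreover have "0 \<le> X (Suc n) \<omega> / X n \<omega>" using x X_nonneg[OF elim(3), of "Suc n"] by simp
    ultimately show "clipped_rate b n \<omega> = g (X n \<omega>) / X n \<omega> \<and> clipped_vol b n \<omega> = sqrt (sigma2 (X n \<omega>)) / X n \<omega>
    \<and> X (Suc n) \<omega> / X n \<omega> = 1 + (clipped_rate b n \<omega> + clipped_vol b n \<omega> * Y n \<omega>) \<and> -1 \<le> clipped_rate b n \<omega> + clipped_vol b n \<omega> * Y n \<omega>"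
      using r rho by linarith
  qed
qed

text \<open>
An upper bound for \<open>E((X (n+1) / x) powr p)\<close> given \<open>X n = x\<close>: second order expansion plus cubic error.
\<close>

definition power_bound :: "real \<Rightarrow> real \<Rightarrow> real" where
  "power_bound p x = 1 + p * (g x / x) - p * (1 - p) / 2 * (sqrt (sigma2 x) / x)\<^sup>2
     + 64 * ((g x / x) ^ 3 + (1 + C) * (sqrt (sigma2 x) / x) ^ 3)"

lemma power_drift:
  assumes p: "0 < p" "p < 1"
    and b: "\<forall>x. P x \<longrightarrow> 0 < x \<and> g x / x \<le> b \<and> sqrt (sigma2 x) / x \<le> b" "0 \<le> b"
    and W: "weight n W" "\<And>\<omega>. \<omega> \<in> space M \<Longrightarrow> 0 \<le> W \<omega>" "\<And>\<omega>. \<omega> \<in> space M \<Longrightarrow> W \<omega> \<noteq> 0 \<Longrightarrow> P (X n \<omega>)"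
    and h: "weight n h" "\<And>\<omega>. \<omega> \<in> space M \<Longrightarrow> W \<omega> \<noteq> 0 \<Longrightarrow> power_bound p (X n \<omega>) \<le> h \<omega>"
  shows "integrable M (\<lambda>\<omega>. W \<omega> * (X (Suc n) \<omega> / X n \<omega>) powr p)"
    and "(\<integral>\<omega>. W \<omega> * (X (Suc n) \<omega> / X n \<omega>) powr p \<partial>M) \<le> (\<integral>\<omega>. W \<omega> * h \<omega> \<partial>M)"
proof -
  define a where "a = (\<lambda>\<omega>. W \<omega> * (1 + p * clipped_rate b n \<omega> + 64 * (clipped_rate b n \<omega> ^ 3 + clipped_vol b n \<omega> ^ 3)))"
  define b' where "b' = (\<lambda>\<omega>. W \<omega> * (p * clipped_vol b n \<omega> - p * (1 - p) * (clipped_rate b n \<omega> * clipped_vol b n \<omega>)))"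
  define c where "c = (\<lambda>\<omega>. W \<omega> * (- (p * (1 - p) / 2) * clipped_vol b n \<omega> ^ 2))"
  define d where "d = (\<lambda>\<omega>. W \<omega> * (64 * clipped_vol b n \<omega> ^ 3))"
  have w: "weight n a" "weight n b'" "weight n c" "weight n d"
    unfolding a_def b'_def c_def d_def by (intro weight_intros W clipped_rate_weight clipped_vol_weight)+
  have nn: "0 \<le> clipped_rate b n \<omega>" "0 \<le> clipped_vol b n \<omega>" for \<omega> using b(2) by (auto simp: clipped_rate_def clipped_vol_def)
  have d: "0 \<le> d \<omega>" if "\<omega> \<in> space M" for \<omega> using nn W(2)[OF that] by (simp add: d_def)
  have le: "AE \<omega> in M. W \<omega> * (X (Suc n) \<omega> / X n \<omega>) powr p \<le> a \<omega> + b' \<omega> * Y n \<omega> + c \<omega> * (Y n \<omega>)\<^sup>2 + d \<omega> * \<bar>Y n \<omega>\<bar> powr q"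
    using increment[of P b, OF b, of n] AE_space
  proof eventually_elim
    case (elim \<omega>)
    show ?case
    proof (cases "W \<omega> = 0")
      case True then show ?thesis by (simp add: a_def b'_def c_def d_def)
    next
      case False
      define t where "t = clipped_rate b n \<omega> + clipped_vol b n \<omega> * Y n \<omega>"
      have t: "X (Suc n) \<omega> / X n \<omega> = 1 + t" "-1 \<le> t" using elim W(3)[OF elim(2) False] by (auto simp: t_def)
      have c3: "\<bar>t\<bar>^3 \<le> 4 * (clipped_rate b n \<omega> ^ 3 + clipped_vol b n \<omega> ^ 3 * (1 + \<bar>Y n \<omega>\<bar> powr q))"
        unfolding t_def using nn q by (intro abs_add_cubed_le) auto
      have t2: "2 * (clipped_rate b n \<omega> * clipped_vol b n \<omega> * Y n \<omega>) + clipped_vol b n \<omega> ^ 2 * Y n \<omega> ^ 2 \<le> t\<^sup>2"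
        unfolding t_def power2_sum using zero_le_power2[of "clipped_rate b n \<omega>"] by (simp add: power_mult_distrib del: zero_le_power2)
      have "(1 + t) powr p \<le> 1 + p * t - p * (1 - p) / 2 * t\<^sup>2 + 16 * \<bar>t\<bar>^3"
        using powr_taylor2[OF t(2) p] by linarith
      also have "\<dots> \<le> 1 + p * t - p * (1 - p) / 2 * (2 * (clipped_rate b n \<omega> * clipped_vol b n \<omega> * Y n \<omega>) + clipped_vol b n \<omega> ^ 2 * Y n \<omega> ^ 2)
          + 16 * (4 * (clipped_rate b n \<omega> ^ 3 + clipped_vol b n \<omega> ^ 3 * (1 + \<bar>Y n \<omega>\<bar> powr q)))"
        using p c3 by (intro add_mono diff_mono mult_left_mono t2) auto
      finally have "W \<omega> * (1 + t) powr p \<le> W \<omega> * \<dots>" using W(2)[OF elim(2)] by (rule mult_left_mono)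
      then show ?thesis unfolding t(1) a_def b'_def c_def d_def t_def by (simp add: field_simps)
    qed
  qed
  have Z: "(\<lambda>\<omega>. W \<omega> * (X (Suc n) \<omega> / X n \<omega>) powr p) \<in> borel_measurable M"
    using weight_meas(2)[OF W(1)] by measurable
  have Z0: "AE \<omega> in M. 0 \<le> W \<omega> * (X (Suc n) \<omega> / X n \<omega>) powr p" using W(2) by (intro AE_I2) simp
  note m = moment_le[OF w d Z Z0 le]
  show "integrable M (\<lambda>\<omega>. W \<omega> * (X (Suc n) \<omega> / X n \<omega>) powr p)" by (rule m(1))
  note m(2)
  also have "(\<integral>\<omega>. a \<omega> + c \<omega> + C * d \<omega> \<partial>M) \<le> (\<integral>\<omega>. W \<omega> * h \<omega> \<partial>M)"
  proof (rule integral_mono_AE)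
    show "integrable M (\<lambda>\<omega>. a \<omega> + c \<omega> + C * d \<omega>)" by (intro weight_integrable[of n] weight_intros w)
    show "integrable M (\<lambda>\<omega>. W \<omega> * h \<omega>)" by (intro weight_integrable[of n] weight_intros W h)
    show "AE \<omega> in M. a \<omega> + c \<omega> + C * d \<omega> \<le> W \<omega> * h \<omega>"
      using increment[of P b, OF b, of n] AE_space
    proof eventually_elim
      case (elim \<omega>)
      show ?case
      proof (cases "W \<omega> = 0")
        case True then show ?thesis by (simp add: a_def c_def d_def)
      next
        case False
        have e: "clipped_rate b n \<omega> = g (X n \<omega>) / X n \<omega>" "clipped_vol b n \<omega> = sqrt (sigma2 (X n \<omega>)) / X n \<omega>"
          using elim W(3)[OF elim(2) False] by auto
        have "a \<omega> + c \<omega> + C * d \<omega> = W \<omega> * power_bound p (X n \<omega>)"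
          by (simp add: a_def c_def d_def power_bound_def e[symmetric] algebra_simps)
        also have "\<dots> \<le> W \<omega> * h \<omega>" using W(2)[OF elim(2)] h(2)[OF elim(2) False] by (intro mult_left_mono)
        finally show ?thesis .
      qed
    qed
  qed
  finally show "(\<integral>\<omega>. W \<omega> * (X (Suc n) \<omega> / X n \<omega>) powr p \<partial>M) \<le> (\<integral>\<omega>. W \<omega> * h \<omega> \<partial>M)" .
qed

text \<open>
A lower bound for \<open>E(saturated p R (X (n+1)))\<close> given \<open>X n = x\<close>.
\<close>

definition saturated_bound :: "real \<Rightarrow> real \<Rightarrow> real \<Rightarrow> real" where
  "saturated_bound p R x = (let u = saturated p R x; s = g x / x; v = sqrt (sigma2 x) / x in
     u * (1 + (1 - u) * (p * s - (p * (1 - p) / 2 + u) * (s\<^sup>2 + v\<^sup>2)) - 68 * (s ^ 3 + (1 + C) * v ^ 3)))"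

lemma saturated_drift:
  assumes p: "0 < p" "p < 1" and R: "0 < R"
    and b: "\<forall>x. P x \<longrightarrow> 0 < x \<and> g x / x \<le> b \<and> sqrt (sigma2 x) / x \<le> b" "0 \<le> b"
    and W: "weight n W" "\<And>\<omega>. \<omega> \<in> space M \<Longrightarrow> 0 \<le> W \<omega>" "\<And>\<omega>. \<omega> \<in> space M \<Longrightarrow> W \<omega> \<noteq> 0 \<Longrightarrow> P (X n \<omega>)"
    and h: "weight n h" "\<And>\<omega>. \<omega> \<in> space M \<Longrightarrow> W \<omega> \<noteq> 0 \<Longrightarrow> h \<omega> \<le> saturated_bound p R (X n \<omega>)"
  shows "(\<integral>\<omega>. W \<omega> * h \<omega> \<partial>M) \<le> (\<integral>\<omega>. W \<omega> * saturated p R (X (Suc n) \<omega>) \<partial>M)"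
proof -
  define u where "u = (\<lambda>\<omega>. saturated p R (X n \<omega>))"
  have u01: "0 \<le> u \<omega>" "u \<omega> < 1" for \<omega> using saturated_bounds[OF R] by (auto simp: u_def)
  have uw: "weight n u"
    unfolding weight_def using u01 adapted[of n]
    by (auto simp: u_def[abs_def] saturated_def intro!: exI[of _ 1] less_imp_le)
  define k where "k = (\<lambda>\<omega>. p * (1 - p) / 2 + u \<omega>)"
  define a where "a = (\<lambda>\<omega>. W \<omega> * u \<omega> * (1 + (1 - u \<omega>) * (p * clipped_rate b n \<omega> - k \<omega> * clipped_rate b n \<omega> ^ 2) - 68 * (clipped_rate b n \<omega> ^ 3 + clipped_vol b n \<omega> ^ 3)))"
  define b' where "b' = (\<lambda>\<omega>. W \<omega> * u \<omega> * ((1 - u \<omega>) * (p * clipped_vol b n \<omega> - 2 * k \<omega> * (clipped_rate b n \<omega> * clipped_vol b n \<omega>))))"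
  define c where "c = (\<lambda>\<omega>. W \<omega> * u \<omega> * ((1 - u \<omega>) * (-1 * k \<omega> * clipped_vol b n \<omega> ^ 2)))"
  define d where "d = (\<lambda>\<omega>. W \<omega> * u \<omega> * (68 * clipped_vol b n \<omega> ^ 3))"
  have w: "weight n a" "weight n b'" "weight n c" "weight n d"
    unfolding a_def b'_def c_def d_def k_def by (intro weight_intros W clipped_rate_weight clipped_vol_weight uw)+
  have nn: "0 \<le> clipped_rate b n \<omega>" "0 \<le> clipped_vol b n \<omega>" for \<omega> using b(2) by (auto simp: clipped_rate_def clipped_vol_def)
  have d: "0 \<le> d \<omega>" if "\<omega> \<in> space M" for \<omega> using nn W(2)[OF that] u01 by (simp add: d_def)
  have le: "AE \<omega> in M. a \<omega> + b' \<omega> * Y n \<omega> + c \<omega> * (Y n \<omega>)\<^sup>2 - d \<omega> * \<bar>Y n \<omega>\<bar> powr q \<le> W \<omega> * saturated p R (X (Suc n) \<omega>)"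
    using increment[of P b, OF b, of n] AE_space
  proof eventually_elim
    case (elim \<omega>)
    show ?case
    proof (cases "W \<omega> = 0")
      case True then show ?thesis by (simp add: a_def b'_def c_def d_def)
    next
      case False
      define t where "t = clipped_rate b n \<omega> + clipped_vol b n \<omega> * Y n \<omega>"
      have t: "X (Suc n) \<omega> / X n \<omega> = 1 + t" "-1 \<le> t" using elim W(3)[OF elim(2) False] by (auto simp: t_def)
      have X: "0 < X n \<omega>" using b(1)[rule_format, OF W(3)[OF elim(2) False]] by blast
      have c3: "\<bar>t\<bar>^3 \<le> 4 * (clipped_rate b n \<omega> ^ 3 + clipped_vol b n \<omega> ^ 3 * (1 + \<bar>Y n \<omega>\<bar> powr q))"
        unfolding t_def using nn q by (intro abs_add_cubed_le) auto
      have t2: "t\<^sup>2 = clipped_rate b n \<omega> ^ 2 + 2 * (clipped_rate b n \<omega> * clipped_vol b n \<omega> * Y n \<omega>) + clipped_vol b n \<omega> ^ 2 * Y n \<omega> ^ 2"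
        unfolding t_def power2_sum by (simp add: power_mult_distrib)
      have "u \<omega> * (1 + (1 - u \<omega>) * (p * t - k \<omega> * t\<^sup>2) - 17 * (4 * (clipped_rate b n \<omega> ^ 3 + clipped_vol b n \<omega> ^ 3 * (1 + \<bar>Y n \<omega>\<bar> powr q))))
        \<le> u \<omega> * (1 + (1 - u \<omega>) * (p * t - k \<omega> * t\<^sup>2) - 17 * \<bar>t\<bar>^3)"
        using u01 c3 by (intro mult_left_mono diff_mono) auto
      also have "\<dots> \<le> saturated p R (X (Suc n) \<omega>)"
        using saturated_pointwise[OF p R X t] by (simp add: u_def k_def)
      finally have "W \<omega> * (u \<omega> * (1 + (1 - u \<omega>) * (p * t - k \<omega> * t\<^sup>2) - 17 * (4 * (clipped_rate b n \<omega> ^ 3 + clipped_vol b n \<omega> ^ 3 * (1 + \<bar>Y n \<omega>\<bar> powr q)))))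
          \<le> W \<omega> * saturated p R (X (Suc n) \<omega>)"
        using W(2)[OF elim(2)] by (rule mult_left_mono)
      also have "W \<omega> * (u \<omega> * (1 + (1 - u \<omega>) * (p * t - k \<omega> * t\<^sup>2) - 17 * (4 * (clipped_rate b n \<omega> ^ 3 + clipped_vol b n \<omega> ^ 3 * (1 + \<bar>Y n \<omega>\<bar> powr q)))))
        = a \<omega> + b' \<omega> * Y n \<omega> + c \<omega> * (Y n \<omega>)\<^sup>2 - d \<omega> * \<bar>Y n \<omega>\<bar> powr q"
        unfolding t2 unfolding t_def a_def b'_def c_def d_def by (simp add: algebra_simps)
      finally show ?thesis .
    qed
  qed
  have Z: "integrable M (\<lambda>\<omega>. W \<omega> * saturated p R (X (Suc n) \<omega>))"
  proof (rule weight_times_integrable[OF W(1)])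
    show "integrable M (\<lambda>\<omega>. saturated p R (X (Suc n) \<omega>))"
    proof (rule integrable_const_bound[of _ 1])
      show "AE \<omega> in M. norm (saturated p R (X (Suc n) \<omega>)) \<le> 1"
        using saturated_bounds[OF R, of p] by (intro AE_I2) (simp add: less_imp_le)
    qed (simp add: saturated_def)
  qed
  have "(\<integral>\<omega>. W \<omega> * h \<omega> \<partial>M) \<le> (\<integral>\<omega>. a \<omega> + c \<omega> - C * d \<omega> \<partial>M)"
  proof (rule integral_mono_AE)
    show "integrable M (\<lambda>\<omega>. a \<omega> + c \<omega> - C * d \<omega>)" by (intro weight_integrable[of n] weight_intros w)
    show "integrable M (\<lambda>\<omega>. W \<omega> * h \<omega>)" by (intro weight_integrable[of n] weight_intros W h)
    show "AE \<omega> in M. W \<omega> * h \<omega> \<le> a \<omega> + c \<omega> - C * d \<omega>"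
      using increment[of P b, OF b, of n] AE_space
    proof eventually_elim
      case (elim \<omega>)
      show ?case
      proof (cases "W \<omega> = 0")
        case True then show ?thesis by (simp add: a_def c_def d_def)
      next
        case False
        have e: "clipped_rate b n \<omega> = g (X n \<omega>) / X n \<omega>" "clipped_vol b n \<omega> = sqrt (sigma2 (X n \<omega>)) / X n \<omega>"
          using elim W(3)[OF elim(2) False] by auto
        have alg: "w * (u * (1 + (1 - u) * (p * r - k * (r\<^sup>2 + v\<^sup>2)) - 68 * (r ^ 3 + (1 + c) * v ^ 3)))
            = w * u * (1 + (1 - u) * (p * r - k * r\<^sup>2) - 68 * (r ^ 3 + v ^ 3)) + w * u * ((1 - u) * (- 1 * k * v\<^sup>2))
              - c * (w * u * (68 * v ^ 3))" for w u p r v k c :: real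
          by (simp add: algebra_simps)
        have uX: "saturated p R (X n \<omega>) = u \<omega>" by (simp add: u_def)
        have "W \<omega> * h \<omega> \<le> W \<omega> * saturated_bound p R (X n \<omega>)"
          using W(2)[OF elim(2)] h(2)[OF elim(2) False] by (intro mult_left_mono)
        also have "\<dots> = a \<omega> + c \<omega> - C * d \<omega>"
          unfolding saturated_bound_def Let_def uX e[symmetric] a_def c_def d_def k_def by (rule alg)
        finally show ?thesis .
      qed
    qed
  qed
  also have "\<dots> \<le> (\<integral>\<omega>. W \<omega> * saturated p R (X (Suc n) \<omega>) \<partial>M)"
    by (rule moment_ge[OF w d Z le])
  finally show ?thesis .
qed

text \<open>
In the present state, whatever it is, the noise exceeds a fixed multiple of its standard deviation with a
probability bounded below, in either direction; the sign \<open>e\<close> selects the direction.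
\<close>

lemma jump_chance:
  assumes e: "e = 1 \<or> e = -1" and W: "weight n W" "\<And>\<omega>. \<omega> \<in> space M \<Longrightarrow> 0 \<le> W \<omega>"
  shows "jump_prob q C * (\<integral>\<omega>. W \<omega> \<partial>M) \<le> (\<integral>\<omega>. W \<omega> * indicator {\<omega>. e * Y n \<omega> \<le> - jump q C} \<omega> \<partial>M)"
proof -
  have q': "2 < q" using q by simp
  define a where "a = (\<lambda>\<omega>. (-1/4) * W \<omega>)"
  define b where "b = (\<lambda>\<omega>. (- spread q C * e) * W \<omega>)"
  define d where "d = (\<lambda>\<omega>. (2 * spread q C powr (2 - q)) * W \<omega>)"
  define Z where "Z = (\<lambda>\<omega>. 2 * (spread q C)\<^sup>2 * (W \<omega> * indicator {\<omega>. e * Y n \<omega> \<le> - jump q C} \<omega>))"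
  have w: "weight n a" "weight n b" "weight n W" "weight n d" unfolding a_def b_def d_def by (intro weight_intros W)+
  have d: "0 \<le> d \<omega>" if "\<omega> \<in> space M" for \<omega> using W(2)[OF that] by (simp add: d_def)
  have Wi: "integrable M (\<lambda>\<omega>. W \<omega> * indicator {\<omega>. e * Y n \<omega> \<le> - jump q C} \<omega>)"
    by (rule Bochner_Integration.integrable_bound[OF weight_integrable[OF W(1)]])
      (use weight_meas(2)[OF W(1)] in \<open>auto simp: indicator_def intro!: AE_I2\<close>)
  then have Z: "integrable M Z" unfolding Z_def by (rule integrable_mult_right)
  have le: "AE \<omega> in M. a \<omega> + b \<omega> * Y n \<omega> + W \<omega> * (Y n \<omega>)\<^sup>2 - d \<omega> * \<bar>Y n \<omega>\<bar> powr q \<le> Z \<omega>"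
  proof (rule AE_I2)
    fix \<omega> assume o: "\<omega> \<in> space M"
    have s: "(e * Y n \<omega>)\<^sup>2 = (Y n \<omega>)\<^sup>2" "\<bar>e * Y n \<omega>\<bar> = \<bar>Y n \<omega>\<bar>" using e by auto
    have "W \<omega> * (- 1/4 - spread q C * (e * Y n \<omega>) + (Y n \<omega>)\<^sup>2 - 2 * spread q C powr (2 - q) * \<bar>Y n \<omega>\<bar> powr q)
       \<le> W \<omega> * (2 * (spread q C)\<^sup>2 * (if e * Y n \<omega> \<le> - (1 / (8 * spread q C)) then 1 else 0))"
      using below_indicator_ge[OF spread(1)[OF q', of C], of q "e * Y n \<omega>"] q W(2)[OF o]
      unfolding s by (intro mult_left_mono) auto
    then show "a \<omega> + b \<omega> * Y n \<omega> + W \<omega> * (Y n \<omega>)\<^sup>2 - d \<omega> * \<bar>Y n \<omega>\<bar> powr q \<le> Z \<omega>"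
      by (cases "e * Y n \<omega> \<le> - (1 / (8 * spread q C))")
        (simp_all add: a_def b_def d_def Z_def jump_def algebra_simps)
  qed
  have I0: "0 \<le> (\<integral>\<omega>. W \<omega> \<partial>M)" using W by (intro integral_nonneg_AE AE_I2)
  have "1/2 * (\<integral>\<omega>. W \<omega> \<partial>M) \<le> (3/4 - C * (2 * spread q C powr (2 - q))) * (\<integral>\<omega>. W \<omega> \<partial>M)"
    using spread(2)[OF q' C] I0 by (intro mult_right_mono) (auto simp: algebra_simps)
  also have "\<dots> = (\<integral>\<omega>. a \<omega> + W \<omega> - C * d \<omega> \<partial>M)"
    using weight_integrable[OF W(1)] by (simp add: a_def d_def algebra_simps)
  also have "\<dots> \<le> (\<integral>\<omega>. Z \<omega> \<partial>M)" by (rule moment_ge[OF w d Z le])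
  also have "\<dots> = 2 * (spread q C)\<^sup>2 * (\<integral>\<omega>. W \<omega> * indicator {\<omega>. e * Y n \<omega> \<le> - jump q C} \<omega> \<partial>M)" by (simp add: Z_def)
  finally show ?thesis using spread(1)[OF q', of C] by (simp add: jump_prob_def pos_divide_le_eq mult_ac)
qed

end

section \<open>The process above a fixed level\<close>

text \<open>
The assumptions on \<open>A\<close> hold for all large values. Neither they nor the constants \<open>b\<close> and \<open>\<eta>\<close> refer to
the exponents \<open>\<alpha>\<close> and \<open>\<beta>\<close>. The last two bounds in \<open>above\<close> say that a jump of the noise by \<open>jump q C\<close> standard deviations
dominates the drift and moves the process by at least \<open>\<eta>\<close>.
\<close>

locale near_critical =
  noisy_growth M F S g sigma2 x0 X \<xi> q C + growth_drift g lam
  for M :: "'a measure" and F S g sigma2 x0 X \<xi> q C lam +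
  fixes \<theta> A b \<eta> :: real
  assumes theta: "0 < \<theta>" "\<theta> < 1"
    and lim_sigma2: "((\<lambda>x. 2 * x * g x / sigma2 x) \<longlongrightarrow> \<theta>) at_top"
    and A: "1 \<le> A" and b: "0 < b" and eta: "0 < \<eta>"
    and above: "\<And>x. A < x \<Longrightarrow> g x / x \<le> b" "\<And>x. A < x \<Longrightarrow> sqrt (sigma2 x) / x \<le> b"
      "\<And>x. A < x \<Longrightarrow> (sqrt (sigma2 x) / x)\<^sup>2 \<le> 3 / \<theta> * (g x / x)"
      "\<And>x. A < x \<Longrightarrow> g x \<le> jump q C / 2 * sqrt (sigma2 x)"
      "\<And>x. A < x \<Longrightarrow> \<eta> \<le> jump q C / 2 * sqrt (sigma2 x)"
    and regular: "\<And>x y. A \<le> x \<Longrightarrow> x \<le> y \<Longrightarrow> g y / y * y powr (lam/2) \<le> g x / x * x powr (lam/2)"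
      "\<And>x y. A \<le> x \<Longrightarrow> x \<le> y \<Longrightarrow> g x / x * x powr (2*lam) \<le> g y / y * y powr (2*lam)"
      "\<And>x y. A \<le> x \<Longrightarrow> x \<le> y \<Longrightarrow> x / g x - lam/2 * growth_G g x \<le> y / g y - lam/2 * growth_G g y"
    and start_above: "A < x0"

begin

abbreviation "vol x \<equiv> sqrt (sigma2 x) / x"

definition alive :: "nat \<Rightarrow> 'a set" where
  "alive n = {\<omega> \<in> space M. \<forall>k\<le>n. A < X k \<omega>}"

lemma X_exceeds_sets: "{\<omega> \<in> space M. a < X n \<omega>} \<in> sets (F n)" "{\<omega> \<in> space M. a \<le> X n \<omega>} \<in> sets (F n)"
proof -
  note [measurable] = adapted[of n]
  show "{\<omega> \<in> space M. a < X n \<omega>} \<in> sets (F n)" "{\<omega> \<in> space M. a \<le> X n \<omega>} \<in> sets (F n)"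
    unfolding space_Fn[of n, symmetric] by measurable
qed

lemma alive_sets: "alive n \<in> sets (F n)"
proof -
  have "{\<omega> \<in> space M. A < X k \<omega>} \<in> sets (F n)" if "k \<le> n" for k
    using X_exceeds_sets(1)[of A k] sets_F_mono[OF that] by blast
  then have "(\<Inter>k\<in>{..n}. {\<omega> \<in> space M. A < X k \<omega>}) \<in> sets (F n)" by (intro sets.finite_INT) auto
  moreover have "(\<Inter>k\<in>{..n}. {\<omega> \<in> space M. A < X k \<omega>}) = alive n" by (auto simp: alive_def)
  ultimately show ?thesis by simp
qed

lemma alive_M [measurable]: "alive n \<in> sets M" by (rule sets_F_M[OF alive_sets])

lemma alive_Suc: "\<omega> \<in> alive (Suc n) \<longleftrightarrow> \<omega> \<in> alive n \<and> A < X (Suc n) \<omega>"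
  by (auto simp: alive_def le_Suc_eq)

lemma alive_D: "\<omega> \<in> alive n \<Longrightarrow> A < X n \<omega>" "\<omega> \<in> alive n \<Longrightarrow> \<omega> \<in> space M"
  by (auto simp: alive_def)

lemma alive_decreasing: "m \<le> n \<Longrightarrow> prob (alive n) \<le> prob (alive m)"
  by (intro finite_measure_mono) (auto simp: alive_def)

lemma above_range: "\<forall>x. A < x \<longrightarrow> 0 < x \<and> g x / x \<le> b \<and> sqrt (sigma2 x) / x \<le> b"
proof (intro allI impI)
  fix x assume x: "A < x"
  show "0 < x \<and> g x / x \<le> b \<and> sqrt (sigma2 x) / x \<le> b"
    using above(1,2)[OF x] A x by simp
qed

lemma rate_pos_above: "A < x \<Longrightarrow> 0 < rate x" using A by (intro rate_pos) auto

lemma vol_pos: "A < x \<Longrightarrow> 0 < vol x" using A sigma2_pos[of x] by simp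

lemma vol_cubed: "A < x \<Longrightarrow> vol x ^ 3 \<le> 3 / \<theta> * rate x * vol x"
proof -
  assume x: "A < x"
  have "vol x ^ 3 = (vol x)\<^sup>2 * vol x" by (simp add: power3_eq_cube power2_eq_square)
  also have "\<dots> \<le> 3 / \<theta> * rate x * vol x" using above(3)[OF x] vol_pos[OF x] by (intro mult_right_mono) auto
  finally show ?thesis .
qed

lemma vol_tendsto: "(vol \<longlongrightarrow> 0) at_top"
proof -
  have lim: "((\<lambda>x. 3 / \<theta> * rate x) \<longlongrightarrow> 0) at_top"
    by (rule tendsto_mult_right_zero[OF rate_tendsto])
  have ev: "eventually (\<lambda>x. norm ((vol x)\<^sup>2) \<le> 3 / \<theta> * rate x) at_top"
    using eventually_gt_at_top[of A]
  proof eventually_elim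
    case (elim x)
    have "norm ((vol x)\<^sup>2) = (vol x)\<^sup>2" by (simp only: real_norm_def abs_power2)
    then show ?case using above(3)[OF elim] by linarith
  qed
  from Lim_null_comparison[OF ev lim]
  have "((\<lambda>x. sqrt ((vol x)\<^sup>2)) \<longlongrightarrow> sqrt 0) at_top" by (rule tendsto_real_sqrt)
  then have "((\<lambda>x. \<bar>vol x\<bar>) \<longlongrightarrow> 0) at_top" by (simp only: real_sqrt_abs real_sqrt_zero)
  then show ?thesis by (rule tendsto_rabs_zero_cancel)
qed

text \<open>
The squares of the relative drift and of the relative standard deviation are \<open>O(rate x)\<close>, and both tend to 0.
\<close>

lemma cubes_negligible:
  assumes "0 < e"
  shows "eventually (\<lambda>x. A < x \<and> rate x ^ 3 + (1 + C) * vol x ^ 3 \<le> e * rate x) at_top"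
proof -
  have "((\<lambda>x. (rate x)\<^sup>2 + (1 + C) * (3 / \<theta> * vol x)) \<longlongrightarrow> 0\<^sup>2 + (1 + C) * (3 / \<theta> * 0)) at_top"
    by (intro tendsto_intros rate_tendsto vol_tendsto)
  then have "eventually (\<lambda>x. (rate x)\<^sup>2 + (1 + C) * (3 / \<theta> * vol x) < e) at_top"
    using assms by (intro order_tendstoD) auto
  then show ?thesis using eventually_gt_at_top[of A]
  proof eventually_elim
    case (elim x)
    have "rate x ^ 3 + (1 + C) * vol x ^ 3 \<le> rate x ^ 3 + (1 + C) * (3 / \<theta> * rate x * vol x)"
      using vol_cubed[OF elim(2)] C by (intro add_left_mono mult_left_mono) auto
    also have "\<dots> = ((rate x)\<^sup>2 + (1 + C) * (3 / \<theta> * vol x)) * rate x"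
 (is "_ = ?rhs")
    proof -
      have "s ^ 3 + (1 + C) * (k * s * v) = (s\<^sup>2 + (1 + C) * (k * v)) * s" for s v k :: real
        by (simp add: power3_eq_cube power2_eq_square algebra_simps)
      then show ?thesis .
    qed
    also have "\<dots> \<le> e * rate x" using elim rate_pos_above[OF elim(2)] by (intro mult_right_mono) auto
    finally show ?case using elim by blast
  qed
qed

lemma vol_sq: "A < x \<Longrightarrow> (vol x)\<^sup>2 * (2 * x * g x / sigma2 x) = 2 * rate x"
proof -
  assume x: "A < x"
  have s: "0 < sigma2 x" "0 < x" using x A sigma2_pos[of x] by auto
  have "(vol x)\<^sup>2 = sigma2 x / (x * x)" using s by (simp add: power_divide power2_eq_square)
  also have "\<dots> * (2 * x * g x / sigma2 x) = 2 * rate x" using s by simp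
  finally show ?thesis .
qed

text \<open>
The two leading terms sum to about \<open>p (1 - (1 - p) / \<theta>) rate x\<close>, which is negative for \<open>p < 1 - \<theta>\<close>. The
auxiliary \<open>\<theta>'\<close> between \<open>\<theta>\<close> and \<open>1 - p\<close> leaves room for the limit defining \<open>\<theta>\<close> and for the cubic error.
\<close>

lemma power_bound_eventually:
  assumes p: "0 < p" "p < 1 - \<theta>"
  shows "\<exists>\<kappa>>0. eventually (\<lambda>x. power_bound p x \<le> 1 - \<kappa> * rate x) at_top"
proof -
  define \<theta>' where "\<theta>' = (\<theta> + (1 - p)) / 2"
  have th: "\<theta> < \<theta>'" "\<theta>' < 1 - p" using p by (auto simp: \<theta>'_def)
  define \<kappa> where "\<kappa> = p * ((1 - p) / \<theta>' - 1) / 2"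
  have k: "0 < \<kappa>" using th p theta by (auto simp: \<kappa>_def)
  have "eventually (\<lambda>x. 2 * x * g x / sigma2 x < \<theta>') at_top" by (rule order_tendstoD(2)[OF lim_sigma2 th(1)])
  moreover have "eventually (\<lambda>x. A < x \<and> rate x ^ 3 + (1 + C) * vol x ^ 3 \<le> \<kappa> / 64 * rate x) at_top"
    using k by (intro cubes_negligible) auto
  ultimately have "eventually (\<lambda>x. power_bound p x \<le> 1 - \<kappa> * rate x) at_top"
  proof eventually_elim
    case (elim x)
    then have x: "A < x" by blast
    have "2 * rate x \<le> (vol x)\<^sup>2 * \<theta>'"
      unfolding vol_sq[OF x, symmetric] using elim by (intro mult_left_mono) auto
    then have v: "2 * rate x / \<theta>' \<le> (vol x)\<^sup>2" using th theta by (subst pos_divide_le_eq) auto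
    have "p * (1 - p) / 2 * (2 * rate x / \<theta>') \<le> p * (1 - p) / 2 * (vol x)\<^sup>2"
      using p theta by (intro mult_left_mono v) auto
    moreover have "p * rate x - p * (1 - p) / 2 * (2 * rate x / \<theta>') = - 2 * \<kappa> * rate x"
    proof -
      have "p * s - p * (1 - p) / 2 * (2 * s / \<theta>') = - 2 * \<kappa> * s" for s
        using th theta by (simp add: \<kappa>_def field_simps)
      then show ?thesis .
    qed
    moreover have "1 + a - v + 64 * d \<le> 1 - \<kappa> * s"
      if "v' \<le> v" "a - v' = - 2 * \<kappa> * s" "d \<le> \<kappa> / 64 * s" for a v v' d s
      using that by (simp add: algebra_simps)
    ultimately show ?case using elim unfolding power_bound_def by blast
  qed
  then show ?thesis using k by blast
qed

lemma power_bound_le: "0 < p \<Longrightarrow> p < 1 \<Longrightarrow> A < x \<Longrightarrow> power_bound p x \<le> 1 + (b + 64 * (b ^ 3 + (1 + C) * b ^ 3))"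
proof -
  assume p: "0 < p" "p < 1" and x: "A < x"
  have r: "0 \<le> rate x" "rate x \<le> b" and v: "0 \<le> vol x" "vol x \<le> b"
    using above[OF x] rate_pos_above[OF x] vol_pos[OF x] by auto
  have "p * rate x \<le> 1 * b" using p r by (intro mult_mono) auto
  moreover have "rate x ^ 3 \<le> b ^ 3" "vol x ^ 3 \<le> b ^ 3" using r v by (auto intro: power_mono)
  moreover have "(1 + C) * vol x ^ 3 \<le> (1 + C) * b ^ 3" using calculation(3) C by (intro mult_left_mono) auto
  moreover have "0 \<le> p * (1 - p) / 2 * (vol x)\<^sup>2" using p by simp
  ultimately show ?thesis unfolding power_bound_def by argo
qed

text \<open>
Above \<open>A\<close>, one step multiplies a saturated power in mean by at least \<open>1 - loss * rate x\<close>.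
\<close>

definition loss :: real where
  "loss = 2 * (b + 3 / \<theta>) + 68 * (b\<^sup>2 + (1 + C) * (3 / \<theta> * b))"

lemma loss_pos: "0 < loss"
  using b theta C by (auto simp: loss_def intro!: add_pos_nonneg)

lemma saturated_bound_ge:
  assumes p: "0 < p" "p < 1" and R: "0 < R" and x: "A < x"
  shows "saturated p R x * (1 - loss * rate x) \<le> saturated_bound p R x"
proof -
  define u where "u = saturated p R x"
  have u: "0 \<le> u" "u < 1" using saturated_bounds[OF R] by (auto simp: u_def)
  have r: "0 \<le> rate x" "rate x \<le> b" and v: "0 \<le> vol x" "vol x \<le> b"
    using above[OF x] rate_pos_above[OF x] vol_pos[OF x] by auto
  have k: "0 \<le> p * (1 - p) / 2 + u" "p * (1 - p) / 2 + u \<le> 2"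
    using p u mult_mono[of p 1 "1-p" 1] by auto
  have r2: "(rate x)\<^sup>2 \<le> b * rate x" using mult_right_mono[OF r(2,1)] by (simp only: power2_eq_square)
  have "(p * (1 - p) / 2 + u) * ((rate x)\<^sup>2 + (vol x)\<^sup>2) \<le> 2 * (b * rate x + 3 / \<theta> * rate x)"
    using k r2 above(3)[OF x] by (intro mult_mono add_mono) auto
  then have "p * rate x - (p * (1 - p) / 2 + u) * ((rate x)\<^sup>2 + (vol x)\<^sup>2) \<ge> - (2 * (b * rate x + 3 / \<theta> * rate x))"
    using mult_nonneg_nonneg[OF less_imp_le[OF p(1)] r(1)] by linarith
  then have "(1 - u) * - (2 * (b * rate x + 3 / \<theta> * rate x)) \<le> (1 - u) * (p * rate x - (p * (1 - p) / 2 + u) * ((rate x)\<^sup>2 + (vol x)\<^sup>2))"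
    using u by (intro mult_left_mono) auto
  moreover have "(1 - u) * (2 * (b * rate x + 3 / \<theta> * rate x)) \<le> 1 * (2 * (b * rate x + 3 / \<theta> * rate x))"
  proof (rule mult_right_mono)
    have "0 \<le> b * rate x" by (rule mult_nonneg_nonneg[OF _ r(1)]) (use b in simp)
    moreover have "0 \<le> 3 / \<theta> * rate x" by (rule mult_nonneg_nonneg[OF _ r(1)]) (use theta in simp)
    ultimately have "0 \<le> b * rate x + 3 / \<theta> * rate x" by (rule add_nonneg_nonneg)
    then show "0 \<le> 2 * (b * rate x + 3 / \<theta> * rate x)" by (rule mult_nonneg_nonneg[OF zero_le_numeral])
  qed (use u in simp)
  moreover have "68 * (rate x ^ 3 + (1 + C) * vol x ^ 3) \<le> 68 * (b\<^sup>2 * rate x + (1 + C) * (3 / \<theta> * rate x * b))"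
  proof -
    have "rate x ^ 3 = (rate x)\<^sup>2 * rate x" by (simp add: power3_eq_cube power2_eq_square)
    also have "\<dots> \<le> b\<^sup>2 * rate x" using r by (intro mult_right_mono power_mono) auto
    finally have 1: "rate x ^ 3 \<le> b\<^sup>2 * rate x" .
    have "vol x ^ 3 \<le> 3 / \<theta> * rate x * vol x" by (rule vol_cubed[OF x])
    also have "\<dots> \<le> 3 / \<theta> * rate x * b" by (rule mult_left_mono[OF v(2) mult_nonneg_nonneg[OF _ r(1)]]) (use theta in simp)
    finally have "vol x ^ 3 \<le> 3 / \<theta> * rate x * b" .
    then have "(1 + C) * vol x ^ 3 \<le> (1 + C) * (3 / \<theta> * rate x * b)" using C by (intro mult_left_mono) auto
    then show ?thesis using 1 by simp
  qed
  moreover have "loss * rate x = 2 * (b * rate x + 3 / \<theta> * rate x) + 68 * (b\<^sup>2 * rate x + (1 + C) * (3 / \<theta> * rate x * b))"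
  proof -
    have "loss * s = 2 * (b * s + 3 / \<theta> * s) + 68 * (b\<^sup>2 * s + (1 + C) * (3 / \<theta> * s * b))" for s
      by (simp add: loss_def algebra_simps)
    then show ?thesis .
  qed
  ultimately have "1 - loss * rate x \<le> 1 + (1 - u) * (p * rate x - (p * (1 - p) / 2 + u) * ((rate x)\<^sup>2 + (vol x)\<^sup>2))
      - 68 * (rate x ^ 3 + (1 + C) * vol x ^ 3)" by linarith
  then have "u * (1 - loss * rate x) \<le> u * (1 + (1 - u) * (p * rate x - (p * (1 - p) / 2 + u) * ((rate x)\<^sup>2 + (vol x)\<^sup>2))
      - 68 * (rate x ^ 3 + (1 + C) * vol x ^ 3))" using u by (intro mult_left_mono)
  then show ?thesis by (simp add: saturated_bound_def Let_def u_def)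
qed

text \<open>
While the saturated power is below a threshold \<open>u\<close>, its curvature correction is dominated by the leading
terms \<open>p (1 - (1 - p) / \<theta>) rate x\<close>, which are positive for \<open>p > 1 - \<theta>\<close>. The threshold and the range of \<open>x\<close> do not
depend on \<open>R\<close>.
\<close>

lemma saturated_bound_eventually:
  assumes p: "1 - \<theta> < p" "p < 1"
  shows "\<exists>u>0. u < 1 \<and> eventually (\<lambda>x. \<forall>R>0. saturated p R x \<le> u \<longrightarrow> saturated p R x \<le> saturated_bound p R x) at_top"
proof -
  have p0: "0 < p" using p theta by simp
  define \<theta>' where "\<theta>' = (\<theta> + (1 - p)) / 2"
  have th: "\<theta>' < \<theta>" "1 - p < \<theta>'" "0 < \<theta>'" using p theta by (auto simp: \<theta>'_def)
  define \<kappa> where "\<kappa> = p * (1 - (1 - p) / \<theta>')"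
  have k: "0 < \<kappa>" using th p0 by (auto simp: \<kappa>_def)
  \<comment> \<open>small enough for the term \<open>u1 * (rate\<^sup>2 + vol\<^sup>2)\<close> to cost at most a quarter of the leading term\<close>
  define u1 where "u1 = min (1/2) (\<kappa> / (4 * (1 + 3 / \<theta>)))"
  have u1: "0 < u1" "u1 \<le> 1/2" "u1 * (1 + 3 / \<theta>) \<le> \<kappa> / 4"
  proof -
    show "0 < u1" using k theta by (auto simp: u1_def add_pos_pos)
    show "u1 \<le> 1/2" unfolding u1_def by (rule min.cobounded1)
    have "u1 * (1 + 3 / \<theta>) \<le> \<kappa> / (4 * (1 + 3 / \<theta>)) * (1 + 3 / \<theta>)"
      using theta by (intro mult_right_mono) (auto simp: u1_def)
    also have "\<dots> = \<kappa> / 4"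
    proof -
      have "1 + 3 / \<theta> \<noteq> 0" using theta by (simp add: add_pos_pos less_imp_neq[symmetric])
      then show ?thesis by (metis divide_divide_eq_left' nonzero_eq_divide_eq mult.commute)
    qed
    finally show "u1 * (1 + 3 / \<theta>) \<le> \<kappa> / 4" .
  qed
  have "eventually (\<lambda>x. \<theta>' < 2 * x * g x / sigma2 x) at_top" by (rule order_tendstoD(1)[OF lim_sigma2 th(1)])
  moreover have "eventually (\<lambda>x. rate x < min 1 (\<kappa> / 4)) at_top"
    using k by (intro order_tendstoD[OF rate_tendsto]) auto
  \<comment> \<open>\<open>272 = 4 * 68\<close>: of the leading term \<open>\<kappa> * rate x\<close> one half is left, and a quarter after multiplication by \<open>1 - u\<close>\<close>
  moreover have "eventually (\<lambda>x. A < x \<and> rate x ^ 3 + (1 + C) * vol x ^ 3 \<le> \<kappa> / 272 * rate x) at_top"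
    using k by (intro cubes_negligible) auto
  ultimately have "eventually (\<lambda>x. \<forall>R>0. saturated p R x \<le> u1 \<longrightarrow> saturated p R x \<le> saturated_bound p R x) at_top"
  proof eventually_elim
    case (elim x)
    then have x: "A < x" by blast
    have r: "0 \<le> rate x" "rate x \<le> 1" "rate x \<le> \<kappa> / 4" using elim rate_pos_above[OF x] by auto
    have "(vol x)\<^sup>2 * \<theta>' \<le> 2 * rate x"
      unfolding vol_sq[OF x, symmetric] using elim by (intro mult_left_mono) auto
    then have v: "(vol x)\<^sup>2 \<le> 2 * rate x / \<theta>'" using th by (subst pos_le_divide_eq) auto
    have "p * (1 - p) / 2 * (vol x)\<^sup>2 \<le> p * (1 - p) / 2 * (2 * rate x / \<theta>')"
      using p p0 by (intro mult_left_mono v) auto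
    moreover have "p * rate x - p * (1 - p) / 2 * (2 * rate x / \<theta>') = \<kappa> * rate x"
    proof -
      have "p * s - p * (1 - p) / 2 * (2 * s / \<theta>') = \<kappa> * s" for s
        using th by (simp add: \<kappa>_def field_simps)
      then show ?thesis .
    qed
    moreover have "p * (1 - p) / 2 * (rate x)\<^sup>2 \<le> \<kappa> / 4 * rate x"
    proof -
      have "p * (1 - p) / 2 \<le> 1" using p p0 mult_mono[of p 1 "1-p" 1] by auto
      then have "p * (1 - p) / 2 * (rate x)\<^sup>2 \<le> 1 * (rate x)\<^sup>2" by (intro mult_right_mono) auto
      also have "\<dots> \<le> \<kappa> / 4 * rate x"
        using mult_right_mono[OF r(3,1)] by (simp only: power2_eq_square mult_1_left)
      finally show ?thesis .
    qed
    ultimately have main: "3 / 4 * \<kappa> * rate x \<le> p * rate x - p * (1 - p) / 2 * ((rate x)\<^sup>2 + (vol x)\<^sup>2)"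
      unfolding distrib_left[of "p * (1 - p) / 2"] by linarith
    show ?case
    proof (intro allI impI)
      fix R :: real assume R: "0 < R" "saturated p R x \<le> u1"
      define u where "u = saturated p R x"
      have u: "0 \<le> u" "u \<le> u1" using saturated_bounds[OF R(1)] R by (auto simp: u_def)
      have "(rate x)\<^sup>2 + (vol x)\<^sup>2 \<le> (1 + 3 / \<theta>) * rate x"
      proof -
        have "(rate x)\<^sup>2 \<le> 1 * rate x" using r unfolding power2_eq_square by (intro mult_right_mono) auto
        then show ?thesis using above(3)[OF x] unfolding distrib_right by linarith
      qed
      then have "u * ((rate x)\<^sup>2 + (vol x)\<^sup>2) \<le> u1 * ((1 + 3 / \<theta>) * rate x)"
        using u by (intro mult_mono) auto
      also have "\<dots> \<le> \<kappa> / 4 * rate x" using mult_right_mono[OF u1(3) r(1)] by (simp only: mult.assoc)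
      finally have F: "\<kappa> / 2 * rate x \<le> p * rate x - (p * (1 - p) / 2 + u) * ((rate x)\<^sup>2 + (vol x)\<^sup>2)"
        using main unfolding distrib_right[of "p * (1 - p) / 2"] by linarith
      have m: "0 \<le> \<kappa> / 2 * rate x" by (rule mult_nonneg_nonneg[OF _ r(1)]) (use k in simp)
      have "1/2 * (\<kappa> / 2 * rate x) \<le> (1 - u) * (p * rate x - (p * (1 - p) / 2 + u) * ((rate x)\<^sup>2 + (vol x)\<^sup>2))"
        by (rule mult_mono[OF _ F _ m]) (use u u1 in auto)
      moreover have "1 \<le> 1 + l - 68 * d" if "1/2 * (\<kappa> / 2 * s) \<le> l" "d \<le> \<kappa> / 272 * s" for l d s
        using that by (simp add: algebra_simps)
      ultimately have "1 \<le> 1 + (1 - u) * (p * rate x - (p * (1 - p) / 2 + u) * ((rate x)\<^sup>2 + (vol x)\<^sup>2))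
          - 68 * (rate x ^ 3 + (1 + C) * vol x ^ 3)" using elim by blast
      then have "u * 1 \<le> u * (1 + (1 - u) * (p * rate x - (p * (1 - p) / 2 + u) * ((rate x)\<^sup>2 + (vol x)\<^sup>2))
          - 68 * (rate x ^ 3 + (1 + C) * vol x ^ 3))" using u by (intro mult_left_mono)
      then show "saturated p R x \<le> saturated_bound p R x" by (simp add: saturated_bound_def Let_def u_def)
    qed
  qed
  then show ?thesis using u1 by (intro exI[of _ u1]) auto
qed

text \<open>
At \<open>x = clock n\<close> this says that \<open>n rate (clock n)\<close> is bounded: a relative change by \<open>rate\<close> per step amounts to a bounded
factor over \<open>n\<close> steps.
\<close>

lemma G_rate_bounded: "\<exists>c>0. \<forall>x>A. G x * rate x \<le> c"
proof (intro exI[of _ "2 / lam + G A * b"] conjI allI impI)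
  have GA: "0 \<le> G A" using G_strict_mono[of 1 A] A by (cases "A = 1") (auto simp: G_one)
  show "0 < 2 / lam + G A * b" using GA b lam_pos by (simp add: add_pos_nonneg)
  fix x assume x: "A < x"
  have g: "0 < g x" "0 < g A" using x A g_pos by auto
  have "A / g A - lam / 2 * G A \<le> x / g x - lam / 2 * G x" using x by (intro regular(3)) auto
  moreover have "0 < A / g A" using A g by auto
  ultimately have "lam / 2 * G x \<le> x / g x + lam / 2 * G A" by linarith
  then have "2 / lam * (lam / 2 * G x) \<le> 2 / lam * (x / g x + lam / 2 * G A)" using lam_pos by (intro mult_left_mono) auto
  then have "G x \<le> 2 / lam * (x / g x) + G A" using lam_pos by (simp add: algebra_simps)
  then have "G x * rate x \<le> (2 / lam * (x / g x) + G A) * rate x" using rate_pos_above[OF x] by (intro mult_right_mono) auto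
  also have "\<dots> = 2 / lam + G A * rate x" using g x A by (simp add: field_simps)
  also have "\<dots> \<le> 2 / lam + G A * b" using GA above(1)[OF x] by (intro add_left_mono mult_left_mono)
  finally show "G x * rate x \<le> 2 / lam + G A * b" .
qed

lemma rate_comparable:
  assumes y: "0 < y" "y \<le> 1" "A \<le> y * R" and x: "y * R \<le> x"
  shows "rate x \<le> y powr (- 2 * lam) * rate R"
proof -
  have z1: "0 < y * R" "0 < x" using x y A by auto
  then have z: "0 < y * R" "0 < x" "0 < R" using zero_less_mult_pos[of y R] y by auto
  have "rate x * x powr (lam/2) \<le> rate (y * R) * (y * R) powr (lam/2)" using y x by (intro regular(1))
  also have "\<dots> \<le> rate (y * R) * x powr (lam/2)"
    using z x lam_pos rate_pos[OF z(1)] by (intro mult_left_mono powr_mono2) auto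
  finally have 1: "rate x \<le> rate (y * R)" by (rule mult_right_le_imp_le) (use z in simp)
  have "rate (y * R) * (y * R) powr (2 * lam) \<le> rate R * R powr (2 * lam)"
    using y z by (intro regular(2)) (auto simp: mult_left_le_one_le)
  then have "(rate (y * R) * y powr (2 * lam)) * R powr (2 * lam) \<le> rate R * R powr (2 * lam)"
    using z y by (simp only: powr_mult mult.assoc)
  then have 2: "rate (y * R) * y powr (2 * lam) \<le> rate R" by (rule mult_right_le_imp_le) (use z in simp)
  have "y powr (2 * lam) * y powr (- 2 * lam) = 1" using y by (simp flip: powr_add)
  then have "rate (y * R) = y powr (- 2 * lam) * (rate (y * R) * y powr (2 * lam))"
    by (metis mult.assoc mult.commute mult_1_right)
  also have "\<dots> \<le> y powr (- 2 * lam) * rate R" using 2 by (intro mult_left_mono) auto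
  finally show ?thesis using 1 by linarith
qed

lemma X_rises:
  "AE \<omega> in M. A < X n \<omega> \<longrightarrow> - 1 * Y n \<omega> \<le> - jump q C \<longrightarrow> X n \<omega> + \<eta> \<le> X (Suc n) \<omega>"
  using sd_eq[of n] step_normalised[of n]
proof eventually_elim
  case (elim \<omega>)
  show ?case
  proof (intro impI)
    assume a: "A < X n \<omega>" "- 1 * Y n \<omega> \<le> - jump q C"
    have "sd n \<omega> * jump q C \<le> sd n \<omega> * Y n \<omega>" using a elim by (intro mult_left_mono) auto
    moreover have "\<eta> \<le> jump q C / 2 * sd n \<omega>" using above(5)[OF a(1)] elim by simp
    moreover have "0 \<le> g (X n \<omega>)" using g_pos[of "X n \<omega>"] a A by simp
    ultimately show "X n \<omega> + \<eta> \<le> X (Suc n) \<omega>" using elim(2) eta by (simp add: mult_ac)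
  qed
qed

lemma X_falls:
  "AE \<omega> in M. A < X n \<omega> \<longrightarrow> 1 * Y n \<omega> \<le> - jump q C \<longrightarrow> X (Suc n) \<omega> \<le> X n \<omega> - \<eta>"
  using sd_eq[of n] step_normalised[of n]
proof eventually_elim
  case (elim \<omega>)
  show ?case
  proof (intro impI)
    assume a: "A < X n \<omega>" "1 * Y n \<omega> \<le> - jump q C"
    have "sd n \<omega> * Y n \<omega> \<le> sd n \<omega> * - jump q C" using a elim by (intro mult_left_mono) auto
    moreover have "\<eta> \<le> jump q C / 2 * sd n \<omega>" "g (X n \<omega>) \<le> jump q C / 2 * sd n \<omega>"
      using above(4,5)[OF a(1)] elim by auto
    ultimately show "X (Suc n) \<omega> \<le> X n \<omega> - \<eta>" using elim(2) by (simp add: mult_ac)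
  qed
qed

section \<open>Lower bound\<close>

text \<open>
Each step goes up by \<open>\<eta>\<close> with conditional probability at least \<open>jump_prob q C\<close>, and a rising path stays above \<open>A\<close>.
\<close>

lemma climb_prob: "jump_prob q C ^ k \<le> prob (alive k \<inter> {\<omega> \<in> space M. x0 + real k * \<eta> \<le> X k \<omega>})"
proof (induction k)
  case 0
  have "AE \<omega> in M. \<omega> \<in> alive 0 \<inter> {\<omega> \<in> space M. x0 + real 0 * \<eta> \<le> X 0 \<omega>}"
    using start AE_space by eventually_elim (use start_above in \<open>auto simp: alive_def\<close>)
  then have "prob (alive 0 \<inter> {\<omega> \<in> space M. x0 + real 0 * \<eta> \<le> X 0 \<omega>}) = 1"
    by (subst prob_eq_1) auto
  then show ?case by simp
next
  case (Suc k)
  define E where "E = (\<lambda>k. alive k \<inter> {\<omega> \<in> space M. x0 + real k * \<eta> \<le> X k \<omega>})"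
  have EF: "E k \<in> sets (F k)" unfolding E_def by (intro sets.Int alive_sets X_exceeds_sets)
  have EM [measurable]: "E k \<in> sets M" for k unfolding E_def by measurable
  have "jump_prob q C ^ Suc k \<le> jump_prob q C * prob (E k)"
    using Suc jump_pos by (simp add: E_def mult_left_mono)
  also have "\<dots> = jump_prob q C * (\<integral>\<omega>. indicator (E k) \<omega> \<partial>M)" by simp
  also have "\<dots> \<le> (\<integral>\<omega>. indicator (E k) \<omega> * indicator {\<omega>. - 1 * Y k \<omega> \<le> - jump q C} \<omega> \<partial>M)"
    by (intro jump_chance weight_indicator EF) auto
  also have "\<dots> \<le> (\<integral>\<omega>. indicator (E (Suc k)) \<omega> \<partial>M)"
  proof (rule integral_mono_AE)
    show "integrable M (\<lambda>\<omega>. indicator (E k) \<omega> * indicator {\<omega>. - 1 * Y k \<omega> \<le> - jump q C} \<omega> :: real)"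
      by (rule integrable_const_bound[of _ 1]) (auto simp: indicator_def)
    show "AE \<omega> in M. indicator (E k) \<omega> * indicator {\<omega>. - 1 * Y k \<omega> \<le> - jump q C} \<omega> \<le> (indicator (E (Suc k)) \<omega> :: real)"
      using X_rises[of k]
    proof eventually_elim
      case (elim \<omega>)
      show ?case
      proof (cases "\<omega> \<in> E k \<and> - 1 * Y k \<omega> \<le> - jump q C")
        case True
        then have a: "\<omega> \<in> alive k" "x0 + real k * \<eta> \<le> X k \<omega>" "\<omega> \<in> space M" by (auto simp: E_def)
        then have "X k \<omega> + \<eta> \<le> X (Suc k) \<omega>" using elim True alive_D by blast
        then have "\<omega> \<in> E (Suc k)" using a alive_D(1)[OF a(1)] eta by (auto simp: E_def alive_Suc algebra_simps)
        then show ?thesis by (simp add: indicator_def)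
      next
        case False then show ?thesis by (auto simp: indicator_def)
      qed
    qed
  qed (auto intro: integrable_real_indicator simp: emeasure_eq_measure)
  also have "\<dots> = prob (E (Suc k))" by simp
  finally show ?case by (simp add: E_def)
qed

lemma saturated_meas [measurable]: "(\<lambda>\<omega>. saturated p R (X n \<omega>)) \<in> borel_measurable (F n)"
  using adapted[of n] unfolding saturated_def by measurable

lemma saturated_weight: "0 < R \<Longrightarrow> weight n (\<lambda>\<omega>. saturated p R (X n \<omega>))"
  using saturated_bounds[of R p] saturated_meas
  by (auto simp: weight_def intro!: exI[of _ 1] less_imp_le)

text \<open>
The saturated power is cut off at a level \<open>B \<ge> A\<close>. Paths that fall to \<open>A\<close> or below then contribute 0 at that moment,
so killing them costs nothing, and the drift matters only above \<open>B\<close>.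
\<close>

definition above_level :: "real \<Rightarrow> real \<Rightarrow> real \<Rightarrow> nat \<Rightarrow> real" where
  "above_level p R B n = (\<integral>\<omega>. indicator (alive n) \<omega> * max 0 (saturated p R (X n \<omega>) - saturated p R B) \<partial>M)"

lemma excess_integrable: "0 < R \<Longrightarrow> integrable M (\<lambda>\<omega>. indicator (alive n) \<omega> * max 0 (saturated p R (X n \<omega>) - saturated p R B))"
proof (rule integrable_const_bound[of _ 1])
  assume R: "0 < R"
  have "\<bar>indicator (alive n) \<omega> * max 0 (saturated p R (X n \<omega>) - saturated p R B)\<bar> \<le> 1" for \<omega>
    using saturated_bounds[OF R, of p "X n \<omega>"] saturated_bounds[OF R, of p B]
    by (auto simp: indicator_def)
  then show "AE \<omega> in M. norm (indicator (alive n) \<omega> * max 0 (saturated p R (X n \<omega>) - saturated p R B)) \<le> 1"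
    by simp
  show "(\<lambda>\<omega>. indicator (alive n) \<omega> * max 0 (saturated p R (X n \<omega>) - saturated p R B)) \<in> borel_measurable M"
    using measurable_F_M[OF saturated_meas[of p R n]] by measurable
qed

lemma above_level_le: "0 < R \<Longrightarrow> above_level p R B n \<le> prob (alive n)"
proof -
  assume R: "0 < R"
  have "above_level p R B n \<le> (\<integral>\<omega>. indicator (alive n) \<omega> \<partial>M)"
    unfolding above_level_def
  proof (rule integral_mono[OF excess_integrable[OF R]])
    show "indicator (alive n) \<omega> * max 0 (saturated p R (X n \<omega>) - saturated p R B) \<le> indicator (alive n) \<omega>" for \<omega>
      using saturated_bounds[OF R, of p "X n \<omega>"] saturated_bounds[OF R, of p B]
      by (auto simp: indicator_def)
  qed (auto intro: integrable_real_indicator simp: emeasure_eq_measure)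
  then show ?thesis by simp
qed

text \<open>
Below \<open>B\<close> the cut-off function is 0 and cannot decrease. Above \<open>B\<close> it is bounded below by the saturated
power minus a constant, to which \<open>saturated_drift\<close> applies.
\<close>

lemma above_level_step:
  assumes p: "0 < p" "p < 1" and R: "0 < R" and B: "A \<le> B"
    and \<epsilon>: "\<And>x. B < x \<Longrightarrow> saturated p R B + (1 - \<epsilon>) * (saturated p R x - saturated p R B) \<le> saturated_bound p R x"
  shows "(1 - \<epsilon>) * above_level p R B n \<le> above_level p R B (Suc n)"
proof -
  define s where "s = saturated p R B"
  define W where "W = (indicator (alive n \<inter> {\<omega> \<in> space M. B < X n \<omega>}) :: 'a \<Rightarrow> real)"
  define h where "h = (\<lambda>\<omega>. s + (1 - \<epsilon>) * (saturated p R (X n \<omega>) - s))"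
  have setF: "alive n \<inter> {\<omega> \<in> space M. B < X n \<omega>} \<in> sets (F n)" by (intro sets.Int alive_sets X_exceeds_sets)
  have Ww: "weight n W" unfolding W_def by (rule weight_indicator[OF setF])
  have hw: "weight n h" unfolding h_def by (intro weight_intros saturated_weight R)
  have satM: "integrable M (\<lambda>\<omega>. W \<omega> * saturated p R (X (Suc n) \<omega>))"
    by (intro weight_times_integrable[OF Ww] weight_integrable[OF saturated_weight] R)
  have drift: "(\<integral>\<omega>. W \<omega> * h \<omega> \<partial>M) \<le> (\<integral>\<omega>. W \<omega> * saturated p R (X (Suc n) \<omega>) \<partial>M)"
  proof (rule saturated_drift[OF p R above_range _ Ww _ _ hw])
    show "0 \<le> b" using b by simp
    fix \<omega> assume "\<omega> \<in> space M"
    show "0 \<le> W \<omega>" by (simp add: W_def)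
    assume "W \<omega> \<noteq> 0"
    then have "A < X n \<omega>" "B < X n \<omega>" by (auto simp: W_def indicator_def alive_def split: if_splits)
    then show "A < X n \<omega>" "h \<omega> \<le> saturated_bound p R (X n \<omega>)" using \<epsilon>[of "X n \<omega>"] by (auto simp: h_def s_def)
  qed
  have "(1 - \<epsilon>) * above_level p R B n = (\<integral>\<omega>. (1 - \<epsilon>) * (indicator (alive n) \<omega> * max 0 (saturated p R (X n \<omega>) - s)) \<partial>M)"
    by (simp add: above_level_def s_def)
  also have "\<dots> = (\<integral>\<omega>. W \<omega> * h \<omega> - W \<omega> * s \<partial>M)"
  proof (rule Bochner_Integration.integral_cong[OF refl])
    fix \<omega> assume o: "\<omega> \<in> space M"
    have "saturated p R (X n \<omega>) \<le> s" if "\<not> B < X n \<omega>"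
      unfolding s_def by (rule saturated_mono) (use p R X_nonneg[OF o] that in auto)
    moreover have "s \<le> saturated p R (X n \<omega>)" if "B < X n \<omega>"
      unfolding s_def by (rule saturated_mono) (use p R A B that in auto)
    ultimately show "(1 - \<epsilon>) * (indicator (alive n) \<omega> * max 0 (saturated p R (X n \<omega>) - s)) = W \<omega> * h \<omega> - W \<omega> * s"
      using o by (cases "B < X n \<omega>") (auto simp: W_def h_def indicator_def max_def)
  qed
  also have "\<dots> = (\<integral>\<omega>. W \<omega> * h \<omega> \<partial>M) - (\<integral>\<omega>. W \<omega> * s \<partial>M)"
    by (intro Bochner_Integration.integral_diff weight_integrable[of n] weight_intros Ww hw)
  also have "\<dots> \<le> (\<integral>\<omega>. W \<omega> * saturated p R (X (Suc n) \<omega>) \<partial>M) - (\<integral>\<omega>. W \<omega> * s \<partial>M)" using drift by simp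
  also have "\<dots> = (\<integral>\<omega>. W \<omega> * saturated p R (X (Suc n) \<omega>) - W \<omega> * s \<partial>M)"
    by (intro Bochner_Integration.integral_diff[symmetric] satM weight_integrable[of n] weight_intros Ww)
  also have "\<dots> \<le> above_level p R B (Suc n)"
    unfolding above_level_def s_def[symmetric]
  proof (rule integral_mono)
    show "integrable M (\<lambda>\<omega>. W \<omega> * saturated p R (X (Suc n) \<omega>) - W \<omega> * s)"
      by (intro Bochner_Integration.integrable_diff satM weight_integrable[of n] weight_intros Ww)
    show "integrable M (\<lambda>\<omega>. indicator (alive (Suc n)) \<omega> * max 0 (saturated p R (X (Suc n) \<omega>) - s))"
      unfolding s_def by (rule excess_integrable[OF R])
    fix \<omega> assume o: "\<omega> \<in> space M"
    have "saturated p R (X (Suc n) \<omega>) \<le> s" if "\<not> A < X (Suc n) \<omega>"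
      unfolding s_def by (rule saturated_mono) (use p R X_nonneg[OF o, of "Suc n"] that B in auto)
    then show "W \<omega> * saturated p R (X (Suc n) \<omega>) - W \<omega> * s \<le> indicator (alive (Suc n)) \<omega> * max 0 (saturated p R (X (Suc n) \<omega>) - s)"
      by (auto simp: W_def indicator_def alive_Suc)
  qed
  finally show ?thesis .
qed

lemma above_level_iterate:
  assumes "0 \<le> \<epsilon>" "\<epsilon> \<le> 1"
    and "\<And>n. (1 - \<epsilon>) * above_level p R B n \<le> above_level p R B (Suc n)"
  shows "(1 - \<epsilon>) ^ m * above_level p R B k \<le> above_level p R B (k + m)"
proof (induction m)
  case (Suc m)
  have "(1 - \<epsilon>) ^ Suc m * above_level p R B k \<le> (1 - \<epsilon>) * above_level p R B (k + m)"
    using Suc assms by (simp add: mult.assoc mult_left_mono)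
  also have "\<dots> \<le> above_level p R B (k + Suc m)" using assms(3) by simp
  finally show ?case .
qed simp

text \<open>
After \<open>k\<close> steps the process has climbed to \<open>2 B\<close> with probability at least \<open>jump_prob q C ^ k\<close>, and there the
cut-off function is of order \<open>1 / R powr p\<close>.
\<close>

lemma above_level_start:
  assumes p: "0 < p" and R: "2 * B \<le> R" and B: "1 \<le> B" and k: "2 * B \<le> x0 + real k * \<eta>"
  shows "jump_prob q C ^ k * (((2 * B) powr p - B powr p) / 4) / R powr p \<le> above_level p R B k"
proof -
  define E where "E = alive k \<inter> {\<omega> \<in> space M. x0 + real k * \<eta> \<le> X k \<omega>}"
  define \<Delta> where "\<Delta> = saturated p R (2 * B) - saturated p R B"
  have R0: "0 < R" using R B by simp
  have EM: "E \<in> sets M" unfolding E_def by measurable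
  have B2: "B powr p \<le> (2 * B) powr p" "(2 * B) powr p \<le> R powr p" using p B R by (auto intro: powr_mono2)
  have \<Delta>0: "0 \<le> \<Delta>" unfolding \<Delta>_def using saturated_mono[of p R B "2 * B"] p R0 B by simp
  have "((2 * B) powr p - B powr p) / 4 / R powr p \<le> \<Delta>"
  proof -
    define z x y where "z = R powr p" and "x = B powr p" and "y = (2 * B) powr p"
    have o: "0 < x" "x \<le> y" "y \<le> z" using B2 B by (auto simp: z_def x_def y_def)
    have "\<Delta> = z * (y - x) / ((z + x) * (z + y))"
      using o by (simp add: \<Delta>_def saturated_def z_def[symmetric] x_def[symmetric] y_def[symmetric] diff_frac_eq)
        (simp add: algebra_simps)
    moreover have "z * (y - x) / ((2 * z) * (2 * z)) \<le> z * (y - x) / ((z + x) * (z + y))"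
      using o by (intro divide_left_mono mult_mono mult_pos_pos) auto
    moreover have "z * (y - x) / ((2 * z) * (2 * z)) = (y - x) / 4 / z" using o by simp
    ultimately show ?thesis by (simp add: z_def x_def y_def)
  qed
  then have "jump_prob q C ^ k * (((2 * B) powr p - B powr p) / 4 / R powr p) \<le> prob E * \<Delta>"
    using climb_prob[of k] \<Delta>0 B2 jump_pos[of q C] by (intro mult_mono) (auto simp: E_def)
  also have "\<dots> = (\<integral>\<omega>. indicator E \<omega> * \<Delta> \<partial>M)"
    by (simp add: Int_absorb2[OF sets.sets_into_space[OF EM]])
  also have "\<dots> \<le> above_level p R B k"
    unfolding above_level_def
  proof (rule integral_mono)
    show "integrable M (\<lambda>\<omega>. indicator E \<omega> * \<Delta>)"
      using EM by (intro integrable_mult_left integrable_real_indicator) (auto simp: emeasure_eq_measure)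
    show "integrable M (\<lambda>\<omega>. indicator (alive k) \<omega> * max 0 (saturated p R (X k \<omega>) - saturated p R B))"
      by (rule excess_integrable[OF R0])
    fix \<omega>
    have "saturated p R (2 * B) \<le> saturated p R (X k \<omega>)" if "\<omega> \<in> E"
      by (rule saturated_mono) (use p R0 B k that in \<open>auto simp: E_def\<close>)
    then show "indicator E \<omega> * \<Delta> \<le> indicator (alive k) \<omega> * max 0 (saturated p R (X k \<omega>) - saturated p R B)"
      by (auto simp: indicator_def \<Delta>_def) (auto simp: E_def)
  qed
  finally show ?thesis by simp
qed

text \<open>
With \<open>R = clock n\<close>, the relative loss per step is at most \<open>c / n\<close>: it vanishes where the saturated power is
below the threshold \<open>u\<close>, and elsewhere \<open>x\<close> is at least a constant times \<open>R\<close>, so that \<open>rate x\<close> is \<open>O(1 / n)\<close>.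
\<close>

lemma survival_lower:
  assumes p: "1 - \<theta> < p" "p < 1"
  shows "\<exists>c>0. \<forall>n. c / clock (real n) powr p \<le> prob (alive n)"
proof -
  have p0: "0 < p" using p theta by simp
  obtain u where u: "0 < u" "u < 1"
    and ev: "eventually (\<lambda>x. \<forall>R>0. saturated p R x \<le> u \<longrightarrow> saturated p R x \<le> saturated_bound p R x) at_top"
    using saturated_bound_eventually[OF p] by blast
  obtain B0 where B0: "\<And>x R. B0 \<le> x \<Longrightarrow> 0 < R \<Longrightarrow> saturated p R x \<le> u \<Longrightarrow> saturated p R x \<le> saturated_bound p R x"
    using ev by (auto simp: eventually_at_top_linorder)
  define B where "B = max A B0"
  have B: "A \<le> B" "B0 \<le> B" "1 \<le> B" using A by (auto simp: B_def)
  obtain cG where cG: "0 < cG" "\<And>x. A < x \<Longrightarrow> G x * rate x \<le> cG" using G_rate_bounded by blast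
  \<comment> \<open>where the saturated power exceeds \<open>u\<close>, the process is above \<open>y R\<close>\<close>
  define y where "y = u powr (1/p)"
  have y: "0 < y" "y \<le> 1" using u p0 by (auto simp: y_def intro: powr_le1)
  \<comment> \<open>the factor 2 compensates for subtracting the value at \<open>B\<close>, which is at most half of the threshold \<open>u\<close>\<close>
  define c where "c = 2 * loss * y powr (- 2 * lam) * cG"
  have c: "0 < c" using loss_pos y cG by (auto simp: c_def)
  obtain k where k: "2 * B \<le> x0 + real k * \<eta>"
  proof -
    obtain k where "2 * B / \<eta> \<le> real k" using real_arch_simple by blast
    then have "2 * B \<le> real k * \<eta>" using eta by (simp add: field_simps)
    then show ?thesis using that[of k] start_above A by simp
  qed
  define a where "a = exp (- 2 * c) * (jump_prob q C ^ k * (((2 * B) powr p - B powr p) / 4))"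
  have a: "0 < a" using jump_pos[of q C] powr_less_mono2[of p B "2 * B"] p0 B by (simp add: a_def)
  have large: "a / clock (real n) powr p \<le> prob (alive n)"
    if n: "0 < n" "k \<le> n" "2 * c \<le> real n" and R: "max (2 * A / y) (max (2 * B) (B / (u / 2) powr (1/p))) \<le> clock (real n)" for n
  proof -
    define R where "R = clock (real n)"
    have R: "2 * A / y \<le> R" "2 * B \<le> R" "B / (u / 2) powr (1/p) \<le> R" "0 < R" "A < R"
      using R B A unfolding R_def by auto
    have yR: "A \<le> y * R"
    proof -
      have "2 * A \<le> y * R" using R(1) y by (simp add: field_simps)
      then show ?thesis using A by linarith
    qed
    have sB: "saturated p R B \<le> u / 2" by (rule saturated_small) (use p0 u B R in auto)
    \<comment> \<open>the loss of the saturated power in one step, relative to its excess over the value at \<open>B\<close>\<close>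
    define \<epsilon> where "\<epsilon> = c / real n"
    have \<epsilon>: "0 \<le> \<epsilon>" "\<epsilon> \<le> 1" using c n by (auto simp: \<epsilon>_def field_simps)
    have rate_R: "rate R \<le> cG / real n"
      using cG(2)[OF R(5)] n G_clock[of "real n"] by (simp add: R_def field_simps)
    have drift: "saturated p R B + (1 - \<epsilon>) * (saturated p R x - saturated p R B) \<le> saturated_bound p R x" if x: "B < x" for x
    proof -
      have le: "saturated p R B \<le> saturated p R x" by (rule saturated_mono) (use p0 R B x in auto)
      show ?thesis
      proof (cases "saturated p R x \<le> u")
        case True
        have "0 \<le> \<epsilon> * (saturated p R x - saturated p R B)" using \<epsilon> le by simp
        then have "saturated p R B + (1 - \<epsilon>) * (saturated p R x - saturated p R B) \<le> saturated p R x"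
          by (simp add: algebra_simps)
        also have "\<dots> \<le> saturated_bound p R x" using True x B R by (intro B0) auto
        finally show ?thesis .
      next
        case False
        have xA: "A < x" using x B by simp
        have "y * R \<le> x" unfolding y_def using False p0 u R x B by (intro saturated_large) auto
        then have "rate x \<le> y powr (- 2 * lam) * rate R" by (rule rate_comparable[OF y yR])
        also have "\<dots> \<le> y powr (- 2 * lam) * (cG / real n)" using rate_R by (intro mult_left_mono) auto
        finally have "loss * rate x \<le> loss * (y powr (- 2 * lam) * (cG / real n))"
          using loss_pos by (intro mult_left_mono) auto
        also have "\<dots> = \<epsilon> / 2" by (simp add: \<epsilon>_def c_def)
        finally have "saturated p R x * (loss * rate x) \<le> saturated p R x * (\<epsilon> / 2)"
          using saturated_bounds[OF R(4), of p x] by (intro mult_left_mono) auto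
        also have "\<dots> \<le> \<epsilon> * (saturated p R x - saturated p R B)"
        proof -
          have "\<epsilon> * (saturated p R x / 2) \<le> \<epsilon> * (saturated p R x - saturated p R B)"
            using \<epsilon> sB False by (intro mult_left_mono) auto
          then show ?thesis by (simp add: mult_ac)
        qed
        finally have "saturated p R B + (1 - \<epsilon>) * (saturated p R x - saturated p R B) \<le> saturated p R x * (1 - loss * rate x)"
          unfolding right_diff_distrib left_diff_distrib by linarith
        also have "\<dots> \<le> saturated_bound p R x" by (rule saturated_bound_ge[OF p0 p(2) R(4) xA])
        finally show ?thesis .
      qed
    qed
    have "exp (- 2 * c) \<le> (1 - \<epsilon>) ^ n" unfolding \<epsilon>_def using c n by (intro one_minus_power_ge) auto
    also have "\<dots> \<le> (1 - \<epsilon>) ^ (n - k)" using \<epsilon> by (intro power_decreasing) auto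
    finally have "exp (- 2 * c) * (jump_prob q C ^ k * (((2 * B) powr p - B powr p) / 4) / R powr p)
      \<le> (1 - \<epsilon>) ^ (n - k) * above_level p R B k"
      using above_level_start[OF p0 R(2) B(3) k] jump_pos[of q C] powr_mono2[of p B "2 * B"] p0 B \<epsilon>
      by (intro mult_mono) auto
    also have "\<dots> \<le> above_level p R B n"
      using above_level_iterate[OF \<epsilon> above_level_step[OF p0 p(2) R(4) B(1) drift], of "n - k" k] n by simp
    also have "\<dots> \<le> prob (alive n)" by (rule above_level_le[OF R(4)])
    finally show ?thesis by (simp add: a_def R_def)
  qed
  have "eventually (\<lambda>n. 0 < n \<and> k \<le> n \<and> 2 * c \<le> real n \<and>
      max (2 * A / y) (max (2 * B) (B / (u / 2) powr (1/p))) \<le> clock (real n)) sequentially"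
    using eventually_gt_at_top[of "0::nat"] eventually_ge_at_top[of k]
      filterlim_at_top[THEN iffD1, OF filterlim_real_sequentially, rule_format, of "2 * c"]
      clock_eventually_ge[of "max (2 * A / y) (max (2 * B) (B / (u / 2) powr (1/p)))"]
    by eventually_elim auto
  then have "eventually (\<lambda>n. a / clock (real n) powr p \<le> prob (alive n)) sequentially"
    by (rule eventually_mono) (use large in blast)
  then obtain N where N: "\<And>n. N \<le> n \<Longrightarrow> a / clock (real n) powr p \<le> prob (alive n)"
    unfolding eventually_sequentially by blast
  define c' where "c' = min a (a / clock (real N) powr p)"
  have cl: "1 \<le> clock (real n) powr p" for n
    using clock_ge_1[of "real n"] p0 by (simp add: ge_one_powr_ge_zero)
  have c'0: "0 < c'" using a less_le_trans[OF zero_less_one cl[of N]] by (simp add: c'_def)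
  have "c' / clock (real n) powr p \<le> prob (alive n)" for n
  proof (cases "N \<le> n")
    case True
    have "c' / clock (real n) powr p \<le> a / clock (real n) powr p" by (intro divide_right_mono) (auto simp: c'_def)
    then show ?thesis using N[OF True] by linarith
  next
    case False
    have "c' / clock (real n) powr p \<le> c' / 1" using cl[of n] c'0 by (intro divide_left_mono) auto
    also have "\<dots> \<le> a / clock (real N) powr p" by (simp add: c'_def)
    also have "\<dots> \<le> prob (alive N)" by (rule N) simp
    also have "\<dots> \<le> prob (alive n)" using False by (intro alive_decreasing) auto
    finally show ?thesis .
  qed
  then show ?thesis using c'0 by blast
qed

section \<open>Upper bound\<close>

text \<open>
A downward jump by \<open>\<eta>\<close> multiplies \<open>exp (- \<kappa> x)\<close> by \<open>exp (\<kappa> \<eta>)\<close>, and it has probability at least \<open>jump_prob q C\<close>.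
For large \<open>\<kappa>\<close> this alone doubles the expectation.
\<close>

lemma exp_drift:
  assumes \<kappa>: "0 < \<kappa>" "2 \<le> jump_prob q C * exp (\<kappa> * \<eta>)"
    and W: "weight n W" "\<And>\<omega>. \<omega> \<in> space M \<Longrightarrow> 0 \<le> W \<omega>" "\<And>\<omega>. \<omega> \<in> space M \<Longrightarrow> W \<omega> \<noteq> 0 \<Longrightarrow> A < X n \<omega>"
  shows "2 * (\<integral>\<omega>. W \<omega> * exp (- \<kappa> * X n \<omega>) \<partial>M) \<le> (\<integral>\<omega>. W \<omega> * exp (- \<kappa> * X (Suc n) \<omega>) \<partial>M)"
proof -
  define V where "V = (\<lambda>\<omega>. exp (\<kappa> * \<eta>) * (W \<omega> * exp (- \<kappa> * max 0 (X n \<omega>))))"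
  have ew: "weight n (\<lambda>\<omega>. exp (- \<kappa> * max 0 (X n \<omega>)))"
    unfolding weight_def using adapted[of n] \<kappa> by (auto intro!: exI[of _ 1])
  have Vw: "weight n V" unfolding V_def by (intro weight_intros W ew)
  have V0: "0 \<le> V \<omega>" if "\<omega> \<in> space M" for \<omega> using W(2)[OF that] by (simp add: V_def)
  have int: "integrable M (\<lambda>\<omega>. W \<omega> * exp (- \<kappa> * X (Suc n) \<omega>))"
  proof (rule weight_times_integrable[OF W(1)])
    show "integrable M (\<lambda>\<omega>. exp (- \<kappa> * X (Suc n) \<omega>))"
      by (rule integrable_const_bound[of _ 1]) (use \<kappa> X_nonneg in \<open>auto intro!: AE_I2\<close>)
  qed
  have "(\<integral>\<omega>. V \<omega> \<partial>M) = exp (\<kappa> * \<eta>) * (\<integral>\<omega>. W \<omega> * exp (- \<kappa> * X n \<omega>) \<partial>M)"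
    unfolding V_def using X_nonneg by (simp add: max_def cong: Bochner_Integration.integral_cong)
  moreover have "2 * (\<integral>\<omega>. W \<omega> * exp (- \<kappa> * X n \<omega>) \<partial>M) \<le> jump_prob q C * exp (\<kappa> * \<eta>) * (\<integral>\<omega>. W \<omega> * exp (- \<kappa> * X n \<omega>) \<partial>M)"
    using \<kappa> W(2) by (intro mult_right_mono integral_nonneg_AE AE_I2) auto
  ultimately have "2 * (\<integral>\<omega>. W \<omega> * exp (- \<kappa> * X n \<omega>) \<partial>M) \<le> jump_prob q C * (\<integral>\<omega>. V \<omega> \<partial>M)" by (simp add: mult.assoc)
  also have "\<dots> \<le> (\<integral>\<omega>. V \<omega> * indicator {\<omega>. 1 * Y n \<omega> \<le> - jump q C} \<omega> \<partial>M)"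
    by (rule jump_chance[OF _ Vw V0]) auto
  also have "\<dots> \<le> (\<integral>\<omega>. W \<omega> * exp (- \<kappa> * X (Suc n) \<omega>) \<partial>M)"
  proof (rule integral_mono_AE[OF _ int])
    show "integrable M (\<lambda>\<omega>. V \<omega> * indicator {\<omega>. 1 * Y n \<omega> \<le> - jump q C} \<omega>)"
      by (rule Bochner_Integration.integrable_bound[OF weight_integrable[OF Vw]])
        (use weight_meas(2)[OF Vw] in \<open>auto simp: indicator_def intro!: AE_I2\<close>)
    show "AE \<omega> in M. V \<omega> * indicator {\<omega>. 1 * Y n \<omega> \<le> - jump q C} \<omega> \<le> W \<omega> * exp (- \<kappa> * X (Suc n) \<omega>)"
      using X_falls[of n] AE_space
    proof eventually_elim
      case (elim \<omega>)
      show ?case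
      proof (cases "W \<omega> \<noteq> 0 \<and> 1 * Y n \<omega> \<le> - jump q C")
        case True
        have A': "A < X n \<omega>" using W(3)[OF elim(2)] True by blast
        have "\<kappa> * X (Suc n) \<omega> \<le> \<kappa> * (X n \<omega> - \<eta>)" using elim(1) A' True \<kappa> by (intro mult_left_mono) auto
        then have "exp (\<kappa> * \<eta>) * exp (- \<kappa> * X n \<omega>) \<le> exp (- \<kappa> * X (Suc n) \<omega>)"
          by (simp add: right_diff_distrib flip: exp_add)
        then have "W \<omega> * (exp (\<kappa> * \<eta>) * exp (- \<kappa> * X n \<omega>)) \<le> W \<omega> * exp (- \<kappa> * X (Suc n) \<omega>)"
          using W(2)[OF elim(2)] by (rule mult_left_mono)
        then show ?thesis using True A' A by (simp add: V_def max_def mult_ac)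
      next
        case False
        then have z: "V \<omega> * indicator {\<omega>. 1 * Y n \<omega> \<le> - jump q C} \<omega> = 0" by (auto simp: V_def indicator_def)
        show ?thesis unfolding z using W(2)[OF elim(2)] by simp
      qed
    qed
  qed
  finally show ?thesis .
qed

text \<open>
Above \<open>B\<close> the power decreases by the factor \<open>1 - k rate x\<close> in mean, and the bounded term does not increase in mean. On \<open>(A, B]\<close>
the power can grow by at most \<open>L B powr p\<close>; the constant \<open>D\<close> is chosen so that the decrease of the bounded term
exceeds this by 1. The upper bound \<open>N\<close> on the support of the weight ensures integrability.
\<close>

lemma lyapunov_drift:
  assumes p: "0 < p" "p < 1 - \<theta>"
  shows "\<exists>D>0. \<exists>\<kappa>>0. \<exists>c>0. \<forall>n N W. weight n W \<longrightarrow> (\<forall>\<omega>\<in>space M. 0 \<le> W \<omega>)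
    \<longrightarrow> (\<forall>\<omega>\<in>space M. W \<omega> \<noteq> 0 \<longrightarrow> A < X n \<omega> \<and> X n \<omega> \<le> N)
    \<longrightarrow> integrable M (\<lambda>\<omega>. W \<omega> * lyapunov p D \<kappa> (X (Suc n) \<omega>))
      \<and> (\<integral>\<omega>. W \<omega> * lyapunov p D \<kappa> (X (Suc n) \<omega>) \<partial>M)
        \<le> (\<integral>\<omega>. W \<omega> * (lyapunov p D \<kappa> (min N (max 0 (X n \<omega>))) * (1 - c * clipped_rate b n \<omega>)) \<partial>M)"
proof -
  have p1: "p < 1" using p theta by simp
  obtain k where k: "0 < k" and ev: "eventually (\<lambda>x. power_bound p x \<le> 1 - k * rate x) at_top"
    using power_bound_eventually[OF p] by blast
  obtain B0 where B0: "\<And>x. B0 \<le> x \<Longrightarrow> power_bound p x \<le> 1 - k * rate x"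
    using ev by (auto simp: eventually_at_top_linorder)
  define B where "B = max A B0"
  have B: "A \<le> B" "B0 \<le> B" by (auto simp: B_def)
  define L where "L = b + 64 * (b ^ 3 + (1 + C) * b ^ 3)"
  have L: "0 < L" using b C by (auto simp: L_def intro!: add_pos_nonneg)
  define \<kappa> where "\<kappa> = max 1 (ln (2 / jump_prob q C) / \<eta>)"
  have \<kappa>: "0 < \<kappa>" by (simp add: \<kappa>_def)
  have \<kappa>2: "2 \<le> jump_prob q C * exp (\<kappa> * \<eta>)"
  proof -
    have "ln (2 / jump_prob q C) / \<eta> * \<eta> \<le> \<kappa> * \<eta>" using eta by (intro mult_right_mono) (auto simp: \<kappa>_def)
    then have "ln (2 / jump_prob q C) \<le> \<kappa> * \<eta>" using eta by simp
    then have "exp (ln (2 / jump_prob q C)) \<le> exp (\<kappa> * \<eta>)" by simp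
    then have "2 / jump_prob q C \<le> exp (\<kappa> * \<eta>)" using jump_pos[of q C] by (subst (asm) exp_ln) auto
    then show ?thesis using jump_pos[of q C] by (simp add: field_simps)
  qed
  \<comment> \<open>the factor \<open>exp (\<kappa> * B)\<close> makes \<open>D * exp (- \<kappa> * x)\<close> at least \<open>L * B powr p + 1\<close> for \<open>x \<le> B\<close>\<close>
  define D where "D = (L * B powr p + 1) * exp (\<kappa> * B)"
  have D: "0 < D" using L by (auto simp: D_def intro!: mult_pos_pos add_nonneg_pos)
  \<comment> \<open>the two entries serve \<open>x > B\<close> and \<open>x \<le> B\<close>\<close>
  define c where "c = min (k / (1 + D)) (1 / (b * (B powr p + D)))"
  have c: "0 < c" using k D b by (auto simp: c_def intro!: divide_pos_pos mult_pos_pos add_nonneg_pos)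
  show ?thesis
  proof (rule exI[of _ D], rule conjI[OF D], rule exI[of _ \<kappa>], rule conjI[OF \<kappa>], rule exI[of _ c], rule conjI[OF c],
      intro allI impI conjI)
    fix n N W
    assume Ww: "weight n W" and W0: "\<forall>\<omega>\<in>space M. 0 \<le> W \<omega>"
      and Ws: "\<forall>\<omega>\<in>space M. W \<omega> \<noteq> 0 \<longrightarrow> A < X n \<omega> \<and> X n \<omega> \<le> N"
    \<comment> \<open>equal to \<open>X n\<close> on the support of \<open>W\<close>, and bounded\<close>
    define x where "x = (\<lambda>\<omega>. min N (max 0 (X n \<omega>)))"
    define Bhi where "Bhi = {\<omega> \<in> space M. B < X n \<omega>}"
    define h where "h = (\<lambda>\<omega>. 1 + L - indicator Bhi \<omega> * (L + k * clipped_rate b n \<omega>))"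
    have BF: "Bhi \<in> sets (F n)" unfolding Bhi_def by (rule X_exceeds_sets)
    have hw: "weight n h" unfolding h_def by (intro weight_intros clipped_rate_weight BF)
    have xM: "x \<in> borel_measurable (F n)" unfolding x_def using adapted[of n] by measurable
    have xpw: "weight n (\<lambda>\<omega>. x \<omega> powr p)"
    proof -
      have "\<bar>x \<omega> powr p\<bar> \<le> N powr p" for \<omega>
      proof (cases "0 \<le> N")
        case True then show ?thesis using p by (auto simp: x_def intro!: powr_mono2)
      next
        case False then show ?thesis by (simp add: x_def min_def max_def)
      qed
      then show ?thesis unfolding weight_def using xM by (auto intro!: exI[of _ "N powr p"])
    qed
    have Vw: "weight n (\<lambda>\<omega>. W \<omega> * x \<omega> powr p)" by (intro weight_intros Ww xpw)
    have xX: "x \<omega> = X n \<omega>" if "\<omega> \<in> space M" "W \<omega> \<noteq> 0" for \<omega>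
      using Ws that X_nonneg[OF that(1), of n] by (auto simp: x_def)
    have h: "power_bound p (X n \<omega>) \<le> h \<omega>" if "\<omega> \<in> space M" "A < X n \<omega>" for \<omega>
    proof -
      have rr: "clipped_rate b n \<omega> = rate (X n \<omega>)" using above(1)[OF that(2)] rate_pos_above[OF that(2)] by (simp add: clipped_rate_def)
      show ?thesis
        using B0[of "X n \<omega>"] B power_bound_le[OF p(1) p1 that(2)] that rr
        by (auto simp: h_def Bhi_def L_def indicator_def)
    qed
    have pd: "integrable M (\<lambda>\<omega>. W \<omega> * x \<omega> powr p * (X (Suc n) \<omega> / X n \<omega>) powr p)"
      "(\<integral>\<omega>. W \<omega> * x \<omega> powr p * (X (Suc n) \<omega> / X n \<omega>) powr p \<partial>M) \<le> (\<integral>\<omega>. W \<omega> * x \<omega> powr p * h \<omega> \<partial>M)"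
      by (rule power_drift[OF p(1) p1 above_range less_imp_le[OF b] Vw _ _ hw]; use W0 Ws h in auto)+
    have eq: "W \<omega> * x \<omega> powr p * (X (Suc n) \<omega> / X n \<omega>) powr p = W \<omega> * X (Suc n) \<omega> powr p" if o: "\<omega> \<in> space M" for \<omega>
    proof (cases "W \<omega> = 0")
      case False
      have "0 < X n \<omega>" using Ws o False A by fastforce
      then show ?thesis using X_nonneg[OF o, of "Suc n"] xX[OF o False] by (simp add: powr_divide)
    qed simp
    have pi: "integrable M (\<lambda>\<omega>. W \<omega> * X (Suc n) \<omega> powr p)"
      using pd(1) eq by (simp cong: Bochner_Integration.integrable_cong)
    have pl: "(\<integral>\<omega>. W \<omega> * X (Suc n) \<omega> powr p \<partial>M) \<le> (\<integral>\<omega>. W \<omega> * x \<omega> powr p * h \<omega> \<partial>M)"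
      using pd(2) eq by (simp cong: Bochner_Integration.integral_cong)
    have ei: "integrable M (\<lambda>\<omega>. W \<omega> * exp (- \<kappa> * X m \<omega>))" for m
    proof (rule weight_times_integrable[OF Ww])
      show "integrable M (\<lambda>\<omega>. exp (- \<kappa> * X m \<omega>))"
        by (rule integrable_const_bound[of _ 1]) (use \<kappa> X_nonneg in \<open>auto intro!: AE_I2\<close>)
    qed
    have el: "2 * (\<integral>\<omega>. W \<omega> * exp (- \<kappa> * X n \<omega>) \<partial>M) \<le> (\<integral>\<omega>. W \<omega> * exp (- \<kappa> * X (Suc n) \<omega>) \<partial>M)"
      by (rule exp_drift[OF \<kappa> \<kappa>2 Ww]) (use W0 Ws in auto)
    note Wi = weight_integrable[OF Ww]
    have split: "W \<omega> * lyapunov p D \<kappa> y = W \<omega> * y powr p + D * W \<omega> - D * (W \<omega> * exp (- \<kappa> * y))" for \<omega> y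
      by (simp add: lyapunov_def algebra_simps)
    show "integrable M (\<lambda>\<omega>. W \<omega> * lyapunov p D \<kappa> (X (Suc n) \<omega>))"
      unfolding split by (intro Bochner_Integration.integrable_diff Bochner_Integration.integrable_add integrable_mult_right pi Wi ei)
    have "(\<integral>\<omega>. W \<omega> * lyapunov p D \<kappa> (X (Suc n) \<omega>) \<partial>M)
        = (\<integral>\<omega>. W \<omega> * X (Suc n) \<omega> powr p \<partial>M) + D * (\<integral>\<omega>. W \<omega> \<partial>M) - D * (\<integral>\<omega>. W \<omega> * exp (- \<kappa> * X (Suc n) \<omega>) \<partial>M)"
      unfolding split using pi Wi ei by simp
    also have "\<dots> \<le> (\<integral>\<omega>. W \<omega> * x \<omega> powr p * h \<omega> \<partial>M) + D * (\<integral>\<omega>. W \<omega> \<partial>M) - D * (2 * (\<integral>\<omega>. W \<omega> * exp (- \<kappa> * X n \<omega>) \<partial>M))"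
      using pl el D by (intro add_mono diff_mono mult_left_mono) auto
    also have "\<dots> = (\<integral>\<omega>. W \<omega> * x \<omega> powr p * h \<omega> + D * W \<omega> - 2 * D * (W \<omega> * exp (- \<kappa> * X n \<omega>)) \<partial>M)"
      using weight_integrable[OF weight_mult[OF Vw hw]] Wi ei[of n] by simp
    also have "\<dots> \<le> (\<integral>\<omega>. W \<omega> * (lyapunov p D \<kappa> (x \<omega>) * (1 - c * clipped_rate b n \<omega>)) \<partial>M)"
    proof (rule integral_mono)
      show "integrable M (\<lambda>\<omega>. W \<omega> * x \<omega> powr p * h \<omega> + D * W \<omega> - 2 * D * (W \<omega> * exp (- \<kappa> * X n \<omega>)))"
        using weight_integrable[OF weight_mult[OF Vw hw]] Wi ei[of n] by simp
      have "weight n (\<lambda>\<omega>. exp (- \<kappa> * x \<omega>))"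
      proof -
        have "\<bar>exp (- \<kappa> * x \<omega>)\<bar> \<le> exp (\<kappa> * \<bar>N\<bar>)" for \<omega>
        proof -
          have "\<kappa> * (- x \<omega>) \<le> \<kappa> * \<bar>N\<bar>" using \<kappa> by (intro mult_left_mono) (auto simp: x_def)
          then show ?thesis by simp
        qed
        then show ?thesis unfolding weight_def using xM by (auto intro!: exI[of _ "exp (\<kappa> * \<bar>N\<bar>)"])
      qed
      then show "integrable M (\<lambda>\<omega>. W \<omega> * (lyapunov p D \<kappa> (x \<omega>) * (1 - c * clipped_rate b n \<omega>)))"
        unfolding lyapunov_def by (intro weight_integrable[of n] weight_intros Ww xpw clipped_rate_weight)
      fix \<omega> assume o: "\<omega> \<in> space M"
      show "W \<omega> * x \<omega> powr p * h \<omega> + D * W \<omega> - 2 * D * (W \<omega> * exp (- \<kappa> * X n \<omega>)) \<le> W \<omega> * (lyapunov p D \<kappa> (x \<omega>) * (1 - c * clipped_rate b n \<omega>))"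
      proof (cases "W \<omega> = 0")
        case False
        define z where "z = X n \<omega>"
        have z: "A < z" "x \<omega> = z" using Ws o False xX[OF o False] by (auto simp: z_def)
        have zp: "1 \<le> z powr p" using z A p by (intro ge_one_powr_ge_zero) auto
        define s where "s = clipped_rate b n \<omega>"
        have s: "s = rate z" "0 < s" "s \<le> b"
          using above(1)[OF z(1)] rate_pos_above[OF z(1)] by (simp_all add: s_def clipped_rate_def z_def)
        define e where "e = exp (- \<kappa> * z)"
        have e: "0 < e" "e \<le> 1" using \<kappa> z A by (auto simp: e_def)
        have f: "lyapunov p D \<kappa> z = z powr p + D * (1 - e)" by (simp add: lyapunov_def e_def)
        have fle: "lyapunov p D \<kappa> z \<le> z powr p + D"
          using mult_left_mono[of "1 - e" 1 D] D e by (simp add: f)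
        have f0: "0 \<le> lyapunov p D \<kappa> z" using D e zp by (simp add: f)
        have "z powr p * h \<omega> + D - 2 * D * e \<le> lyapunov p D \<kappa> z * (1 - c * s)"
        proof (cases "B < z")
          case True
          then have hh: "h \<omega> = 1 - k * s" using o by (simp add: h_def Bhi_def z_def s_def)
          have "D * 1 \<le> D * z powr p" using zp D by (intro mult_left_mono) auto
          then have "lyapunov p D \<kappa> z \<le> (1 + D) * z powr p" using fle by (simp add: distrib_right)
          moreover have cs: "0 \<le> c * s" using mult_pos_pos[OF c s(2)] by (rule less_imp_le)
          ultimately have "c * s * lyapunov p D \<kappa> z \<le> c * s * ((1 + D) * z powr p)" by (rule mult_left_mono)
          also have "\<dots> = (c * (1 + D)) * (s * z powr p)" by simp
          also have "\<dots> \<le> k * (s * z powr p)"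
          proof (intro mult_right_mono)
            have "c \<le> k / (1 + D)" by (simp add: c_def)
            then show "c * (1 + D) \<le> k" using D by (simp add: pos_le_divide_eq)
          qed (rule mult_nonneg_nonneg[OF less_imp_le[OF s(2)] powr_ge_zero])
          finally have gain: "c * s * lyapunov p D \<kappa> z \<le> k * (s * z powr p)" .
          have "z powr p * h \<omega> + D - 2 * D * e = lyapunov p D \<kappa> z - k * (s * z powr p) - D * e"
            unfolding hh f by (simp add: algebra_simps)
          also have "\<dots> \<le> lyapunov p D \<kappa> z - c * s * lyapunov p D \<kappa> z"
            using gain mult_pos_pos[OF D e(1)] by linarith
          also have "\<dots> = lyapunov p D \<kappa> z * (1 - c * s)" by (simp add: algebra_simps)
          finally show ?thesis .
        next
          case False
          then have hh: "h \<omega> = 1 + L" by (simp add: h_def Bhi_def z_def)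
          have "z powr p \<le> B powr p" using False z A p by (intro powr_mono2) auto
          have a1: "L * z powr p \<le> L * B powr p" using \<open>z powr p \<le> B powr p\<close> L by (intro mult_left_mono) auto
          have a2: "L * B powr p + 1 \<le> D * e"
          proof -
            have "exp (- \<kappa> * B) \<le> e" unfolding e_def using False \<kappa> by simp
            then have "D * exp (- \<kappa> * B) \<le> D * e" using D by (intro mult_left_mono) auto
            moreover have "D * exp (- \<kappa> * B) = L * B powr p + 1" unfolding D_def by (simp add: mult.assoc flip: exp_add)
            ultimately show ?thesis by simp
          qed
          have a3: "c * s * lyapunov p D \<kappa> z \<le> 1"
          proof -
            have BD: "0 < b * (B powr p + D)" using b D by (intro mult_pos_pos add_nonneg_pos) auto
            have "c * s * lyapunov p D \<kappa> z \<le> c * b * (B powr p + D)"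
              using c s b fle f0 \<open>z powr p \<le> B powr p\<close> by (intro mult_mono) auto
            also have "\<dots> \<le> 1"
            proof -
              have "c \<le> 1 / (b * (B powr p + D))" by (simp add: c_def)
              then show ?thesis using BD by (simp add: pos_le_divide_eq mult_ac)
            qed
            finally show ?thesis .
          qed
          have "z powr p * h \<omega> + D - 2 * D * e = lyapunov p D \<kappa> z + (L * z powr p - D * e)"
            unfolding hh f by (simp add: algebra_simps)
          also have "\<dots> \<le> lyapunov p D \<kappa> z - c * s * lyapunov p D \<kappa> z" using a1 a2 a3 by linarith
          also have "\<dots> = lyapunov p D \<kappa> z * (1 - c * s)" by (simp add: algebra_simps)
          finally show ?thesis .
        qed
        then have "W \<omega> * (z powr p * h \<omega> + D - 2 * D * e) \<le> W \<omega> * (lyapunov p D \<kappa> z * (1 - c * s))"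
          using W0 o by (intro mult_left_mono) auto
        then show ?thesis using z by (simp add: s_def e_def z_def algebra_simps)
      qed simp
    qed
    finally show "(\<integral>\<omega>. W \<omega> * lyapunov p D \<kappa> (X (Suc n) \<omega>) \<partial>M)
        \<le> (\<integral>\<omega>. W \<omega> * (lyapunov p D \<kappa> (min N (max 0 (X n \<omega>))) * (1 - c * clipped_rate b n \<omega>)) \<partial>M)"
      by (simp add: x_def)
  qed
qed

text \<open>
Passing from \<open>s\<close> to \<open>s - 1\<close> lowers \<open>clock s powr p\<close> by a factor of about \<open>1 - p rate (clock s)\<close>. If \<open>x\<close> is smaller than
\<open>clock s\<close> by a large factor, then \<open>rate x\<close> exceeds \<open>rate (clock s)\<close> by a large factor.
\<close>

lemma clock_decay:
  assumes c: "0 < c" and p: "0 < p"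
  shows "\<exists>K\<ge>1. \<forall>s\<ge>1. \<forall>x>A. K * x powr p < clock s powr p
    \<longrightarrow> (1 - c * rate x) * clock s powr p \<le> clock (s - 1) powr p"
proof -
  obtain m where m: "0 < m" "\<And>y. 1 \<le> y \<Longrightarrow> rate y \<le> m" using rate_bounded by blast
  \<comment> \<open>\<open>rate y \<le> c / p * rate x\<close> as soon as \<open>y \<ge> k * x\<close>\<close>
  define k where "k = max 1 ((p / c) powr (2 / lam))"
  have k: "1 \<le> k" by (simp add: k_def)
  have kc: "k powr (- (lam/2)) \<le> c / p"
  proof -
    have "k powr (- (lam/2)) \<le> ((p / c) powr (2 / lam)) powr (- (lam/2))"
      using lam_pos p c by (intro powr_mono2') (auto simp: k_def)
    also have "\<dots> = c / p" using lam_pos p c by (simp add: powr_powr powr_minus_divide)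
    finally show ?thesis .
  qed
  \<comment> \<open>the clock grows by a factor of at most \<open>exp m\<close> in one unit of time\<close>
  define K where "K = (exp m * k) powr p"
  have emk: "1 \<le> exp m * k" using k m mult_mono[of 1 "exp m" 1 k] by simp
  have "1 \<le> K" unfolding K_def using p emk by (intro ge_one_powr_ge_zero) auto
  moreover have "(1 - c * rate x) * clock s powr p \<le> clock (s - 1) powr p"
    if s: "1 \<le> s" and x: "A < x" and lt: "K * x powr p < clock s powr p" for s x
  proof -
    have cs: "1 \<le> clock s" "1 \<le> clock (s - 1)" using clock_ge_1 s by auto
    have "(exp m * k * x) powr p < clock s powr p"
      using lt x A emk by (simp add: K_def powr_mult)
    then have lt': "exp m * (k * x) < clock s"
      using powr_mono2[of p "clock s" "exp m * k * x"] p cs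
      by (cases "clock s \<le> exp m * k * x") (auto simp: mult.assoc)
    have "ln (clock s) - ln (clock (s - 1)) \<le> m * (s - (s - 1))"
      by (rule ln_clock_diff_le) (use s cs in \<open>auto intro!: m(2)\<close>)
    then have "ln (clock s) \<le> ln (exp m * clock (s - 1))" using cs by (simp add: ln_mult)
    then have "clock s \<le> exp m * clock (s - 1)" using cs by (subst (asm) ln_le_cancel_iff) auto
    then have "exp m * (k * x) < exp m * clock (s - 1)" using lt' by linarith
    then have kx: "k * x < clock (s - 1)" by simp
    have ratey: "rate y \<le> c / p * rate x" if y: "clock (s - 1) \<le> y" for y
    proof -
      have xy: "k * x \<le> y" "0 < x" "x \<le> k * x" using kx y x A k by auto
      then have y0: "0 < y" "x \<le> y" by linarith+
      have "rate y * y powr (lam/2) \<le> rate x * x powr (lam/2)" using x y0 by (intro regular(1)) auto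
      then have "rate y * y powr (lam/2) * y powr (- (lam/2)) \<le> rate x * x powr (lam/2) * y powr (- (lam/2))"
        by (intro mult_right_mono) auto
      moreover have "y powr (lam/2) * y powr (- (lam/2)) = 1" using y0 by (simp flip: powr_add)
      ultimately have "rate y \<le> rate x * (x powr (lam/2) * y powr (- (lam/2)))" by (simp add: mult.assoc)
      also have "\<dots> \<le> rate x * (c / p)"
      proof (rule mult_left_mono)
        have "x powr (lam/2) * y powr (- (lam/2)) \<le> x powr (lam/2) * (k * x) powr (- (lam/2))"
          using xy k lam_pos by (intro mult_left_mono powr_mono2') auto
        also have "\<dots> = k powr (- (lam/2))" using xy k by (simp add: powr_mult powr_minus field_simps)
        finally show "x powr (lam/2) * y powr (- (lam/2)) \<le> c / p" using kc by linarith
        show "0 \<le> rate x" using rate_pos_above[OF x] by simp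
      qed
      finally show ?thesis by (simp add: mult.commute)
    qed
    have "ln (clock s) - ln (clock (s - 1)) \<le> c / p * rate x * (s - (s - 1))"
      by (rule ln_clock_diff_le) (use s ratey in auto)
    then have d: "p * ln (clock s) \<le> p * ln (clock (s - 1)) + c * rate x"
      using mult_left_mono[of "ln (clock s) - ln (clock (s - 1))" "c / p * rate x" p] p
      by (simp add: right_diff_distrib)
    have "(1 - c * rate x) * clock s powr p \<le> exp (- (c * rate x)) * clock s powr p"
      using exp_ge_add_one_self[of "- (c * rate x)"] by (intro mult_right_mono) auto
    also have "\<dots> = exp (p * ln (clock s) - c * rate x)" using cs by (simp add: powr_def flip: exp_add)
    also have "\<dots> \<le> exp (p * ln (clock (s - 1)))" using d by simp
    also have "\<dots> = clock (s - 1) powr p" using cs by (simp add: powr_def)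
    finally show ?thesis .
  qed
  ultimately show ?thesis by blast
qed

text \<open>
The expectation of \<open>min 1 (K f (X k) / clock (n - k) powr p)\<close> over the surviving paths does not increase with \<open>k\<close>.
At \<open>k = n\<close> the minimum is 1, because \<open>clock 0 = 1\<close>; at \<open>k = 0\<close> it is at most the claimed bound.
\<close>

lemma survival_upper:
  assumes p: "0 < p" "p < 1 - \<theta>"
  shows "\<exists>c>0. \<forall>n. prob (alive n) \<le> c / clock (real n) powr p"
proof -
  obtain D \<kappa> c where D: "0 < D" and \<kappa>: "0 < \<kappa>" and c: "0 < c" and drift0:
    "\<forall>n N W. weight n W \<longrightarrow> (\<forall>\<omega>\<in>space M. 0 \<le> W \<omega>)
    \<longrightarrow> (\<forall>\<omega>\<in>space M. W \<omega> \<noteq> 0 \<longrightarrow> A < X n \<omega> \<and> X n \<omega> \<le> N)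
    \<longrightarrow> integrable M (\<lambda>\<omega>. W \<omega> * lyapunov p D \<kappa> (X (Suc n) \<omega>))
      \<and> (\<integral>\<omega>. W \<omega> * lyapunov p D \<kappa> (X (Suc n) \<omega>) \<partial>M)
        \<le> (\<integral>\<omega>. W \<omega> * (lyapunov p D \<kappa> (min N (max 0 (X n \<omega>))) * (1 - c * clipped_rate b n \<omega>)) \<partial>M)"
    using lyapunov_drift[OF p] by (elim exE conjE) (rule that)
  obtain K where K: "1 \<le> K" and decay: "\<And>s x. 1 \<le> s \<Longrightarrow> A < x \<Longrightarrow> K * x powr p < clock s powr p
    \<Longrightarrow> (1 - c * rate x) * clock s powr p \<le> clock (s - 1) powr p"
    using clock_decay[OF c p(1)] by blast
  define f where "f = lyapunov p D \<kappa>"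
  have f_ge: "x powr p \<le> f x" if "0 \<le> x" for x unfolding f_def using that D \<kappa> by (intro lyapunov_ge) auto
  have fM [measurable]: "f \<in> borel_measurable borel" by (simp add: f_def)
  have cl: "1 \<le> clock (real n) powr p" for n
    using clock_ge_1[of "real n"] p by (simp add: ge_one_powr_ge_zero)
  have "prob (alive n) \<le> K * f x0 / clock (real n) powr p" for n
  proof -
    define v where "v = (\<lambda>k \<omega>. K * f (X k \<omega>) / clock (real (n - k)) powr p)"
    define u where "u = (\<lambda>k. \<integral>\<omega>. indicator (alive k) \<omega> * min 1 (v k \<omega>) \<partial>M)"
    have f0: "0 \<le> f (X k \<omega>)" if "\<omega> \<in> space M" for k \<omega>
      using f_ge[OF X_nonneg[OF that, of k]] powr_ge_zero[of "X k \<omega>" p] by linarith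
    have v0: "0 \<le> v k \<omega>" if "\<omega> \<in> space M" for k \<omega>
      using f0[OF that, of k] K by (simp add: v_def)
    have vM: "v k \<in> borel_measurable (F k)" for k unfolding v_def using adapted[of k] by measurable
    have ui: "integrable M (\<lambda>\<omega>. indicator (alive k) \<omega> * min 1 (v k \<omega>))" for k
      by (rule integrable_const_bound[of _ 1]) (use measurable_F_M[OF vM[of k]] v0[of _ k] in \<open>auto intro!: AE_I2 simp: indicator_def\<close>)
    have step: "u (Suc k) \<le> u k" if k: "k < n" for k
    proof -
      define s where "s = real (n - k)"
      have s: "1 \<le> s" "real (n - Suc k) = s - 1" using k by (auto simp: s_def of_nat_diff)
      \<comment> \<open>outside \<open>lo\<close> the minimum is already 1 and cannot grow\<close>
      define lo where "lo = {\<omega> \<in> space M. v k \<omega> < 1}"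
      have loF: "lo \<in> sets (F k)" unfolding lo_def space_Fn[of k, symmetric] using vM[of k] by measurable
      define W where "W = (indicator (alive k \<inter> lo) :: 'a \<Rightarrow> real)"
      have Ww: "weight k W" unfolding W_def by (intro weight_indicator sets.Int alive_sets loF)
      have Hw: "weight k (indicator (alive k - lo))" by (intro weight_indicator sets.Diff alive_sets loF)
      have Wlow: "K * X k \<omega> powr p < clock s powr p" if "\<omega> \<in> space M" "W \<omega> \<noteq> 0" for \<omega>
      proof -
        have "v k \<omega> < 1" using that by (auto simp: W_def lo_def indicator_def split: if_splits)
        then have "K * f (X k \<omega>) < clock s powr p"
          using clock_ge_1[of s] s by (simp add: v_def s_def[symmetric] divide_less_eq)
        moreover have "K * X k \<omega> powr p \<le> K * f (X k \<omega>)"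
          using K f_ge[OF X_nonneg[OF that(1), of k]] by (intro mult_left_mono) auto
        ultimately show ?thesis by linarith
      qed
      have Wsup: "\<forall>\<omega>\<in>space M. W \<omega> \<noteq> 0 \<longrightarrow> A < X k \<omega> \<and> X k \<omega> \<le> clock s"
      proof (intro ballI impI conjI)
        fix \<omega> assume o: "\<omega> \<in> space M" "W \<omega> \<noteq> 0"
        then show A': "A < X k \<omega>" by (auto simp: W_def indicator_def alive_def split: if_splits)
        have "X k \<omega> powr p \<le> K * X k \<omega> powr p" using K by (simp add: mult_le_cancel_right1)
        then have "X k \<omega> powr p < clock s powr p" using Wlow[OF o] by linarith
        then show "X k \<omega> \<le> clock s" using powr_mono2[of p "clock s" "X k \<omega>"] p clock_ge_1[of s] s by force
      qed
      have W0: "\<forall>\<omega>\<in>space M. 0 \<le> W \<omega>" by (simp add: W_def)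
      note dr = drift0[THEN spec, THEN spec, THEN spec, THEN mp, THEN mp, THEN mp, OF Ww W0 Wsup, folded f_def]
      have v'M [measurable]: "v (Suc k) \<in> borel_measurable M" by (rule measurable_F_M[OF vM])
      have Wv: "W \<omega> * v (Suc k) \<omega> = K / clock (s - 1) powr p * (W \<omega> * f (X (Suc k) \<omega>))" for \<omega>
        by (simp add: v_def s)
      have Wvi: "integrable M (\<lambda>\<omega>. W \<omega> * v (Suc k) \<omega>)" unfolding Wv using dr by simp
      have Hi: "integrable M (indicator (alive k - lo) :: 'a \<Rightarrow> real)" by (rule weight_integrable[OF Hw])
      have Wmi: "integrable M (\<lambda>\<omega>. W \<omega> * min 1 (v k \<omega>))"
        using weight_times_integrable[OF Ww ui[of k]]
        by (rule Bochner_Integration.integrable_cong[OF refl, THEN iffD1, rotated]) (auto simp: W_def indicator_def)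
      have "u (Suc k) \<le> (\<integral>\<omega>. indicator (alive k - lo) \<omega> + W \<omega> * v (Suc k) \<omega> \<partial>M)"
        unfolding u_def
      proof (rule integral_mono[OF ui])
        fix \<omega> assume o: "\<omega> \<in> space M"
        show "indicator (alive (Suc k)) \<omega> * min 1 (v (Suc k) \<omega>) \<le> indicator (alive k - lo) \<omega> + W \<omega> * v (Suc k) \<omega>"
          using v0[OF o, of "Suc k"] by (auto simp: indicator_def W_def alive_Suc)
      qed (intro Bochner_Integration.integrable_add Hi Wvi)
      also have "\<dots> = (\<integral>\<omega>. indicator (alive k - lo) \<omega> \<partial>M) + (\<integral>\<omega>. W \<omega> * v (Suc k) \<omega> \<partial>M)"
        by (rule Bochner_Integration.integral_add[OF Hi Wvi])
      also have "(\<integral>\<omega>. W \<omega> * v (Suc k) \<omega> \<partial>M) \<le> (\<integral>\<omega>. W \<omega> * min 1 (v k \<omega>) \<partial>M)"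
      proof -
        have wi: "integrable M (\<lambda>\<omega>. W \<omega> * (f (min (clock s) (max 0 (X k \<omega>))) * (1 - c * clipped_rate b k \<omega>)))"
        proof -
          have "weight k (\<lambda>\<omega>. f (min (clock s) (max 0 (X k \<omega>))))"
          proof -
            have "\<bar>f (min (clock s) (max 0 (X k \<omega>)))\<bar> \<le> clock s powr p + D" for \<omega>
            proof -
              define z where "z = min (clock s) (max 0 (X k \<omega>))"
              have z: "0 \<le> z" "z \<le> clock s" using clock_ge_1[of s] s by (auto simp: z_def)
              have "z powr p \<le> clock s powr p" using z p by (intro powr_mono2) auto
              moreover have "D * (1 - exp (- \<kappa> * z)) \<le> D * 1" using D by (intro mult_left_mono) auto
              moreover have "0 \<le> f z" using f_ge[OF z(1)] powr_ge_zero[of z p] by linarith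
              ultimately show ?thesis by (simp add: f_def lyapunov_def z_def)
            qed
            then show ?thesis unfolding weight_def using adapted[of k] by (auto intro!: exI[of _ "clock s powr p + D"])
          qed
          then show ?thesis by (intro weight_integrable[of k] weight_intros Ww clipped_rate_weight)
        qed
        have cpos: "0 < clock (s - 1) powr p" "0 < clock s powr p"
          using clock_ge_1[of "s - 1"] clock_ge_1[of s] s by auto
        have "(\<integral>\<omega>. W \<omega> * v (Suc k) \<omega> \<partial>M) = K / clock (s - 1) powr p * (\<integral>\<omega>. W \<omega> * f (X (Suc k) \<omega>) \<partial>M)"
          unfolding Wv by simp
        also have "\<dots> \<le> K / clock (s - 1) powr p * (\<integral>\<omega>. W \<omega> * (f (min (clock s) (max 0 (X k \<omega>))) * (1 - c * clipped_rate b k \<omega>)) \<partial>M)"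
          using dr K by (intro mult_left_mono) auto
        also have "\<dots> = (\<integral>\<omega>. K / clock (s - 1) powr p * (W \<omega> * (f (min (clock s) (max 0 (X k \<omega>))) * (1 - c * clipped_rate b k \<omega>))) \<partial>M)"
          by simp
        also have "\<dots> \<le> (\<integral>\<omega>. W \<omega> * min 1 (v k \<omega>) \<partial>M)"
        proof (rule integral_mono[OF integrable_mult_right[OF wi] Wmi])
          fix \<omega> assume o: "\<omega> \<in> space M"
          show "K / clock (s - 1) powr p * (W \<omega> * (f (min (clock s) (max 0 (X k \<omega>))) * (1 - c * clipped_rate b k \<omega>))) \<le> W \<omega> * min 1 (v k \<omega>)"
          proof (cases "W \<omega> = 0")
            case False
            have W1: "W \<omega> = 1" using False by (auto simp: W_def indicator_def split: if_splits)
            have x: "A < X k \<omega>" "X k \<omega> \<le> clock s" using Wsup o False by auto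
            have mx: "min (clock s) (max 0 (X k \<omega>)) = X k \<omega>" using x A by simp
            have rr: "clipped_rate b k \<omega> = rate (X k \<omega>)" using above(1)[OF x(1)] rate_pos_above[OF x(1)] by (simp add: clipped_rate_def)
            have vlt: "v k \<omega> < 1" using False by (auto simp: W_def lo_def indicator_def split: if_splits)
            have "(1 - c * rate (X k \<omega>)) * clock s powr p \<le> clock (s - 1) powr p"
              by (rule decay[OF s(1) x(1) Wlow[OF o False]])
            then have "(1 - c * rate (X k \<omega>)) / clock (s - 1) powr p \<le> 1 / clock s powr p"
              using cpos by (simp add: pos_divide_le_eq pos_le_divide_eq)
            then have "K * f (X k \<omega>) * ((1 - c * rate (X k \<omega>)) / clock (s - 1) powr p) \<le> K * f (X k \<omega>) * (1 / clock s powr p)"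
              using K f0[OF o, of k] by (intro mult_left_mono) auto
            then have "K / clock (s - 1) powr p * (f (X k \<omega>) * (1 - c * rate (X k \<omega>))) \<le> v k \<omega>"
              by (simp add: v_def s_def[symmetric] mult_ac)
            then show ?thesis unfolding mx rr W1 using vlt by simp
          qed simp
        qed
        finally show ?thesis .
      qed
      also have "(\<integral>\<omega>. indicator (alive k - lo) \<omega> \<partial>M) + (\<integral>\<omega>. W \<omega> * min 1 (v k \<omega>) \<partial>M)
          = (\<integral>\<omega>. indicator (alive k - lo) \<omega> + W \<omega> * min 1 (v k \<omega>) \<partial>M)"
        by (rule Bochner_Integration.integral_add[OF Hi Wmi, symmetric])
      also have "\<dots> = u k"
        unfolding u_def
      proof (rule Bochner_Integration.integral_cong[OF refl])
        fix \<omega> assume o: "\<omega> \<in> space M"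
        show "indicator (alive k - lo) \<omega> + W \<omega> * min 1 (v k \<omega>) = indicator (alive k) \<omega> * min 1 (v k \<omega>)"
          using o by (auto simp: indicator_def W_def lo_def)
      qed
      finally show ?thesis by simp
    qed
    have "u k \<le> u 0" if "k \<le> n" for k
      using that by (induction k) (auto intro: order.trans[OF step])
    then have "u n \<le> u 0" by simp
    moreover have "u n = prob (alive n)"
    proof -
      have "u n = (\<integral>\<omega>. indicator (alive n) \<omega> \<partial>M)"
        unfolding u_def
      proof (rule Bochner_Integration.integral_cong[OF refl])
        fix \<omega> assume o: "\<omega> \<in> space M"
        have "1 \<le> v n \<omega>" if "\<omega> \<in> alive n"
        proof -
          have "1 \<le> X n \<omega> powr p" using alive_D(1)[OF that] A p by (intro ge_one_powr_ge_zero) auto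
          then have "1 \<le> f (X n \<omega>)" using f_ge[OF X_nonneg[OF o, of n]] by linarith
          then have "1 * 1 \<le> K * f (X n \<omega>)" using K by (intro mult_mono) auto
          then show ?thesis by (simp add: v_def clock_0)
        qed
        then show "indicator (alive n) \<omega> * min 1 (v n \<omega>) = indicator (alive n) \<omega>"
          by (auto simp: indicator_def)
      qed
      then show ?thesis by simp
    qed
    moreover have "u 0 \<le> K * f x0 / clock (real n) powr p"
    proof -
      have "u 0 \<le> (\<integral>\<omega>. K * f x0 / clock (real n) powr p \<partial>M)"
        unfolding u_def
      proof (rule integral_mono_AE[OF ui])
        show "AE \<omega> in M. indicator (alive 0) \<omega> * min 1 (v 0 \<omega>) \<le> K * f x0 / clock (real n) powr p"
          using start AE_space
        proof eventually_elim
          case (elim \<omega>)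
          have "v 0 \<omega> = K * f x0 / clock (real n) powr p" using elim by (simp add: v_def)
          then show ?case using v0[OF elim(2), of 0] by (auto simp: indicator_def)
        qed
      qed simp
      then show ?thesis by (simp add: prob_space)
    qed
    ultimately show ?thesis by linarith
  qed
  moreover have "0 < K * f x0"
    using K f_ge[of x0] start_above A by (intro mult_pos_pos) (auto intro: less_le_trans[of 0 "x0 powr p"])
  ultimately show ?thesis by blast
qed

end

section \<open>Tail of the hitting time\<close>

lemma growth_tau_gt_iff: "enat n < growth_tau X A \<omega> \<longleftrightarrow> (\<forall>k\<le>n. A < X k \<omega>)"
proof
  assume a: "enat n < growth_tau X A \<omega>"
  show "\<forall>k\<le>n. A < X k \<omega>"
  proof (intro allI impI, rule ccontr)
    fix k assume k: "k \<le> n" "\<not> A < X k \<omega>"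
    have "growth_tau X A \<omega> \<le> enat k" unfolding growth_tau_def using k by (intro Inf_lower) auto
    then show False using a k by (meson enat_ord_simps(1) leD order.trans)
  qed
next
  assume a: "\<forall>k\<le>n. A < X k \<omega>"
  have "enat (Suc n) \<le> growth_tau X A \<omega>"
    unfolding growth_tau_def
  proof (rule Inf_greatest)
    fix x assume "x \<in> {enat k |k. X k \<omega> \<le> A}"
    then obtain k where k: "x = enat k" "X k \<omega> \<le> A" by auto
    then have "n < k" using a by (meson leD leI)
    then show "enat (Suc n) \<le> x" using k by simp
  qed
  then show "enat n < growth_tau X A \<omega>" by (metis enat_ord_simps(2) lessI less_le_trans)
qed

text \<open>
The level \<open>A\<close> is chosen so that all requirements of \<open>near_critical\<close> hold. The hypothesis comparing \<open>x g x\<close> with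
\<open>y g y\<close> yields a positive lower bound for \<open>y g y\<close>, hence for the variance; it excludes jumps that become
arbitrarily small.
\<close>

theorem theorem1p1:
  fixes S :: "real set" and g sigma2 :: "real \<Rightarrow> real"
    and M :: "real \<Rightarrow> 'a measure" and F :: "real \<Rightarrow> nat \<Rightarrow> 'a measure"
    and X \<xi> :: "real \<Rightarrow> nat \<Rightarrow> 'a \<Rightarrow> real"
    and lam \<theta> :: real
  assumes S_nonneg: "S \<subseteq> {0..}"
    and S_unbounded: "\<not> bdd_above S"
    and sigma2_pos: "\<And>x. 0 \<le> x \<Longrightarrow> 0 < sigma2 x"
    and process: "\<And>x0. x0 \<in> S \<Longrightarrow>
      stochastic_growth_process (M x0) (F x0) S g sigma2 x0 (X x0) (\<xi> x0)"
    and A1_pos: "\<And>x. 0 \<le> x \<Longrightarrow> 0 < g x"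
    and A1_diff: "g differentiable_on {0..}"
    and A1_small: "g \<in> o[at_top](\<lambda>x. x)"
    and A2: "\<exists>K>0. \<exists>c1>0. \<exists>\<epsilon>>0. \<forall>x>K. \<forall>y>(1 - \<epsilon>) * x. x * g x \<le> c1 * (y * g y)"
    and A3: "\<exists>\<delta>>0. \<exists>C>0. \<forall>x0\<in>S. \<forall>n. AE \<omega> in M x0.
      nn_cond_exp (M x0) (F x0 n) (\<lambda>\<omega>. ennreal (\<bar>\<xi> x0 n \<omega>\<bar> powr (4 + \<delta>))) \<omega>
        \<le> ennreal (C * sigma2 (X x0 n \<omega>) powr ((4 + \<delta>) / 2))"
    and lambda_pos: "0 < lam"
    and theta: "0 < \<theta>" "\<theta> < 1"
    and lim_g: "((\<lambda>x. deriv g x * x / g x) \<longlongrightarrow> 1 - lam) at_top"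
    and lim_sigma2: "((\<lambda>x. 2 * x * g x / sigma2 x) \<longlongrightarrow> \<theta>) at_top"
  shows "\<exists>A>0. \<forall>x0 \<in> S \<inter> {A<..}. \<forall>\<alpha> \<beta>. 0 < \<alpha> \<and> \<alpha> < 1 - \<theta> \<and> 1 - \<theta> < \<beta> \<longrightarrow>
    (\<exists>C\<^sub>\<alpha>>0. \<exists>C\<^sub>\<beta>>0. \<forall>n::nat.
      C\<^sub>\<beta> / growth_ell g \<beta> (real n)
        \<le> measure (M x0) {\<omega> \<in> space (M x0). growth_tau (X x0) A \<omega> > enat n} \<and>
      measure (M x0) {\<omega> \<in> space (M x0). growth_tau (X x0) A \<omega> > enat n}
        \<le> C\<^sub>\<alpha> / growth_ell g \<alpha> (real n))"
proof -
  obtain \<delta> C where \<delta>: "0 < \<delta>" and C: "0 < C" and moment: "\<And>x0 n. x0 \<in> S \<Longrightarrow> AE \<omega> in M x0.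
      nn_cond_exp (M x0) (F x0 n) (\<lambda>\<omega>. ennreal (\<bar>\<xi> x0 n \<omega>\<bar> powr (4 + \<delta>))) \<omega>
        \<le> ennreal (C * sigma2 (X x0 n \<omega>) powr ((4 + \<delta>) / 2))"
    using A3 by blast
  define q where "q = 4 + \<delta>"
  interpret drift: growth_drift g lam
    using A1_pos A1_diff A1_small lambda_pos lim_g by unfold_locales
  obtain a where a: "1 \<le> a"
    "\<And>x y. a \<le> x \<Longrightarrow> x \<le> y \<Longrightarrow> g y / y * y powr (lam/2) \<le> g x / x * x powr (lam/2)"
    "\<And>x y. a \<le> x \<Longrightarrow> x \<le> y \<Longrightarrow> g x / x * x powr (2*lam) \<le> g y / y * y powr (2*lam)"
    "\<And>x y. a \<le> x \<Longrightarrow> x \<le> y \<Longrightarrow> x / g x - lam/2 * growth_G g x \<le> y / g y - lam/2 * growth_G g y"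
    using drift.rate_regular by blast
  obtain m where m: "0 < m" "\<And>x. 1 \<le> x \<Longrightarrow> g x / x \<le> m" using drift.rate_bounded by blast
  obtain K c1 \<epsilon> where K: "0 < K" "0 < c1" "0 < \<epsilon>" and A2': "\<And>x y. K < x \<Longrightarrow> (1 - \<epsilon>) * x < y \<Longrightarrow> x * g x \<le> c1 * (y * g y)"
    using A2 by blast
  \<comment> \<open>a positive lower bound for \<open>y * g y\<close>\<close>
  define l where "l = (K + 1) * g (K + 1) / c1"
  have l: "0 < l" using K A1_pos[of "K + 1"] by (simp add: l_def)
  have xg: "l \<le> y * g y" if "K + 1 < y" for y
  proof -
    have "(1 - \<epsilon>) * (K + 1) \<le> 1 * (K + 1)" using K by (intro mult_right_mono) auto
    also have "\<dots> < y" using that by simp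
    finally have "(1 - \<epsilon>) * (K + 1) < y" .
    then show ?thesis using A2'[of "K + 1" y] K by (simp add: l_def pos_divide_le_eq mult.commute)
  qed
  \<comment> \<open>half a jump may be spent on the drift; the other half is the net displacement\<close>
  define j where "j = jump q C / 2"
  have j: "0 < j" using jump_pos(1)[of q C] by (simp add: j_def)
  have "2 / 3 * \<theta> < \<theta>" using theta by simp
  then have "eventually (\<lambda>x. 2 / 3 * \<theta> < 2 * x * g x / sigma2 x) at_top"
    by (rule order_tendstoD(1)[OF lim_sigma2])
  moreover have "eventually (\<lambda>x. 2 * x * g x / sigma2 x < 2) at_top"
    by (rule order_tendstoD(2)[OF lim_sigma2]) (use theta in simp)
  moreover have "eventually (\<lambda>x. g x / x < j\<^sup>2) at_top"
    by (rule order_tendstoD(2)[OF drift.rate_tendsto]) (use j in simp)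
  ultimately have "eventually (\<lambda>x. 2 / 3 * \<theta> < 2 * x * g x / sigma2 x \<and> 2 * x * g x / sigma2 x < 2 \<and> g x / x < j\<^sup>2) at_top"
    by eventually_elim blast
  then obtain N where N: "\<And>x. N \<le> x \<Longrightarrow> 2 / 3 * \<theta> < 2 * x * g x / sigma2 x"
      "\<And>x. N \<le> x \<Longrightarrow> 2 * x * g x / sigma2 x < 2" "\<And>x. N \<le> x \<Longrightarrow> g x / x < j\<^sup>2"
    by (auto simp: eventually_at_top_linorder)
  define A where "A = max a (max N (K + 1))"
  have A: "1 \<le> A" "a \<le> A" "N \<le> A" "K + 1 \<le> A" using a(1) by (auto simp: A_def)
  define b where "b = max m (sqrt (3 / \<theta> * m))"
  define \<eta> where "\<eta> = j * sqrt l"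
  have bounds: "g x / x \<le> b" "sqrt (sigma2 x) / x \<le> b" "(sqrt (sigma2 x) / x)\<^sup>2 \<le> 3 / \<theta> * (g x / x)"
    "g x \<le> j * sqrt (sigma2 x)" "\<eta> \<le> j * sqrt (sigma2 x)" if x: "A < x" for x
  proof -
    have x0: "0 < x" "1 \<le> x" "N \<le> x" "K + 1 < x" using x A by auto
    have s: "0 < sigma2 x" and g: "0 < g x" using sigma2_pos A1_pos x0 by auto
    have up: "sigma2 x \<le> 3 / \<theta> * (x * g x)"
      using N(1)[OF x0(3)] s theta by (simp add: field_simps)
    have low: "x * g x \<le> sigma2 x" using N(2)[OF x0(3)] s by (simp add: field_simps)
    show "g x / x \<le> b" using m(2)[OF x0(2)] by (simp add: b_def)
    have "(sqrt (sigma2 x) / x)\<^sup>2 = sigma2 x / x\<^sup>2" using s by (simp add: power_divide)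
    also have "\<dots> \<le> (3 / \<theta> * (x * g x)) / x\<^sup>2" using up by (intro divide_right_mono) auto
    also have "\<dots> = 3 / \<theta> * (g x / x)" using x0 by (simp add: power2_eq_square)
    finally show sq: "(sqrt (sigma2 x) / x)\<^sup>2 \<le> 3 / \<theta> * (g x / x)" .
    also have "\<dots> \<le> 3 / \<theta> * m" using m(2)[OF x0(2)] theta by (intro mult_left_mono) auto
    finally have "sqrt (sigma2 x) / x \<le> sqrt (3 / \<theta> * m)" by (rule real_le_rsqrt)
    then show "sqrt (sigma2 x) / x \<le> b" by (simp add: b_def)
    have "g x * g x \<le> j\<^sup>2 * x * g x"
      using N(3)[OF x0(3)] x0 g by (intro mult_right_mono) (auto simp: pos_divide_less_eq)
    also have "\<dots> \<le> j\<^sup>2 * sigma2 x" using mult_left_mono[OF low, of "j\<^sup>2"] by (simp add: mult.assoc)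
    also have "\<dots> = (j * sqrt (sigma2 x))\<^sup>2" using s by (simp add: power_mult_distrib)
    finally have "(g x)\<^sup>2 \<le> (j * sqrt (sigma2 x))\<^sup>2" by (simp add: power2_eq_square)
    then show "g x \<le> j * sqrt (sigma2 x)" by (rule power2_le_imp_le) (use j s in simp)
    have "l \<le> sigma2 x" using xg[OF x0(4)] low by linarith
    then show "\<eta> \<le> j * sqrt (sigma2 x)" using j by (simp add: \<eta>_def)
  qed
  have b0: "0 < b" using m by (simp add: b_def)
  have \<eta>0: "0 < \<eta>" using j l by (simp add: \<eta>_def)
  show ?thesis
  proof (rule exI[of _ A], intro conjI ballI allI impI; (elim conjE)?)
    show "0 < A" using A by simp
    fix x0 \<alpha> \<beta> assume "x0 \<in> S \<inter> {A<..}" and ab: "0 < \<alpha>" "\<alpha> < 1 - \<theta>" "1 - \<theta> < \<beta>"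
    then have x0: "x0 \<in> S" "A < x0" by auto
    interpret P: stochastic_growth_process "M x0" "F x0" S g sigma2 x0 "X x0" "\<xi> x0"
      by (rule process[OF x0(1)])
    interpret P: near_critical "M x0" "F x0" S g sigma2 x0 "X x0" "\<xi> x0" q C lam \<theta> A b \<eta>
    proof
      show "S \<subseteq> {0..}" by (rule S_nonneg)
      show "continuous_on {0..} g" by (rule drift.g_cont)
      show "4 < q" "0 < C" using \<delta> C by (auto simp: q_def)
      show "AE \<omega> in M x0. nn_cond_exp (M x0) (F x0 n) (\<lambda>\<omega>. ennreal (\<bar>\<xi> x0 n \<omega>\<bar> powr q)) \<omega>
        \<le> ennreal (C * sigma2 (X x0 n \<omega>) powr (q / 2))" for n
        unfolding q_def by (rule moment[OF x0(1)])
      show "((\<lambda>x. 2 * x * g x / sigma2 x) \<longlongrightarrow> \<theta>) at_top" by (rule lim_sigma2)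
    qed (use sigma2_pos A1_pos theta A b0 \<eta>0 bounds x0 a(2-4) in \<open>auto simp: j_def\<close>)
    have ell: "growth_ell g e (real n) = drift.clock (real n) powr e" for e n
      by (simp add: growth_ell_def drift.clock_def)
    have surv: "{\<omega> \<in> space (M x0). growth_tau (X x0) A \<omega> > enat n} = P.alive n" for n
      by (auto simp: P.alive_def growth_tau_gt_iff)
    obtain cu where cu: "0 < cu" "\<And>n. measure (M x0) (P.alive n) \<le> cu / drift.clock (real n) powr \<alpha>"
      using P.survival_upper[OF ab(1,2)] by blast
    define \<beta>' where "\<beta>' = min \<beta> (1 - \<theta> / 2)"
    have \<beta>': "1 - \<theta> < \<beta>'" "\<beta>' < 1" "\<beta>' \<le> \<beta>" using ab theta by (auto simp: \<beta>'_def)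
    obtain cl where cl: "0 < cl" "\<And>n. cl / drift.clock (real n) powr \<beta>' \<le> measure (M x0) (P.alive n)"
      using P.survival_lower[OF \<beta>'(1,2)] by blast
    have "cl / drift.clock (real n) powr \<beta> \<le> measure (M x0) (P.alive n)" for n
    proof -
      have "1 \<le> drift.clock (real n)" by (rule drift.clock_ge_1) simp
      then have "cl / drift.clock (real n) powr \<beta> \<le> cl / drift.clock (real n) powr \<beta>'"
        using cl(1) \<beta>'(3) by (intro divide_left_mono powr_mono mult_pos_pos) auto
      then show ?thesis using cl(2)[of n] by linarith
    qed
    then show "\<exists>C\<^sub>\<alpha>>0. \<exists>C\<^sub>\<beta>>0. \<forall>n::nat.
      C\<^sub>\<beta> / growth_ell g \<beta> (real n)
        \<le> measure (M x0) {\<omega> \<in> space (M x0). growth_tau (X x0) A \<omega> > enat n} \<and>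
      measure (M x0) {\<omega> \<in> space (M x0). growth_tau (X x0) A \<omega> > enat n}
        \<le> C\<^sub>\<alpha> / growth_ell g \<alpha> (real n)"
      unfolding ell surv using cu cl(1) by blast
  qed
qed

end
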